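(* Let $\Omega\subset\mathbb{R}^d$ ($d\in\mathbb{N}$) be a bounded domain with smooth boundary, $T>0$, $Q_T=\Omega\times(0,T]$. Let $\alpha:\mathbb{R}\to\mathbb{R}$ be non-decreasing and locally Lipschitz continuous with $\alpha(\mathbb{R})=\mathbb{R}$ and $\alpha(0)=0$. Let $z_0\in L^\infty(\Omega)$, $\mu>0$, $u_0=\alpha(z_0)$, $v_0=z_0-\mu\alpha(z_0)$. Let $[-M,M]$ and $L_\alpha>0$ be the bounded interval and Lipschitz constant described in the context, and assume $L_\alpha<1/\mu$. For $\varepsilon>0$ and $\xi\ge 0$ let $(u_{\varepsilon,\xi},v_{\varepsilon,\xi})$ be the strong solution of $(\mathrm{P}_{\varepsilon,\xi})$. Then for every fixed $\varepsilon>0$, as $\xi\to0$ (with $\xi>0$), $$u_{\varepsilon,\xi}\to u_{\varepsilon,0}\ \text{ strongly in }L^2(Q_T),\qquad v_{\varepsilon,\xi}\to v_{\varepsilon,0}\ \text{ strongly in }L^2(0,T;H^1_0(\Omega)),$$ where $(u_{\varepsilon,0},v_{\varepsilon,0})$ is the solution of $(\mathrm{P}_{\varepsilon,\xi})$ with $\xi=0$.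
   Context: Problem $(\mathrm{P}_{\varepsilon,\xi})$ ($\varepsilon>0$, $\xi\ge0$): $$\frac1\mu\frac{\partial u_{\varepsilon,\xi}}{\partial t}=\Delta u_{\varepsilon,\xi}-\frac1\varepsilon\bigl(u_{\varepsilon,\xi}-\alpha(\mu u_{\varepsilon,\xi}+v_{\varepsilon,\xi})\bigr),\qquad \xi\frac{\partial v_{\varepsilon,\xi}}{\partial t}=\Delta v_{\varepsilon,\xi}+\frac\mu\varepsilon\bigl(u_{\varepsilon,\xi}-\alpha(\mu u_{\varepsilon,\xi}+v_{\varepsilon,\xi})\bigr)\quad\text{in }Q_T,$$ with $u_{\varepsilon,\xi}=v_{\varepsilon,\xi}=0$ on $\partial\Omega\times(0,T]$, $u_{\varepsilon,\xi}(0)=u_0$ and, if $\xi>0$, $v_{\varepsilon,\xi}(0)=v_0$ (for $\xi=0$ the second equation is elliptic and no initial condition on $v$ is imposed). Strong solution: the equations hold in $L^2(\Omega)$ for each $t\in(0,T]$, and $u_{\varepsilon,\xi}$ (and, if $\xi>0$, also $v_{\varepsilon,\xi}$) belongs to $C([0,T];L^2(\Omega))\cap C^1((0,T];L^2(\Omega))\cap C((0,T];H^1_0(\Omega)\cap H^2(\Omega))$; if $\xi=0$, $v_{\varepsilon,0}\in C([0,T];H^1_0(\Omega)\cap H^2(\Omega))$. Put $z_{\varepsilon,\xi}=\mu u_{\varepsilon,\xi}+v_{\varepsilon,\xi}$. Interval and Lipschitz constant: $[-M,M]$, $M>0$, is a bounded interval (coming from the $L^\infty$-bounds of the data) which contains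 the values of $z_0$ and of all the functions $z_{\varepsilon,\xi}$ (a.e.), and $L_\alpha>0$ is a Lipschitz constant of $\alpha$ on $[-M,M]$. Solutions of $(\mathrm{P}_{\varepsilon,\xi})$ are understood as those with $z_{\varepsilon,\xi}\in[-M,M]$ a.e.; accordingly $\alpha$ may be replaced outside $[-M,M]$ by its linear extension of slope $L_\alpha$, i.e. treated as globally Lipschitz with constant $L_\alpha$. *)

theory Defs
  imports "HOL-Analysis.Analysis"
begin

section \<open>Function spaces\<close>

text \<open>
  Elements of Lebesgue and Sobolev spaces are represented by functions on the whole space; only
  their values on the underlying set matter, and only up to null sets.  In particular the norms
  below are norms after identifying functions that agree almost everywhere.
\<close>

definition L2_space :: "'a::euclidean_space set \<Rightarrow> ('a \<Rightarrow> real) set" where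
  "L2_space S = {f. f \<in> borel_measurable (lebesgue_on S) \<and>
                    integrable (lebesgue_on S) (\<lambda>x. (f x)\<^sup>2)}"

definition L2_norm :: "'a::euclidean_space set \<Rightarrow> ('a \<Rightarrow> real) \<Rightarrow> real" where
  "L2_norm S f = sqrt (integral\<^sup>L (lebesgue_on S) (\<lambda>x. (f x)\<^sup>2))"

definition Linf_space :: "'a::euclidean_space set \<Rightarrow> ('a \<Rightarrow> real) set" where
  "Linf_space S = {f. f \<in> borel_measurable (lebesgue_on S) \<and>
                      (\<exists>C. AE x in lebesgue_on S. \<bar>f x\<bar> \<le> C)}"

text \<open>Intended for open \<open>S\<close>; all directional derivatives are differentiated again.\<close>

fun Ck_on :: "nat \<Rightarrow> 'a::euclidean_space set \<Rightarrow> ('a \<Rightarrow> real) \<Rightarrow> bool" where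
  "Ck_on 0 S f \<longleftrightarrow> continuous_on S f"
| "Ck_on (Suc k) S f \<longleftrightarrow> (\<forall>x\<in>S. f differentiable (at x)) \<and>
     (\<forall>h. Ck_on k S (\<lambda>x. frechet_derivative f (at x) h))"

definition smooth_on :: "'a::euclidean_space set \<Rightarrow> ('a \<Rightarrow> real) \<Rightarrow> bool" where
  "smooth_on S f \<longleftrightarrow> (\<forall>k. Ck_on k S f)"

definition test_functions :: "'a::euclidean_space set \<Rightarrow> ('a \<Rightarrow> real) set" where
  "test_functions \<Omega> = {\<phi>. smooth_on UNIV \<phi> \<and>
     compact (closure {x. \<phi> x \<noteq> 0}) \<and> closure {x. \<phi> x \<noteq> 0} \<subseteq> \<Omega>}"

definition has_weak_deriv ::
    "'a::euclidean_space set \<Rightarrow> 'a \<Rightarrow> ('a \<Rightarrow> real) \<Rightarrow> ('a \<Rightarrow> real) \<Rightarrow> bool" where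
  "has_weak_deriv \<Omega> b f g \<longleftrightarrow> f \<in> L2_space \<Omega> \<and> g \<in> L2_space \<Omega> \<and>
     (\<forall>\<phi>\<in>test_functions \<Omega>.
        integral\<^sup>L (lebesgue_on \<Omega>) (\<lambda>x. f x * frechet_derivative \<phi> (at x) b) =
        - integral\<^sup>L (lebesgue_on \<Omega>) (\<lambda>x. g x * \<phi> x))"

text \<open>On open sets weak derivatives are unique up to null sets, so the choice made here is
  immaterial wherever a weak derivative exists.\<close>

definition weak_deriv :: "'a::euclidean_space set \<Rightarrow> 'a \<Rightarrow> ('a \<Rightarrow> real) \<Rightarrow> ('a \<Rightarrow> real)" where
  "weak_deriv \<Omega> b f = (SOME g. has_weak_deriv \<Omega> b f g)"

definition H1_space :: "'a::euclidean_space set \<Rightarrow> ('a \<Rightarrow> real) set" where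
  "H1_space \<Omega> = {f \<in> L2_space \<Omega>. \<forall>b\<in>Basis. \<exists>g. has_weak_deriv \<Omega> b f g}"

definition H1_norm :: "'a::euclidean_space set \<Rightarrow> ('a \<Rightarrow> real) \<Rightarrow> real" where
  "H1_norm \<Omega> f = sqrt ((L2_norm \<Omega> f)\<^sup>2 + (\<Sum>b\<in>Basis. (L2_norm \<Omega> (weak_deriv \<Omega> b f))\<^sup>2))"

definition H10_space :: "'a::euclidean_space set \<Rightarrow> ('a \<Rightarrow> real) set" where
  "H10_space \<Omega> = {f \<in> H1_space \<Omega>.
     \<forall>\<delta>>0. \<exists>\<phi>\<in>test_functions \<Omega>. H1_norm \<Omega> (\<lambda>x. f x - \<phi> x) < \<delta>}"

definition H2_space :: "'a::euclidean_space set \<Rightarrow> ('a \<Rightarrow> real) set" where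
  "H2_space \<Omega> = {f \<in> H1_space \<Omega>. \<forall>b\<in>Basis. weak_deriv \<Omega> b f \<in> H1_space \<Omega>}"

definition H2_norm :: "'a::euclidean_space set \<Rightarrow> ('a \<Rightarrow> real) \<Rightarrow> real" where
  "H2_norm \<Omega> f = sqrt ((L2_norm \<Omega> f)\<^sup>2 + (\<Sum>b\<in>Basis. (H1_norm \<Omega> (weak_deriv \<Omega> b f))\<^sup>2))"

definition weak_laplacian :: "'a::euclidean_space set \<Rightarrow> ('a \<Rightarrow> real) \<Rightarrow> ('a \<Rightarrow> real)" where
  "weak_laplacian \<Omega> f = (\<lambda>x. \<Sum>b\<in>Basis. weak_deriv \<Omega> b (weak_deriv \<Omega> b f) x)"

section \<open>Functions of time with values in a function space\<close>

text \<open>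
  A time-dependent function is written \<open>w t x\<close>.  The parameters \<open>X\<close> and \<open>N\<close> are one of the
  function spaces above and its norm.
\<close>

definition C_time ::
    "real set \<Rightarrow> ('a \<Rightarrow> real) set \<Rightarrow> (('a \<Rightarrow> real) \<Rightarrow> real) \<Rightarrow> (real \<Rightarrow> 'a \<Rightarrow> real) set" where
  "C_time I X N = {w. (\<forall>t\<in>I. w t \<in> X) \<and>
     (\<forall>t\<in>I. ((\<lambda>s. N (\<lambda>x. w s x - w t x)) \<longlongrightarrow> 0) (at t within I))}"

text \<open>\<open>w\<close> is of class \<open>C\<^sup>1(I; X)\<close> with derivative \<open>w'\<close>, the difference quotients converging in \<open>X\<close>;
  one-sided derivatives are meant at end points belonging to \<open>I\<close>.\<close>

definition has_C1_deriv ::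
    "real set \<Rightarrow> ('a \<Rightarrow> real) set \<Rightarrow> (('a \<Rightarrow> real) \<Rightarrow> real) \<Rightarrow>
     (real \<Rightarrow> 'a \<Rightarrow> real) \<Rightarrow> (real \<Rightarrow> 'a \<Rightarrow> real) \<Rightarrow> bool" where
  "has_C1_deriv I X N w w' \<longleftrightarrow> w \<in> C_time I X N \<and> w' \<in> C_time I X N \<and>
     (\<forall>t\<in>I. ((\<lambda>s. N (\<lambda>x. (w s x - w t x) / (s - t) - w' t x)) \<longlongrightarrow> 0) (at t within I))"

text \<open>Bochner spaces \<open>L\<^sup>2(0,T; X)\<close>: strong measurability means being almost everywhere the limit
  of a sequence of measurable simple functions.\<close>

definition strongly_measurable_time ::
    "real \<Rightarrow> ('a \<Rightarrow> real) set \<Rightarrow> (('a \<Rightarrow> real) \<Rightarrow> real) \<Rightarrow> (real \<Rightarrow> 'a \<Rightarrow> real) \<Rightarrow> bool" where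
  "strongly_measurable_time T X N w \<longleftrightarrow> (\<exists>s :: nat \<Rightarrow> real \<Rightarrow> 'a \<Rightarrow> real.
     (\<forall>n. s n ` {0<..<T} \<subseteq> X \<and> finite (s n ` {0<..<T}) \<and>
          (\<forall>f. {t \<in> {0<..<T}. s n t = f} \<in> sets lebesgue)) \<and>
     (AE t in lebesgue_on {0<..<T}. (\<lambda>n. N (\<lambda>x. s n t x - w t x)) \<longlonglongrightarrow> 0))"

definition L2_time_space ::
    "real \<Rightarrow> ('a \<Rightarrow> real) set \<Rightarrow> (('a \<Rightarrow> real) \<Rightarrow> real) \<Rightarrow> (real \<Rightarrow> 'a \<Rightarrow> real) set" where
  "L2_time_space T X N = {w. (AE t in lebesgue_on {0<..<T}. w t \<in> X) \<and>
     strongly_measurable_time T X N w \<and>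
     integrable (lebesgue_on {0<..<T}) (\<lambda>t. (N (w t))\<^sup>2)}"

definition L2_time_norm ::
    "real \<Rightarrow> (('a \<Rightarrow> real) \<Rightarrow> real) \<Rightarrow> (real \<Rightarrow> 'a \<Rightarrow> real) \<Rightarrow> real" where
  "L2_time_norm T N w = sqrt (integral\<^sup>L (lebesgue_on {0<..<T}) (\<lambda>t. (N (w t))\<^sup>2))"

section \<open>The domain\<close>

text \<open>
  Near each boundary point \<open>\<Omega>\<close> is the set strictly above a smooth graph, in the direction of some
  unit vector \<open>e\<close>.  The graph function is evaluated only on the hyperplane orthogonal to \<open>e\<close>.
\<close>

definition smooth_boundary :: "'a::euclidean_space set \<Rightarrow> bool" where
  "smooth_boundary \<Omega> \<longleftrightarrow> (\<forall>p\<in>frontier \<Omega>. \<exists>r>0. \<exists>e \<gamma>.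
     norm e = 1 \<and> smooth_on UNIV \<gamma> \<and>
     \<Omega> \<inter> ball p r = {x \<in> ball p r. x \<bullet> e > \<gamma> (x - (x \<bullet> e) *\<^sub>R e)})"

definition smooth_bounded_domain :: "'a::euclidean_space set \<Rightarrow> bool" where
  "smooth_bounded_domain \<Omega> \<longleftrightarrow>
     open \<Omega> \<and> connected \<Omega> \<and> \<Omega> \<noteq> {} \<and> bounded \<Omega> \<and> smooth_boundary \<Omega>"

definition Q :: "'a::euclidean_space set \<Rightarrow> real \<Rightarrow> ('a \<times> real) set" where
  "Q \<Omega> T = \<Omega> \<times> {0<..T}"

section \<open>Strong solutions\<close>

text \<open>
  The condition of joint measurability selects a representative \<open>(x, t) \<mapsto> w t x\<close> of the
  element of \<open>L\<^sup>2(Q\<^sub>T)\<close> given by \<open>w \<in> C([0,T]; L\<^sup>2(\<Omega>))\<close>.  It has to be demanded because arbitrary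
  choices of representatives of the \<open>w t\<close> need not fit together measurably; it is no restriction
  on the underlying curve in \<open>L\<^sup>2(\<Omega>)\<close>.
\<close>

definition jointly_measurable ::
    "'a::euclidean_space set \<Rightarrow> real \<Rightarrow> (real \<Rightarrow> 'a \<Rightarrow> real) \<Rightarrow> bool" where
  "jointly_measurable \<Omega> T w \<longleftrightarrow> (\<lambda>(x, t). w t x) \<in> borel_measurable (lebesgue_on (Q \<Omega> T))"

text \<open>
  The regularity of an unknown with an evolution equation, \<open>w'\<close> being its time derivative.
  The homogeneous Dirichlet condition is contained in \<open>w t \<in> H10_space \<Omega>\<close>.
\<close>

definition evolution_regularity ::
    "'a::euclidean_space set \<Rightarrow> real \<Rightarrow> (real \<Rightarrow> 'a \<Rightarrow> real) \<Rightarrow> (real \<Rightarrow> 'a \<Rightarrow> real) \<Rightarrow> bool" where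
  "evolution_regularity \<Omega> T w w' \<longleftrightarrow>
     w \<in> C_time {0..T} (L2_space \<Omega>) (L2_norm \<Omega>) \<and>
     has_C1_deriv {0<..T} (L2_space \<Omega>) (L2_norm \<Omega>) w w' \<and>
     w \<in> C_time {0<..T} (H10_space \<Omega> \<inter> H2_space \<Omega>) (H2_norm \<Omega>)"

text \<open>
  For \<open>\<xi> = 0\<close> the function \<open>v'\<close> is unconstrained and enters only through the product \<open>\<xi> * v' t x = 0\<close>.
\<close>

definition strong_solution ::
    "'a::euclidean_space set \<Rightarrow> real \<Rightarrow> (real \<Rightarrow> real) \<Rightarrow> real \<Rightarrow> ('a \<Rightarrow> real) \<Rightarrow> ('a \<Rightarrow> real) \<Rightarrow>
     real \<Rightarrow> real \<Rightarrow> (real \<Rightarrow> 'a \<Rightarrow> real) \<Rightarrow> (real \<Rightarrow> 'a \<Rightarrow> real) \<Rightarrow> bool" where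
  "strong_solution \<Omega> T \<alpha> \<mu> u0 v0 \<epsilon> \<xi> u v \<longleftrightarrow>
     jointly_measurable \<Omega> T u \<and> jointly_measurable \<Omega> T v \<and>
     (\<exists>u' v'.
        evolution_regularity \<Omega> T u u' \<and>
        (if \<xi> > 0 then evolution_regularity \<Omega> T v v'
         else v \<in> C_time {0..T} (H10_space \<Omega> \<inter> H2_space \<Omega>) (H2_norm \<Omega>)) \<and>
        (\<forall>t\<in>{0<..T}. AE x in lebesgue_on \<Omega>.
           1 / \<mu> * u' t x =
             weak_laplacian \<Omega> (u t) x - 1 / \<epsilon> * (u t x - \<alpha> (\<mu> * u t x + v t x))) \<and>
        (\<forall>t\<in>{0<..T}. AE x in lebesgue_on \<Omega>.
           \<xi> * v' t x =
             weak_laplacian \<Omega> (v t) x + \<mu> / \<epsilon> * (u t x - \<alpha> (\<mu> * u t x + v t x)))) \<and>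
     (AE x in lebesgue_on \<Omega>. u 0 x = u0 x) \<and>
     (\<xi> > 0 \<longrightarrow> (AE x in lebesgue_on \<Omega>. v 0 x = v0 x))"

section \<open>Strong convergence\<close>

definition converges_L2_Q ::
    "'a::euclidean_space set \<Rightarrow> real \<Rightarrow> (real \<Rightarrow> real \<Rightarrow> 'a \<Rightarrow> real) \<Rightarrow> (real \<Rightarrow> 'a \<Rightarrow> real) \<Rightarrow> bool" where
  "converges_L2_Q \<Omega> T w w0 \<longleftrightarrow>
     (\<forall>\<xi>>0. (\<lambda>(x, t). w \<xi> t x) \<in> L2_space (Q \<Omega> T)) \<and>
     (\<lambda>(x, t). w0 t x) \<in> L2_space (Q \<Omega> T) \<and>
     ((\<lambda>\<xi>. L2_norm (Q \<Omega> T) (\<lambda>(x, t). w \<xi> t x - w0 t x)) \<longlongrightarrow> 0) (at_right 0)"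

definition converges_L2_H10 ::
    "'a::euclidean_space set \<Rightarrow> real \<Rightarrow> (real \<Rightarrow> real \<Rightarrow> 'a \<Rightarrow> real) \<Rightarrow> (real \<Rightarrow> 'a \<Rightarrow> real) \<Rightarrow> bool" where
  "converges_L2_H10 \<Omega> T w w0 \<longleftrightarrow>
     (\<forall>\<xi>>0. w \<xi> \<in> L2_time_space T (H10_space \<Omega>) (H1_norm \<Omega>)) \<and>
     w0 \<in> L2_time_space T (H10_space \<Omega>) (H1_norm \<Omega>) \<and>
     ((\<lambda>\<xi>. L2_time_norm T (H1_norm \<Omega>) (\<lambda>t x. w \<xi> t x - w0 t x)) \<longlongrightarrow> 0) (at_right 0)"

end

theory Submission
  imports Defs
begin

text \<open>
  Let \<open>U\<close> and \<open>V\<close> be the differences of the solutions for \<open>\<xi>\<close> and for \<open>0\<close>.  Testing the difference of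
  the parabolic equations with \<open>U\<close> and that of the second equations with \<open>V\<close>, and using the
  monotonicity of \<open>\<alpha>\<close> and Poincare's inequality, gives
  \<open>d/dt \<parallel>U\<parallel>\<^sup>2 + \<xi> (\<partial>\<^sub>t v\<^sub>\<xi>, V) + \<parallel>\<nabla>V\<parallel>\<^sup>2 / 4 \<le> C \<parallel>U\<parallel>\<^sup>2\<close>.  The middle term is \<open>(\<xi> / 2) d/dt \<parallel>V\<parallel>\<^sup>2\<close> except that \<open>v\<^sub>0\<close> need
  not be differentiable in time; but the elliptic equation makes \<open>v\<^sub>0\<close> a Lipschitz function of \<open>u\<^sub>0\<close>,
  hence of time on \<open>[\<delta>, T]\<close>, so that the error is at most \<open>C\<^sub>\<delta> \<xi>\<close>.  Gronwall's inequality on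
  \<open>[\<delta>, T]\<close> and the crude energy estimates, uniform in \<open>\<xi>\<close>, on \<open>[0, \<delta>]\<close> bound everything by
  \<open>A \<delta> + B\<^sub>\<delta> \<xi>\<close>.  Let first \<open>\<xi>\<close> and then \<open>\<delta>\<close> tend to zero.
\<close>

section \<open>The semi-inner product of square integrable functions\<close>

text \<open>Two things go wrong at t = 0. The prescribed \<open>v0\<close> need not be the value of
  the elliptic solution at time 0, so V may have an initial layer; but its square enters the energy
  with weight \<xi> / 2, so any bounded starting value costs only O(\<xi>). And the time derivative
  of u for \<xi> = 0 is known to be bounded only away from 0, which is why the Lipschitz argument
  starts at \<delta>.

  The condition \<open>L\<^sub>\<alpha> < 1 / \<mu>\<close> controls the coupling. Let A be the
  difference of the values of \<alpha>, so that the reactions differ by U - A. In the equation for U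
  one has |A| \<le> L (\<mu> |U| + |V|), and L \<mu> < 1 lets the damping term absorb L \<mu> U^2.
  In the equation for V, monotonicity together with the Lipschitz bound gives A (\<mu> U + V) \<ge>
  A^2 / L, and this bounds -A V by a multiple of U^2.

  Uniformity in \<xi> comes from the constraint on z: the energy bound on u never sees \<xi>, and v
  = z - \<mu> u inherits it. The constraint is given almost everywhere on the cylinder and must
  first be transferred to every single time.\<close>

definition L2_ip :: "'a::euclidean_space set \<Rightarrow> ('a \<Rightarrow> real) \<Rightarrow> ('a \<Rightarrow> real) \<Rightarrow> real" where
  "L2_ip S f g = integral\<^sup>L (lebesgue_on S) (\<lambda>x. f x * g x)"

lemma L2_space_measurable: "f \<in> L2_space S \<Longrightarrow> f \<in> borel_measurable (lebesgue_on S)"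
  by (simp add: L2_space_def)

lemma L2_space_integrable_sq: "f \<in> L2_space S \<Longrightarrow> integrable (lebesgue_on S) (\<lambda>x. (f x)\<^sup>2)"
  by (simp add: L2_space_def)

lemma L2_spaceI:
  "f \<in> borel_measurable (lebesgue_on S) \<Longrightarrow> integrable (lebesgue_on S) (\<lambda>x. (f x)\<^sup>2) \<Longrightarrow> f \<in> L2_space S"
  by (simp add: L2_space_def)

lemma L2_space_integrable_mult:
  assumes "f \<in> L2_space S" "g \<in> L2_space S"
  shows "integrable (lebesgue_on S) (\<lambda>x. f x * g x)"
proof (rule Bochner_Integration.integrable_bound)
  show "integrable (lebesgue_on S) (\<lambda>x. (f x)\<^sup>2 + (g x)\<^sup>2)"
    using assms by (simp add: L2_space_def)
  show "(\<lambda>x. f x * g x) \<in> borel_measurable (lebesgue_on S)"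
    using assms by (intro borel_measurable_times L2_space_measurable)
  have "\<bar>a * b\<bar> \<le> a\<^sup>2 + b\<^sup>2" for a b :: real
    using sum_squares_bound[of "\<bar>a\<bar>" "\<bar>b\<bar>"] zero_le_power2[of a] zero_le_power2[of b] abs_ge_zero[of "a * b"]
    unfolding abs_mult power2_abs by linarith
  then show "AE x in lebesgue_on S. norm (f x * g x) \<le> norm ((f x)\<^sup>2 + (g x)\<^sup>2)"
    by (intro AE_I2) (smt (verit) real_norm_def)
qed

lemma L2_space_scale: "f \<in> L2_space S \<Longrightarrow> (\<lambda>x. c * f x) \<in> L2_space S"
  by (rule L2_spaceI[OF borel_measurable_times[OF borel_measurable_const L2_space_measurable]])
    (simp_all add: L2_space_integrable_sq power_mult_distrib)

lemma L2_space_add: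
  assumes "f \<in> L2_space S" "g \<in> L2_space S"
  shows "(\<lambda>x. f x + g x) \<in> L2_space S"
proof -
  have "integrable (lebesgue_on S) (\<lambda>x. (f x)\<^sup>2 + (g x)\<^sup>2 + 2 * (f x * g x))"
    using assms L2_space_integrable_mult[OF assms] by (simp add: L2_space_def)
  then have "integrable (lebesgue_on S) (\<lambda>x. (f x + g x)\<^sup>2)"
    by (simp add: power2_eq_square algebra_simps)
  then show ?thesis
    by (rule L2_spaceI[OF borel_measurable_add[OF assms[THEN L2_space_measurable]]])
qed

lemma L2_space_uminus: "f \<in> L2_space S \<Longrightarrow> (\<lambda>x. - f x) \<in> L2_space S"
  using L2_space_scale[of f S "-1"] by simp

lemma L2_space_diff:
  "f \<in> L2_space S \<Longrightarrow> g \<in> L2_space S \<Longrightarrow> (\<lambda>x. f x - g x) \<in> L2_space S"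
  using L2_space_add[of f S "\<lambda>x. - g x"] L2_space_uminus[of g S] by simp

lemma L2_space_divide: "f \<in> L2_space S \<Longrightarrow> (\<lambda>x. f x / c) \<in> L2_space S"
  using L2_space_scale[of f S "inverse c"] by (simp add: field_simps)

lemma L2_space_zero: "(\<lambda>x. 0) \<in> L2_space S"
  by (simp add: L2_space_def)

lemma L2_space_sum:
  "finite I \<Longrightarrow> (\<And>i. i \<in> I \<Longrightarrow> f i \<in> L2_space S) \<Longrightarrow> (\<lambda>x. \<Sum>i\<in>I. f i x) \<in> L2_space S"
  by (induction rule: finite_induct) (auto intro: L2_space_zero L2_space_add)

lemma L2_ip_self: "L2_ip S f f = (L2_norm S f)\<^sup>2"
  by (simp add: L2_ip_def L2_norm_def power2_eq_square)

lemma L2_norm_nonneg [simp]: "L2_norm S f \<ge> 0"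
  by (simp add: L2_norm_def)

lemma L2_norm_zero [simp]: "L2_norm S (\<lambda>x. 0) = 0"
  by (simp add: L2_norm_def)

lemma L2_ip_commute: "L2_ip S f g = L2_ip S g f"
  by (simp add: L2_ip_def mult.commute)

lemma L2_ip_add_left:
  assumes "f \<in> L2_space S" "g \<in> L2_space S" "h \<in> L2_space S"
  shows "L2_ip S (\<lambda>x. f x + g x) h = L2_ip S f h + L2_ip S g h"
  using assms by (simp add: L2_ip_def distrib_right Bochner_Integration.integral_add L2_space_integrable_mult)

lemma L2_ip_diff_left:
  assumes "f \<in> L2_space S" "g \<in> L2_space S" "h \<in> L2_space S"
  shows "L2_ip S (\<lambda>x. f x - g x) h = L2_ip S f h - L2_ip S g h"
  using assms by (simp add: L2_ip_def left_diff_distrib Bochner_Integration.integral_diff L2_space_integrable_mult)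

lemma L2_ip_scale_left: "L2_ip S (\<lambda>x. c * f x) g = c * L2_ip S f g"
  by (simp add: L2_ip_def mult.assoc)

lemma L2_ip_divide_left: "L2_ip S (\<lambda>x. f x / c) g = L2_ip S f g / c"
  using L2_ip_scale_left[of S "inverse c" f g] by (simp add: field_simps)

lemma L2_ip_add_right:
  assumes "f \<in> L2_space S" "g \<in> L2_space S" "h \<in> L2_space S"
  shows "L2_ip S h (\<lambda>x. f x + g x) = L2_ip S h f + L2_ip S h g"
  using L2_ip_add_left[OF assms] by (simp add: L2_ip_commute)

lemma L2_ip_diff_right:
  assumes "f \<in> L2_space S" "g \<in> L2_space S" "h \<in> L2_space S"
  shows "L2_ip S h (\<lambda>x. f x - g x) = L2_ip S h f - L2_ip S h g"
  using L2_ip_diff_left[OF assms] by (simp add: L2_ip_commute)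

lemma L2_ip_sum_left:
  assumes "finite I" "\<And>i. i \<in> I \<Longrightarrow> f i \<in> L2_space S" "g \<in> L2_space S"
  shows "L2_ip S (\<lambda>x. \<Sum>i\<in>I. f i x) g = (\<Sum>i\<in>I. L2_ip S (f i) g)"
  using assms(1,2)
proof (induction rule: finite_induct)
  case empty
  then show ?case by (simp add: L2_ip_def)
next
  case (insert a I)
  then show ?case by (simp add: L2_ip_add_left L2_space_sum assms(3))
qed

lemma L2_ip_cong_AE:
  assumes "AE x in lebesgue_on S. f x = f' x" "AE x in lebesgue_on S. g x = g' x"
    and "f \<in> L2_space S" "f' \<in> L2_space S" "g \<in> L2_space S" "g' \<in> L2_space S"
  shows "L2_ip S f g = L2_ip S f' g'"
  unfolding L2_ip_def
  by (intro integral_cong_AE borel_measurable_times L2_space_measurable assms) (use assms(1,2) in auto)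

lemma L2_norm_cong_AE:
  assumes "AE x in lebesgue_on S. f x = g x" "f \<in> L2_space S" "g \<in> L2_space S"
  shows "L2_norm S f = L2_norm S g"
proof -
  have "(L2_norm S f)\<^sup>2 = (L2_norm S g)\<^sup>2"
    unfolding L2_ip_self[symmetric] by (rule L2_ip_cong_AE) (use assms in auto)
  then show ?thesis by (simp add: power2_eq_iff_nonneg)
qed

lemma L2_norm_eq_0_AE:
  assumes "f \<in> L2_space S" "L2_norm S f = 0"
  shows "AE x in lebesgue_on S. f x = 0"
proof -
  have "integral\<^sup>L (lebesgue_on S) (\<lambda>x. (f x)\<^sup>2) = 0"
    using assms(2) by (simp add: L2_norm_def)
  then have "AE x in lebesgue_on S. (f x)\<^sup>2 = 0"
    by (subst (asm) integral_nonneg_eq_0_iff_AE[OF L2_space_integrable_sq[OF assms(1)]]) auto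
  then show ?thesis by simp
qed

lemma L2_norm_scale: "L2_norm S (\<lambda>x. c * f x) = \<bar>c\<bar> * L2_norm S f"
  by (simp add: L2_norm_def power_mult_distrib real_sqrt_mult)

lemma L2_norm_uminus [simp]: "L2_norm S (\<lambda>x. - f x) = L2_norm S f"
  by (simp add: L2_norm_def)

lemma L2_norm_minus_commute: "L2_norm S (\<lambda>x. f x - g x) = L2_norm S (\<lambda>x. g x - f x)"
  by (simp add: L2_norm_def power2_commute)

lemma L2_norm_diff_sq:
  assumes "f \<in> L2_space S" "g \<in> L2_space S"
  shows "(L2_norm S (\<lambda>x. f x - g x))\<^sup>2 = (L2_norm S f)\<^sup>2 - 2 * L2_ip S f g + (L2_norm S g)\<^sup>2"
  unfolding L2_ip_self[symmetric]
  using assms L2_space_diff[OF assms]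
  by (simp add: L2_ip_diff_left L2_ip_diff_right L2_ip_commute[of S g f])

lemma L2_norm_add_sq:
  assumes "f \<in> L2_space S" "g \<in> L2_space S"
  shows "(L2_norm S (\<lambda>x. f x + g x))\<^sup>2 = (L2_norm S f)\<^sup>2 + 2 * L2_ip S f g + (L2_norm S g)\<^sup>2"
  unfolding L2_ip_self[symmetric]
  using assms L2_space_add[OF assms]
  by (simp add: L2_ip_add_left L2_ip_add_right L2_ip_commute[of S g f])

lemma L2_Cauchy_Schwarz:
  assumes "f \<in> L2_space S" "g \<in> L2_space S"
  shows "\<bar>L2_ip S f g\<bar> \<le> L2_norm S f * L2_norm S g"
proof -
  let ?a = "L2_norm S f" and ?b = "L2_norm S g" and ?c = "L2_ip S f g"
  \<comment> \<open>Null functions make this only a semi-inner product, so both norms may vanish.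
    Two free scalars replace the usual division by a norm.\<close>
  have q: "0 \<le> s\<^sup>2 * ?a\<^sup>2 - 2 * s * t * ?c + t\<^sup>2 * ?b\<^sup>2" for s t
  proof -
    have "0 \<le> (L2_norm S (\<lambda>x. s * f x - t * g x))\<^sup>2" by simp
    also have "\<dots> = s\<^sup>2 * ?a\<^sup>2 - 2 * s * t * ?c + t\<^sup>2 * ?b\<^sup>2"
      using L2_norm_diff_sq[OF L2_space_scale[OF assms(1), of s] L2_space_scale[OF assms(2), of t]]
      by (simp add: L2_norm_scale power_mult_distrib L2_ip_scale_left L2_ip_commute[of S f "\<lambda>x. t * g x"]
           L2_ip_commute[of S g f])
    finally show ?thesis .
  qed
  have "?c\<^sup>2 \<le> ?a\<^sup>2 * ?b\<^sup>2"
  proof (cases "?a = 0 \<and> ?b = 0")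
    case True
    have "0 \<le> - 2 * ?c" "0 \<le> 2 * ?c" using q[of 1 1] q[of 1 "-1"] True by auto
    then show ?thesis using True by simp
  next
    case False
    show ?thesis
    proof (cases "?b = 0")
      case True
      then have a: "?a\<^sup>2 > 0" using False by simp
      have "0 \<le> ?c\<^sup>2 * ?a\<^sup>2 - 2 * ?c * ?a\<^sup>2 * ?c" using q[of ?c "?a\<^sup>2"] True by simp
      then have "0 \<le> - (?c\<^sup>2 * ?a\<^sup>2)" by (simp add: power2_eq_square algebra_simps)
      then have "?c = 0" using a by (simp add: mult_le_0_iff)
      then show ?thesis by simp
    next
      case False
      then have b: "?b\<^sup>2 > 0" by simp
      have "0 \<le> ?b\<^sup>2 * (?a\<^sup>2 * ?b\<^sup>2 - ?c\<^sup>2)"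
        using q[of "?b\<^sup>2" ?c] by (simp add: power2_eq_square algebra_simps)
      then show ?thesis using b by (simp add: zero_le_mult_iff)
    qed
  qed
  then show ?thesis
    by (metis abs_le_square_iff abs_of_nonneg L2_norm_nonneg mult_nonneg_nonneg power_mult_distrib)
qed

lemma L2_norm_triangle:
  assumes "f \<in> L2_space S" "g \<in> L2_space S"
  shows "L2_norm S (\<lambda>x. f x + g x) \<le> L2_norm S f + L2_norm S g"
proof (rule power2_le_imp_le)
  show "(L2_norm S (\<lambda>x. f x + g x))\<^sup>2 \<le> (L2_norm S f + L2_norm S g)\<^sup>2"
    using L2_norm_add_sq[OF assms] L2_Cauchy_Schwarz[OF assms] by (simp add: power2_sum)
qed simp

lemma L2_norm_triangle_diff:
  assumes "f \<in> L2_space S" "g \<in> L2_space S"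
  shows "L2_norm S (\<lambda>x. f x - g x) \<le> L2_norm S f + L2_norm S g"
  using L2_norm_triangle[OF assms(1) L2_space_uminus[OF assms(2)]] by simp

lemma L2_norm_triangle_sub:
  assumes "f \<in> L2_space S" "g \<in> L2_space S"
  shows "L2_norm S f \<le> L2_norm S g + L2_norm S (\<lambda>x. f x - g x)"
  using L2_norm_triangle[OF assms(2) L2_space_diff[OF assms]] by simp

lemma L2_norm_diff_abs:
  assumes "f \<in> L2_space S" "g \<in> L2_space S"
  shows "\<bar>L2_norm S f - L2_norm S g\<bar> \<le> L2_norm S (\<lambda>x. f x - g x)"
  using L2_norm_triangle_sub[OF assms] L2_norm_triangle_sub[OF assms(2,1)]
  by (simp add: L2_norm_minus_commute[of S g f])

section \<open>Limits with respect to the L2 norm\<close>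

lemma L2_tendsto_add:
  assumes "((\<lambda>s. L2_norm S (\<lambda>x. f s x - a x)) \<longlongrightarrow> 0) F" "((\<lambda>s. L2_norm S (\<lambda>x. g s x - b x)) \<longlongrightarrow> 0) F"
    and "\<forall>\<^sub>F s in F. f s \<in> L2_space S" "\<forall>\<^sub>F s in F. g s \<in> L2_space S" "a \<in> L2_space S" "b \<in> L2_space S"
  shows "((\<lambda>s. L2_norm S (\<lambda>x. (f s x + g s x) - (a x + b x))) \<longlongrightarrow> 0) F"
proof (rule tendsto_sandwich[OF _ _ tendsto_const])
  show "((\<lambda>s. L2_norm S (\<lambda>x. f s x - a x) + L2_norm S (\<lambda>x. g s x - b x)) \<longlongrightarrow> 0) F"
    using tendsto_add[OF assms(1,2)] by simp
  show "\<forall>\<^sub>F s in F. L2_norm S (\<lambda>x. (f s x + g s x) - (a x + b x))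
      \<le> L2_norm S (\<lambda>x. f s x - a x) + L2_norm S (\<lambda>x. g s x - b x)"
    using assms(3,4)
  proof eventually_elim
    case (elim s)
    show ?case
      using L2_norm_triangle[OF L2_space_diff[OF elim(1) assms(5)] L2_space_diff[OF elim(2) assms(6)]]
      by (simp add: algebra_simps)
  qed
qed simp

lemma L2_tendsto_uminus:
  assumes "((\<lambda>s. L2_norm S (\<lambda>x. f s x - a x)) \<longlongrightarrow> 0) F"
  shows "((\<lambda>s. L2_norm S (\<lambda>x. - f s x - - a x)) \<longlongrightarrow> 0) F"
  using assms by (simp add: L2_norm_minus_commute[of S a] add.commute)

lemma L2_tendsto_diff:
  assumes "((\<lambda>s. L2_norm S (\<lambda>x. f s x - a x)) \<longlongrightarrow> 0) F" "((\<lambda>s. L2_norm S (\<lambda>x. g s x - b x)) \<longlongrightarrow> 0) F"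
    and "\<forall>\<^sub>F s in F. f s \<in> L2_space S" "\<forall>\<^sub>F s in F. g s \<in> L2_space S" "a \<in> L2_space S" "b \<in> L2_space S"
  shows "((\<lambda>s. L2_norm S (\<lambda>x. (f s x - g s x) - (a x - b x))) \<longlongrightarrow> 0) F"
proof -
  have "\<forall>\<^sub>F s in F. (\<lambda>x. - g s x) \<in> L2_space S"
    using assms(4) by eventually_elim (rule L2_space_uminus)
  from L2_tendsto_add[OF assms(1) L2_tendsto_uminus[OF assms(2)] assms(3) this assms(5) L2_space_uminus[OF assms(6)]]
  show ?thesis by simp
qed

lemma L2_tendsto_norm:
  assumes "((\<lambda>s. L2_norm S (\<lambda>x. f s x - a x)) \<longlongrightarrow> 0) F"
    and "\<forall>\<^sub>F s in F. f s \<in> L2_space S" "a \<in> L2_space S"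
  shows "((\<lambda>s. L2_norm S (f s)) \<longlongrightarrow> L2_norm S a) F"
proof (rule Lim_null[THEN iffD2], rule Lim_null_comparison[OF _ assms(1)])
  show "\<forall>\<^sub>F s in F. norm (L2_norm S (f s) - L2_norm S a) \<le> L2_norm S (\<lambda>x. f s x - a x)"
    using assms(2) by eventually_elim (use L2_norm_diff_abs assms(3) in auto)
qed

lemma L2_tendsto_ip:
  assumes "((\<lambda>s. L2_norm S (\<lambda>x. f s x - a x)) \<longlongrightarrow> 0) F" "((\<lambda>s. L2_norm S (\<lambda>x. g s x - b x)) \<longlongrightarrow> 0) F"
    and "\<forall>\<^sub>F s in F. f s \<in> L2_space S" "\<forall>\<^sub>F s in F. g s \<in> L2_space S" "a \<in> L2_space S" "b \<in> L2_space S"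
  shows "((\<lambda>s. L2_ip S (f s) (g s)) \<longlongrightarrow> L2_ip S a b) F"
proof (rule Lim_null[THEN iffD2], rule Lim_null_comparison)
  let ?B = "\<lambda>s. L2_norm S (\<lambda>x. f s x - a x) * L2_norm S (g s) + L2_norm S a * L2_norm S (\<lambda>x. g s x - b x)"
  show "(?B \<longlongrightarrow> 0) F"
    using tendsto_add[OF tendsto_mult[OF assms(1) L2_tendsto_norm[OF assms(2,4,6)]]
        tendsto_mult[OF tendsto_const[of "L2_norm S a"] assms(2)]] by simp
  show "\<forall>\<^sub>F s in F. norm (L2_ip S (f s) (g s) - L2_ip S a b) \<le> ?B s"
    using assms(3,4)
  proof eventually_elim
    case (elim s)
    have "L2_ip S (f s) (g s) - L2_ip S a b
        = L2_ip S (\<lambda>x. f s x - a x) (g s) + L2_ip S a (\<lambda>x. g s x - b x)"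
      by (simp add: L2_ip_diff_left L2_ip_diff_right elim assms)
    then show ?case
      using L2_Cauchy_Schwarz[OF L2_space_diff[OF elim(1) assms(5)] elim(2)]
        L2_Cauchy_Schwarz[OF assms(5) L2_space_diff[OF elim(2) assms(6)]] by simp
  qed
qed

lemma L2_space_AE_bounded:
  assumes "S \<in> lmeasurable" "f \<in> borel_measurable (lebesgue_on S)" "AE x in lebesgue_on S. \<bar>f x\<bar> \<le> C"
  shows "f \<in> L2_space S" "(L2_norm S f)\<^sup>2 \<le> C\<^sup>2 * measure lebesgue S"
proof -
  interpret finite_measure "lebesgue_on S" by (rule finite_measure_lebesgue_on[OF assms(1)])
  have b: "AE x in lebesgue_on S. (f x)\<^sup>2 \<le> C\<^sup>2"
    using assms(3) by eventually_elim (metis abs_ge_zero power2_abs power_mono)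
  show f: "f \<in> L2_space S"
    by (rule L2_spaceI[OF assms(2)], rule Bochner_Integration.integrable_bound[OF integrable_const[of "C\<^sup>2"]])
      (use b assms(2) in auto)
  have "(L2_norm S f)\<^sup>2 = integral\<^sup>L (lebesgue_on S) (\<lambda>x. (f x)\<^sup>2)"
    by (simp add: L2_norm_def)
  also have "\<dots> \<le> integral\<^sup>L (lebesgue_on S) (\<lambda>x. C\<^sup>2)"
    by (intro integral_mono_AE L2_space_integrable_sq[OF f] integrable_const b)
  also have "\<dots> = C\<^sup>2 * measure lebesgue S"
    using fmeasurableD[OF assms(1)] by (simp add: measure_restrict_space space_restrict_space)
  finally show "(L2_norm S f)\<^sup>2 \<le> C\<^sup>2 * measure lebesgue S" .
qed

text \<open>The function \<open>max 0 (\<bar>a\<bar> - max 0 M)\<close> is dominated by \<open>\<bar>f s - a\<bar>\<close>.\<close>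

lemma L2_limit_AE_bounded:
  assumes "((\<lambda>s. L2_norm S (\<lambda>x. f s x - a x)) \<longlongrightarrow> 0) F" "F \<noteq> bot"
    and "\<forall>\<^sub>F s in F. f s \<in> L2_space S" "\<forall>\<^sub>F s in F. AE x in lebesgue_on S. \<bar>f s x\<bar> \<le> M"
    and a: "a \<in> L2_space S"
  shows "AE x in lebesgue_on S. \<bar>a x\<bar> \<le> M"
proof -
  let ?p = "\<lambda>x. max 0 (\<bar>a x\<bar> - max 0 M)"
  have pm: "?p \<in> borel_measurable (lebesgue_on S)" using L2_space_measurable[OF a] by simp
  have p: "?p \<in> L2_space S"
  proof (rule L2_spaceI[OF pm], rule Bochner_Integration.integrable_bound[OF L2_space_integrable_sq[OF a]])
    have "(?p x)\<^sup>2 \<le> (a x)\<^sup>2" for x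
      by (rule abs_le_square_iff[THEN iffD1]) auto
    then show "AE x in lebesgue_on S. norm ((?p x)\<^sup>2) \<le> norm ((a x)\<^sup>2)" by simp
  qed (use pm in simp)
  have "\<forall>\<^sub>F s in F. L2_norm S ?p \<le> L2_norm S (\<lambda>x. f s x - a x)"
    using assms(3,4)
  proof eventually_elim
    case (elim s)
    have "AE x in lebesgue_on S. (?p x)\<^sup>2 \<le> (f s x - a x)\<^sup>2"
      using elim(2) by eventually_elim (rule abs_le_square_iff[THEN iffD1], auto)
    then show ?case
      unfolding L2_norm_def real_sqrt_le_iff
      by (intro integral_mono_AE L2_space_integrable_sq p L2_space_diff elim a)
  qed
  then have "L2_norm S ?p \<le> 0"
    using tendsto_lowerbound[OF assms(1) _ assms(2)] by auto
  then have "L2_norm S ?p = 0" using L2_norm_nonneg[of S ?p] by linarith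
  from L2_norm_eq_0_AE[OF p this] have "AE x in lebesgue_on S. ?p x = 0" .
  \<comment> \<open>So far \<bar>a\<bar> is bounded by \<open>max 0 M\<close>. A single s with
    \<bar>f s x\<bar> \<le> M shows that M \<ge> 0 at almost every x, so the maximum is M.\<close>
  moreover obtain s where "AE x in lebesgue_on S. \<bar>f s x\<bar> \<le> M"
    using eventually_happens[OF assms(4)] assms(2) by auto
  ultimately show ?thesis by eventually_elim auto
qed

section \<open>Smooth bump functions\<close>

text \<open>\<open>flat 0\<close> is the classical smooth function exp(-1/t) extended by zero. The
  powers of 1/t are included because they make the family closed under differentiation up to linear
  combinations.\<close>

definition flat :: "nat \<Rightarrow> real \<Rightarrow> real" where
  "flat n t = (if t > 0 then exp (- 1 / t) / t ^ n else 0)"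

lemma flat_tendsto_0: "(flat n \<longlongrightarrow> 0) (at 0)"
proof -
  have "((\<lambda>t::real. inverse t ^ n / exp (inverse t)) \<longlongrightarrow> 0) (at_right 0)"
    using tendsto_power_div_exp_0 filterlim_inverse_at_top_right by (rule filterlim_compose)
  then have "(flat n \<longlongrightarrow> 0) (at_right 0)"
    by (rule Lim_transform_eventually)
      (auto simp: eventually_at_filter flat_def exp_minus field_simps)
  moreover have "(flat n \<longlongrightarrow> 0) (at_left 0)"
    by (rule Lim_transform_eventually[OF tendsto_const]) (auto simp: eventually_at_filter flat_def)
  ultimately show ?thesis by (simp add: filterlim_at_split)
qed

text \<open>The critical point is t = 0: there the difference quotient of \<open>flat n\<close> is
  \<open>flat (n + 1)\<close>, which tends to 0 by the previous lemma.\<close>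

lemma flat_has_derivative:
  "(flat n has_real_derivative (flat (n + 2) t - real n * flat (n + 1) t)) (at t)"
proof (cases t "0::real" rule: linorder_cases)
  case less
  have "((\<lambda>t. 0) has_real_derivative 0) (at t)" by simp
  then have "(flat n has_real_derivative 0) (at t)"
    by (rule has_field_derivative_transform_within_open[where S="{..<0}"]) (use less in \<open>auto simp: flat_def\<close>)
  then show ?thesis using less by (simp add: flat_def)
next
  case equal
  have "((\<lambda>s. (flat n s - flat n 0) / (s - 0)) \<longlongrightarrow> 0) (at 0)"
    by (rule Lim_transform_eventually[OF flat_tendsto_0[of "n + 1"]])
      (auto simp: eventually_at_filter flat_def)
  then show ?thesis using equal by (simp add: has_field_derivative_iff flat_def)
next
  case greater
  have "((\<lambda>t. exp (- 1 / t) / t ^ n) has_real_derivative (flat (n + 2) t - real n * flat (n + 1) t)) (at t)"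
  proof -
    have t: "exp (- 1 / t) / t ^ n = exp (- inverse t) * inverse t ^ n" for t :: real
      by (simp add: field_simps)
    have "((\<lambda>t. exp (- inverse t) * inverse t ^ n) has_real_derivative
        exp (- inverse t) * (inverse t)\<^sup>2 * inverse t ^ n
        - exp (- inverse t) * (real n * inverse t ^ (n - 1) * (inverse t)\<^sup>2)) (at t)"
      using greater by (auto intro!: derivative_eq_intros simp: power2_eq_square algebra_simps)
    moreover have "real n * inverse t ^ (n - 1) * (inverse t)\<^sup>2 = real n * inverse t ^ (n + 1)"
      by (cases n) (simp_all add: power2_eq_square)
    moreover have "flat (n + 2) t = exp (- inverse t) * (inverse t)\<^sup>2 * inverse t ^ n"
      "flat (n + 1) t = exp (- inverse t) * inverse t ^ (n + 1)"
      using greater t[of t] by (simp_all add: flat_def power2_eq_square field_simps)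
    ultimately show ?thesis unfolding t by (simp only: mult.left_commute[of "real n"])
  qed
  then show ?thesis
    by (rule has_field_derivative_transform_within_open[where S="{0<..}"]) (use greater in \<open>auto simp: flat_def\<close>)
qed

lemma flat_0_bounds: "0 \<le> flat 0 t" "flat 0 t \<le> 1"
  by (auto simp: flat_def)

lemma flat_0_limit:
  assumes "t > 0"
  shows "(\<lambda>n. flat 0 (real (Suc n) * t)) \<longlonglongrightarrow> 1"
proof -
  have "(\<lambda>n. exp (- (1 / t) * inverse (real (Suc n)))) \<longlonglongrightarrow> exp (- (1 / t) * 0)"
    by (intro tendsto_intros LIMSEQ_inverse_real_of_nat)
  moreover have "flat 0 (real (Suc n) * t) = exp (- (1 / t) * inverse (real (Suc n)))" for n
    using assms zero_less_mult_iff[of "real (Suc n)" t] by (simp add: flat_def divide_simps)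
  ultimately show ?thesis by simp
qed

text \<open>This class is closed under directional derivatives, so smoothness of all its members
  follows by one induction on the order, without a Leibniz or chain rule for
  \<open>Ck_on\<close>.\<close>

inductive bump_algebra :: "('a::euclidean_space \<Rightarrow> real) \<Rightarrow> bool" where
  bump_const: "bump_algebra (\<lambda>x. c)"
| bump_flat: "bump_algebra (\<lambda>x. flat n (x \<bullet> w + c))"
| bump_add: "bump_algebra f \<Longrightarrow> bump_algebra g \<Longrightarrow> bump_algebra (\<lambda>x. f x + g x)"
| bump_mult: "bump_algebra f \<Longrightarrow> bump_algebra g \<Longrightarrow> bump_algebra (\<lambda>x. f x * g x)"

lemma bump_algebra_derivative:
  "bump_algebra f \<Longrightarrow> \<exists>f'. (\<forall>x. (f has_derivative f' x) (at x)) \<and> (\<forall>h. bump_algebra (\<lambda>x. f' x h))"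
proof (induction rule: bump_algebra.induct)
  case (bump_const c)
  show ?case
    by (rule exI[of _ "\<lambda>x h. 0"]) (auto intro: bump_algebra.bump_const)
next
  case (bump_flat n w c)
  let ?d = "\<lambda>t. flat (n + 2) t - real n * flat (n + 1) t"
  have "((\<lambda>x. flat n (x \<bullet> w + c)) has_derivative (\<lambda>h. ?d (x \<bullet> w + c) * (h \<bullet> w))) (at x)" for x
    by (rule has_derivative_compose[OF _ has_field_derivative_imp_has_derivative[OF flat_has_derivative], of _ "\<lambda>h. h \<bullet> w"])
      (auto intro!: derivative_eq_intros)
  moreover have "bump_algebra (\<lambda>x. ?d (x \<bullet> w + c) * (h \<bullet> w))" for h
    using bump_algebra.bump_mult[OF bump_algebra.bump_add[OF bump_algebra.bump_flat[of "n + 2" w c]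
          bump_algebra.bump_mult[OF bump_algebra.bump_const[of "- real n"] bump_algebra.bump_flat[of "n + 1" w c]]]
        bump_algebra.bump_const[of "h \<bullet> w"]] by simp
  ultimately show ?case
    by (intro exI[of _ "\<lambda>x h. ?d (x \<bullet> w + c) * (h \<bullet> w)"]) auto
next
  case (bump_add f g)
  then obtain f' g' where "\<forall>x. (f has_derivative f' x) (at x)" "\<forall>h. bump_algebra (\<lambda>x. f' x h)"
    "\<forall>x. (g has_derivative g' x) (at x)" "\<forall>h. bump_algebra (\<lambda>x. g' x h)" by auto
  then show ?case
    by (intro exI[of _ "\<lambda>x h. f' x h + g' x h"]) (auto intro: has_derivative_add bump_algebra.bump_add)
next
  case (bump_mult f g)
  then obtain f' g' where "\<forall>x. (f has_derivative f' x) (at x)" "\<forall>h. bump_algebra (\<lambda>x. f' x h)"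
    "\<forall>x. (g has_derivative g' x) (at x)" "\<forall>h. bump_algebra (\<lambda>x. g' x h)" by auto
  then show ?case using bump_mult.hyps
    by (intro exI[of _ "\<lambda>x h. f x * g' x h + f' x h * g x"])
      (auto intro!: has_derivative_mult bump_algebra.bump_add bump_algebra.bump_mult)
qed

lemma bump_algebra_smooth: "bump_algebra f \<Longrightarrow> smooth_on UNIV f"
proof -
  have "bump_algebra f \<Longrightarrow> Ck_on k UNIV f" for k and f :: "'a \<Rightarrow> real"
  proof (induction k arbitrary: f)
    case 0
    then obtain f' where "\<forall>x. (f has_derivative f' x) (at x)" using bump_algebra_derivative by blast
    then show ?case by (auto simp: continuous_on_eq_continuous_at intro: has_derivative_continuous)
  next
    case (Suc k)
    then obtain f' where f': "\<forall>x. (f has_derivative f' x) (at x)" "\<forall>h. bump_algebra (\<lambda>x. f' x h)"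
      using bump_algebra_derivative by blast
    have "frechet_derivative f (at x) = f' x" for x
      using frechet_derivative_at[of f "f' x" x] f'(1) by auto
    then show ?case using f' Suc.IH by (auto simp: differentiable_def)
  qed
  then show "bump_algebra f \<Longrightarrow> smooth_on UNIV f" by (simp add: smooth_on_def)
qed

text \<open>Increasing n only steepens the transition at the faces: the support is always the closed
  box, so all members are test functions on a common compact set while they converge to the
  indicator of the open box.\<close>

definition bump :: "'a::euclidean_space \<Rightarrow> 'a \<Rightarrow> nat \<Rightarrow> 'a \<Rightarrow> real" where
  "bump p q n x = (\<Prod>b\<in>Basis. flat 0 (real (Suc n) * (x \<bullet> b - p \<bullet> b)) * flat 0 (real (Suc n) * (q \<bullet> b - x \<bullet> b)))"

lemma bump_algebra_bump: "bump_algebra (bump p q n)"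
proof -
  have P: "finite I \<Longrightarrow> (\<And>i. i \<in> I \<Longrightarrow> bump_algebra (f i)) \<Longrightarrow> bump_algebra (\<lambda>x. \<Prod>i\<in>I. f i x)"
    for I and f :: "'a \<Rightarrow> 'a \<Rightarrow> real"
    by (induction rule: finite_induct) (auto intro: bump_const bump_mult)
  have "bump_algebra (\<lambda>x. flat 0 (real (Suc n) * (x \<bullet> b - p \<bullet> b)))" for b
    using bump_flat[of 0 "real (Suc n) *\<^sub>R b" "- real (Suc n) * (p \<bullet> b)"] by (simp add: algebra_simps)
  moreover have "bump_algebra (\<lambda>x. flat 0 (real (Suc n) * (q \<bullet> b - x \<bullet> b)))" for b
    using bump_flat[of 0 "- real (Suc n) *\<^sub>R b" "real (Suc n) * (q \<bullet> b)"] by (simp add: algebra_simps)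
  ultimately show ?thesis
    unfolding bump_def[abs_def] by (intro P bump_mult) auto
qed

lemma bump_eq_0_iff: "bump p q n x = 0 \<longleftrightarrow> x \<notin> box p q"
proof -
  have "flat 0 (real (Suc n) * t) = 0 \<longleftrightarrow> t \<le> 0" for t :: real
    using zero_less_mult_iff[of "real (Suc n)" t] by (auto simp: flat_def not_less)
  then show ?thesis by (simp add: bump_def mem_box) (meson not_less)
qed

lemma bump_bounds: "0 \<le> bump p q n x" "bump p q n x \<le> indicator (box p q) x"
proof -
  show "0 \<le> bump p q n x" by (auto simp: bump_def intro!: prod_nonneg mult_nonneg_nonneg flat_0_bounds)
  have "bump p q n x \<le> 1"
    unfolding bump_def by (intro prod_le_1 conjI mult_nonneg_nonneg mult_le_one flat_0_bounds)
  then show "bump p q n x \<le> indicator (box p q) x"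
    using bump_eq_0_iff[of p q n x] by (auto simp: indicator_def)
qed

lemma bump_limit: "(\<lambda>n. bump p q n x) \<longlonglongrightarrow> indicator (box p q) x"
proof (cases "x \<in> box p q")
  case True
  then have "x \<bullet> b - p \<bullet> b > 0 \<and> q \<bullet> b - x \<bullet> b > 0" if "b \<in> Basis" for b
    using that by (auto simp: mem_box)
  then have "(\<lambda>n. bump p q n x) \<longlonglongrightarrow> (\<Prod>b\<in>(Basis::'a set). 1 * 1)"
    unfolding bump_def by (intro tendsto_prod tendsto_mult flat_0_limit) auto
  then show ?thesis using True by simp
next
  case False
  then have "bump p q n x = 0" for n using bump_eq_0_iff by blast
  then show ?thesis using False by simp
qed

lemma bump_test_function:
  assumes "cbox p q \<subseteq> \<Omega>"
  shows "bump p q n \<in> test_functions \<Omega>"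
proof -
  have "{x. bump p q n x \<noteq> 0} = box p q" by (auto simp: bump_eq_0_iff)
  moreover have "closure (box p q) \<subseteq> cbox p q" by (rule closure_minimal) (auto simp: box_subset_cbox)
  moreover have "compact (closure (box p q))" by (simp add: compact_closure)
  ultimately show ?thesis
    using assms bump_algebra_smooth[OF bump_algebra_bump[of p q n]] by (auto simp: test_functions_def)
qed

section \<open>Integrals of derivatives\<close>

lemma integrable_lborel_continuous_compact_support:
  fixes f :: "'a::euclidean_space \<Rightarrow> real"
  assumes "continuous_on UNIV f" "compact K" "\<And>x. x \<notin> K \<Longrightarrow> f x = 0"
  shows "integrable lborel f"
proof -
  have "integrable lborel (\<lambda>x. indicator K x *\<^sub>R f x)"
    using borel_integrable_compact[OF assms(2) continuous_on_subset[OF assms(1)]] by simp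
  moreover have "(\<lambda>x. indicator K x *\<^sub>R f x) = f"
    using assms(3) by (intro ext) (auto simp: indicator_def)
  ultimately show ?thesis by simp
qed

text \<open>The integral of a difference quotient vanishes by translation invariance; let the step tend to zero.\<close>

lemma integral_derivative_compact_support:
  fixes f :: "'a::euclidean_space \<Rightarrow> real"
  assumes f: "\<And>x. (f has_derivative f' x) (at x)" and c: "continuous_on UNIV (\<lambda>x. f' x b)"
    and K: "compact K" "\<And>x. x \<notin> K \<Longrightarrow> f x = 0"
  shows "integral\<^sup>L lborel (\<lambda>x. f' x b) = 0"
proof -
  have cf: "continuous_on UNIV f"
    using f by (auto simp: continuous_on_eq_continuous_at intro: has_derivative_continuous)
  have intf: "integrable lborel f"
    by (rule integrable_lborel_continuous_compact_support[OF cf K])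
  obtain R where R: "R > 0" "K \<subseteq> cball 0 R"
    using compact_imp_bounded[OF K(1)] by (auto simp: bounded_pos subset_iff)
  \<comment> \<open>The steps \<open>h n\<close> are at most 1, so every difference quotient
    vanishes outside this enlarged ball, which carries the dominating function.\<close>
  define K' where "K' = cball (0::'a) (R + norm b)"
  have "bounded ((\<lambda>x. f' x b) ` K')"
    by (rule compact_imp_bounded, rule compact_continuous_image[OF continuous_on_subset[OF c]]) (auto simp: K'_def)
  then obtain B where B: "B > 0" "\<And>x. x \<in> K' \<Longrightarrow> \<bar>f' x b\<bar> \<le> B"
    by (auto simp: bounded_pos)
  define h where "h n = inverse (real (Suc n))" for n
  have h: "h n > 0" "h n \<le> 1" "h \<longlonglongrightarrow> 0" for n
    using LIMSEQ_inverse_real_of_nat by (auto simp: h_def[abs_def] inverse_le_1_iff)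
  define D where "D n x = (f (x + h n *\<^sub>R b) - f x) / h n" for n x
  have shift: "integrable lborel (\<lambda>x. f (x + c))" "integral\<^sup>L lborel (\<lambda>x. f (x + c)) = integral\<^sup>L lborel f" for c
  proof -
    have m: "f \<in> borel_measurable borel" using cf by (rule borel_measurable_continuous_onI)
    have "integrable (distr lborel borel ((+) c)) f" using intf by (simp add: lborel_distr_plus)
    then show "integrable lborel (\<lambda>x. f (x + c))"
      by (subst (asm) integrable_distr_eq) (use m in \<open>auto simp: add.commute\<close>)
    have "integral\<^sup>L (distr lborel borel ((+) c)) f = integral\<^sup>L lborel (\<lambda>x. f (c + x))"
      by (rule integral_distr) (use m in auto)
    then show "integral\<^sup>L lborel (\<lambda>x. f (x + c)) = integral\<^sup>L lborel f"
      by (simp add: lborel_distr_plus add.commute)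
  qed
  have D0: "integral\<^sup>L lborel (D n) = 0" for n
    unfolding D_def[abs_def] using shift[of "h n *\<^sub>R b"] intf
    by (simp add: Bochner_Integration.integral_diff)
  have lim: "(\<lambda>n. D n x) \<longlonglongrightarrow> f' x b" for x
  proof -
    have "((\<lambda>t. f (x + t *\<^sub>R b)) has_derivative (\<lambda>t. f' x (t *\<^sub>R b))) (at 0)"
      by (rule has_derivative_compose[where g=f and f="\<lambda>t. x + t *\<^sub>R b"])
        (use f in \<open>auto intro!: derivative_eq_intros\<close>)
    moreover have "(\<lambda>t. f' x (t *\<^sub>R b)) = (*) (f' x b)"
      using linear_scale[OF has_derivative_linear[OF f[of x]], of _ b] by (simp add: fun_eq_iff)
    ultimately have "((\<lambda>t. f (x + t *\<^sub>R b)) has_real_derivative f' x b) (at 0)"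
      by (simp add: has_field_derivative_def)
    then have *: "((\<lambda>t. (f (x + t *\<^sub>R b) - f x) / t) \<longlongrightarrow> f' x b) (at 0)"
      by (simp add: has_field_derivative_iff)
    have "filterlim h (at 0) sequentially"
      using h by (auto simp: filterlim_at intro!: always_eventually less_imp_neq[symmetric])
    from filterlim_compose[OF * this] show ?thesis by (simp add: D_def)
  qed
  have bound: "norm (D n x) \<le> B * indicator K' x" for n x
  proof (cases "x \<in> K'")
    case False
    have "K \<subseteq> K'" by (rule order_trans[OF R(2)]) (simp add: K'_def subset_cball)
    then have "x \<notin> K" using False by auto
    moreover have "x + h n *\<^sub>R b \<notin> K"
    proof
      assume "x + h n *\<^sub>R b \<in> K"
      then have "norm (x + h n *\<^sub>R b) \<le> R" using R by auto
      moreover have "norm (h n *\<^sub>R b) \<le> norm b" using h(1,2)[of n] by (simp add: mult_left_le_one_le)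
      ultimately have "norm x \<le> R + norm b"
        using norm_triangle_ineq4[of "x + h n *\<^sub>R b" "h n *\<^sub>R b"] by simp
      then show False using False by (simp add: K'_def)
    qed
    ultimately show ?thesis using False K(2) by (simp add: D_def)
  next
    case True
    have der: "((\<lambda>t. f (x + t *\<^sub>R b)) has_real_derivative f' (x + t *\<^sub>R b) b) (at t)" for t
    proof -
      have "((\<lambda>t. f (x + t *\<^sub>R b)) has_derivative (\<lambda>s. f' (x + t *\<^sub>R b) (s *\<^sub>R b))) (at t)"
        by (rule has_derivative_compose[where g=f and f="\<lambda>t. x + t *\<^sub>R b"])
          (use f in \<open>auto intro!: derivative_eq_intros\<close>)
      moreover have "(\<lambda>s. f' (x + t *\<^sub>R b) (s *\<^sub>R b)) = (*) (f' (x + t *\<^sub>R b) b)"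
        using linear_scale[OF has_derivative_linear[OF f[of "x + t *\<^sub>R b"]], of _ b] by (simp add: fun_eq_iff)
      ultimately show ?thesis by (simp add: has_field_derivative_def)
    qed
    obtain s where s: "0 < s" "s < h n" "f (x + h n *\<^sub>R b) - f (x + 0 *\<^sub>R b) = (h n - 0) * f' (x + s *\<^sub>R b) b"
      using MVT2[of 0 "h n" "\<lambda>t. f (x + t *\<^sub>R b)" "\<lambda>t. f' (x + t *\<^sub>R b) b"] h(1)[of n] der by auto
    have D: "D n x = f' (x + s *\<^sub>R b) b" using s(3) h(1)[of n] by (simp add: D_def)
    show ?thesis
    proof (cases "x + s *\<^sub>R b \<in> K'")
      case True
      then show ?thesis using B(2) \<open>x \<in> K'\<close> D by simp
    next
      \<comment> \<open>\<open>B\<close> bounds the derivative only on \<open>K'\<close>. Off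
        \<open>K'\<close> the function vanishes in a whole neighbourhood of the intermediate point,
        so its derivative there is 0.\<close>
      case False
      moreover have "K \<subseteq> K'" by (rule order_trans[OF R(2)]) (simp add: K'_def subset_cball)
      ultimately have "x + s *\<^sub>R b \<in> - K" by auto
      moreover have "open (- K)" using compact_imp_closed[OF K(1)] by (simp add: open_Compl)
      ultimately have "(f has_derivative (\<lambda>h. 0)) (at (x + s *\<^sub>R b))"
        using has_derivative_transform_within_open[OF has_derivative_const[of 0], where s="- K" and g=f] K(2)
        by (metis ComplD)
      then have "f' (x + s *\<^sub>R b) = (\<lambda>h. 0)" using f has_derivative_unique by blast
      then show ?thesis using D B(1) by simp
    qed
  qed
  have "(\<lambda>n. integral\<^sup>L lborel (D n)) \<longlonglongrightarrow> integral\<^sup>L lborel (\<lambda>x. f' x b)"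
  proof (rule integral_dominated_convergence[where w="\<lambda>x. B * indicator K' x"])
    show "(\<lambda>x. f' x b) \<in> borel_measurable lborel" using borel_measurable_continuous_onI[OF c] by simp
    have m: "f \<in> borel_measurable borel" using cf by (rule borel_measurable_continuous_onI)
    show "D n \<in> borel_measurable lborel" for n
      unfolding D_def[abs_def] using m by measurable
    show "integrable lborel (\<lambda>x. B * indicator K' x)"
      using emeasure_bounded_finite[of K'] by (intro integrable_mult_right integrable_real_indicator) (auto simp: K'_def)
  qed (use lim bound in auto)
  then show ?thesis using D0 LIMSEQ_unique[OF tendsto_const] by fastforce
qed

section \<open>The fundamental lemma of the calculus of variations\<close>

text \<open>The sets over which G integrates to zero contain the intersection-stable generator
  formed by the boxes and are closed under disjoint countable unions; the hypothesis on the whole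
  space gives closure under complements. Hence G and 0 are densities of the same measure.\<close>

lemma integral_boxes_zero_imp_AE_zero:
  fixes G :: "'a::euclidean_space \<Rightarrow> real"
  assumes G: "integrable lborel G"
    and boxes: "\<And>p q. (LINT x:box p q|lborel. G x) = 0" and univ: "integral\<^sup>L lborel G = 0"
  shows "AE x in lborel. G x = 0"
proof (rule density_unique_real[where f'="\<lambda>x. 0"])
  fix A :: "'a set" assume "A \<in> sets lborel"
  then have A: "A \<in> sigma_sets UNIV (range (\<lambda>(a, b). box a b))"
    by (simp add: borel_eq_box)
  have "Int_stable (range (\<lambda>(a, b). box a b :: 'a set))"
    unfolding Int_stable_def by (auto simp: box_Int_box)
  moreover have "range (\<lambda>(a, b). box a b :: 'a set) \<subseteq> Pow UNIV" by simp
  ultimately have "(LINT x:A|lborel. G x) = 0"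
    using A
  proof (induction rule: sigma_sets_induct_disjoint)
    case (basic A)
    then show ?case using boxes by auto
  next
    case empty
    then show ?case by (simp add: set_lebesgue_integral_def)
  next
    case (compl A)
    then have A: "A \<in> sets lborel" by (simp add: borel_eq_box)
    have "(LINT x:UNIV - A|lborel. G x) = integral\<^sup>L lborel (\<lambda>x. G x - indicator A x *\<^sub>R G x)"
      unfolding set_lebesgue_integral_def by (intro Bochner_Integration.integral_cong) (auto simp: indicator_def)
    also have "\<dots> = integral\<^sup>L lborel G - (LINT x:A|lborel. G x)"
      unfolding set_lebesgue_integral_def
      by (intro Bochner_Integration.integral_diff G integrable_mult_indicator A)
    finally show ?case using compl univ by simp
  next
    case (union A)
    then have A: "A i \<in> sets lborel" for i by (auto simp: borel_eq_box)
    have "(LINT x:\<Union> (range A)|lborel. G x) = (\<Sum>i. LINT x:A i|lborel. G x)"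
    proof (rule lebesgue_integral_countable_add)
      show "set_integrable lborel (\<Union> (range A)) G"
        unfolding set_integrable_def using A by (intro integrable_mult_indicator G) blast
    qed (use union(1) A in \<open>auto simp: disjoint_family_on_def\<close>)
    then show ?case using union by simp
  qed
  then show "(LINT x:A|lborel. G x) = (LINT x:A|lborel. 0)" by (simp add: set_lebesgue_integral_def)
qed (use G in auto)

text \<open>Bump functions tend to indicators of boxes, so dominated convergence turns vanishing
  against test functions into vanishing over boxes. Cutting g off to one fixed box makes it
  integrable on the whole space, and the other boxes then enter only through their intersections
  with it.\<close>

lemma fundamental_lemma_box:
  fixes g :: "'a::euclidean_space \<Rightarrow> real"
  assumes \<Omega>: "open \<Omega>" and g: "g \<in> L2_space \<Omega>" and PQ: "cbox l u \<subseteq> \<Omega>"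
    and zero: "\<And>\<phi>. \<phi> \<in> test_functions \<Omega> \<Longrightarrow> integral\<^sup>L (lebesgue_on \<Omega>) (\<lambda>x. g x * \<phi> x) = 0"
  shows "AE x in lebesgue. x \<in> box l u \<longrightarrow> g x = 0"
proof -
  have O: "\<Omega> \<in> sets lebesgue" using \<Omega> by simp
  have ind: "indicator (box p q) \<in> L2_space \<Omega>" if "cbox p q \<subseteq> \<Omega>" for p q
  proof (rule L2_spaceI)
    show "indicator (box p q) \<in> borel_measurable (lebesgue_on \<Omega>)"
      by (intro measurable_restrict_space1 borel_measurable_indicator) simp
    have "(\<lambda>x. (indicator (box p q) x)\<^sup>2) = (indicat_real (box p q))" by (auto simp: indicator_def)
    moreover have "integrable (lebesgue_on \<Omega>) (indicat_real (box p q))"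
    proof (rule Lebesgue_Measure.integrable_restrict_UNIV[OF O, THEN iffD1])
      have "(\<lambda>x. if x \<in> \<Omega> then indicat_real (box p q) x else 0) = indicator (box p q)"
        using that box_subset_cbox[of p q] by (auto simp: indicator_def fun_eq_iff)
      then show "integrable lebesgue (\<lambda>x. if x \<in> \<Omega> then indicat_real (box p q) x else 0)"
        using lmeasurable_box[of p q] by (simp add: fmeasurable_def)
    qed
    ultimately show "integrable (lebesgue_on \<Omega>) (\<lambda>x. (indicat_real (box p q) x)\<^sup>2)" by simp
  qed
  have box0: "integral\<^sup>L (lebesgue_on \<Omega>) (\<lambda>x. g x * indicator (box p q) x) = 0" if "cbox p q \<subseteq> \<Omega>" for p q
  proof -
    have int: "integrable (lebesgue_on \<Omega>) (\<lambda>x. g x * indicator (box p q) x)"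
      by (rule L2_space_integrable_mult[OF g ind[OF that]])
    have "(\<lambda>n. integral\<^sup>L (lebesgue_on \<Omega>) (\<lambda>x. g x * bump p q n x))
        \<longlonglongrightarrow> integral\<^sup>L (lebesgue_on \<Omega>) (\<lambda>x. g x * indicator (box p q) x)"
    proof (rule integral_dominated_convergence[where w="\<lambda>x. \<bar>g x * indicator (box p q) x\<bar>"])
      show "(\<lambda>x. g x * indicator (box p q) x) \<in> borel_measurable (lebesgue_on \<Omega>)"
        using int by (rule borel_measurable_integrable)
      have "continuous_on UNIV (bump p q n)" for n
        using bump_algebra_smooth[OF bump_algebra_bump[of p q n]] unfolding smooth_on_def
        by (metis Ck_on.simps(1))
      then have "bump p q n \<in> borel_measurable (lebesgue_on \<Omega>)" for n
        by (intro measurable_restrict_space1 measurable_completion) (simp add: borel_measurable_continuous_onI)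
      then show "(\<lambda>x. g x * bump p q n x) \<in> borel_measurable (lebesgue_on \<Omega>)" for n
        by (intro borel_measurable_times L2_space_measurable[OF g])
      show "AE x in lebesgue_on \<Omega>. (\<lambda>n. g x * bump p q n x) \<longlonglongrightarrow> g x * indicator (box p q) x"
        by (intro AE_I2 tendsto_mult tendsto_const bump_limit)
      show "AE x in lebesgue_on \<Omega>. norm (g x * bump p q n x) \<le> \<bar>g x * indicator (box p q) x\<bar>" for n
        using bump_bounds[of p q n] by (intro AE_I2) (auto simp: abs_mult intro!: mult_left_mono)
    qed (use int in auto)
    moreover have "integral\<^sup>L (lebesgue_on \<Omega>) (\<lambda>x. g x * bump p q n x) = 0" for n
      by (rule zero[OF bump_test_function[OF that]])
    ultimately show ?thesis using LIMSEQ_unique[OF tendsto_const] by fastforce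
  qed
  define G where "G x = (if x \<in> \<Omega> then g x * indicator (box l u) x else 0)" for x
  have Gi: "integrable lebesgue G"
    unfolding G_def[abs_def]
    by (rule Lebesgue_Measure.integrable_restrict_UNIV[OF O, THEN iffD2, OF L2_space_integrable_mult[OF g ind[OF PQ]]])
  \<comment> \<open>The argument with generating boxes runs through Borel sets, so the Lebesgue
    measurable \<open>G\<close> is replaced by a Borel representative.\<close>
  then obtain G' where G': "G' \<in> borel_measurable lborel" "AE x in lborel. G x = G' x"
    using completion_ex_borel_measurable_real[OF borel_measurable_integrable[OF Gi]] by blast
  have GG': "AE x in lebesgue. G x = G' x" using G'(2) by (rule AE_completion)
  have G'c: "G' \<in> borel_measurable lebesgue" using G'(1) by (rule measurable_completion)
  have G'i: "integrable lborel G'"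
    using Gi Bochner_Integration.integrable_cong_AE[OF borel_measurable_integrable[OF Gi] G'c GG'] integrable_completion[OF G'(1)[unfolded measurable_lborel2]]
    by (simp add: integrable_completion[OF G'(1)])
  have G'box: "(LINT x:A|lborel. G' x) = integral\<^sup>L (lebesgue_on \<Omega>) (\<lambda>x. g x * indicator (A \<inter> box l u) x)"
    if "A \<in> sets lborel" for A
  proof -
    have "(LINT x:A|lborel. G' x) = integral\<^sup>L lebesgue (\<lambda>x. indicator A x *\<^sub>R G' x)"
      unfolding set_lebesgue_integral_def using that G'(1)
      by (intro integral_completion[symmetric]) simp
    also have "\<dots> = integral\<^sup>L lebesgue (\<lambda>x. if x \<in> \<Omega> then g x * indicator (A \<inter> box l u) x else 0)"
    proof (rule integral_cong_AE)
      have "(\<lambda>x. if x \<in> \<Omega> then g x * indicator (A \<inter> box l u) x else 0) = (\<lambda>x. indicator A x *\<^sub>R G x)"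
        by (auto simp: G_def indicator_def fun_eq_iff)
      then show "(\<lambda>x. if x \<in> \<Omega> then g x * indicator (A \<inter> box l u) x else 0) \<in> borel_measurable lebesgue"
        using borel_measurable_integrable[OF Gi] that
        by (auto intro!: borel_measurable_scaleR borel_measurable_indicator simp del: real_scaleR_def)
      show "AE x in lebesgue. indicator A x *\<^sub>R G' x = (if x \<in> \<Omega> then g x * indicator (A \<inter> box l u) x else 0)"
        using GG' by eventually_elim (auto simp: G_def indicator_def split: if_splits)
    qed (use G'c that in \<open>auto intro!: borel_measurable_scaleR borel_measurable_indicator simp del: real_scaleR_def\<close>)
    also have "\<dots> = integral\<^sup>L (lebesgue_on \<Omega>) (\<lambda>x. g x * indicator (A \<inter> box l u) x)"
      by (rule Lebesgue_Measure.integral_restrict_UNIV[OF O])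
    finally show ?thesis .
  qed
  have "AE x in lborel. G' x = 0"
  proof (rule integral_boxes_zero_imp_AE_zero[OF G'i])
    fix p q :: 'a
    \<comment> \<open>The corners of the intersection of the two boxes, whose closed box still lies
      in the domain.\<close>
    let ?p = "\<Sum>i\<in>Basis. max (p\<bullet>i) (l\<bullet>i) *\<^sub>R i" and ?q = "\<Sum>i\<in>Basis. min (q\<bullet>i) (u\<bullet>i) *\<^sub>R i"
    have "cbox ?p ?q \<subseteq> \<Omega>" using Int_interval[of p q l u] PQ by auto
    then show "(LINT x:box p q|lborel. G' x) = 0"
      using box0[of ?p ?q] by (simp add: G'box box_Int_box)
  next
    show "integral\<^sup>L lborel G' = 0"
      using G'box[of UNIV] box0[OF PQ] by (simp add: set_lebesgue_integral_def)
  qed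
  then have "AE x in lebesgue. G' x = 0" by (rule AE_completion)
  with GG' show ?thesis
    by eventually_elim (use PQ box_subset_cbox[of l u] in \<open>auto simp: G_def indicator_def split: if_splits\<close>)
qed

text \<open>An open set is a countable union of closed boxes inside it. The previous lemma treats
  their interiors, and the boundaries of the boxes are null sets.\<close>

lemma fundamental_lemma:
  fixes g :: "'a::euclidean_space \<Rightarrow> real"
  assumes \<Omega>: "open \<Omega>" and g: "g \<in> L2_space \<Omega>"
    and zero: "\<And>\<phi>. \<phi> \<in> test_functions \<Omega> \<Longrightarrow> integral\<^sup>L (lebesgue_on \<Omega>) (\<lambda>x. g x * \<phi> x) = 0"
  shows "AE x in lebesgue_on \<Omega>. g x = 0"
proof -
  obtain \<D> where \<D>: "countable \<D>" "\<D> \<subseteq> Pow \<Omega>" "\<And>X. X \<in> \<D> \<Longrightarrow> \<exists>a b. X = cbox a b" "\<Union>\<D> = \<Omega>"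
    using open_countable_Union_open_cbox[OF \<Omega>] by metis
  have "AE x in lebesgue. x \<in> X \<longrightarrow> g x = 0" if X: "X \<in> \<D>" for X
  proof -
    obtain a b where ab: "X = cbox a b" using \<D>(3)[OF X] by auto
    then have "AE x in lebesgue. x \<in> box a b \<longrightarrow> g x = 0"
      using \<D>(2) X by (intro fundamental_lemma_box[OF \<Omega> g _ zero]) auto
    moreover have "AE x in lebesgue. x \<notin> cbox a b - box a b"
      using negligible_frontier_interval[of a b] by (intro AE_not_in) (simp add: negligible_iff_null_sets)
    ultimately show ?thesis by eventually_elim (use ab in auto)
  qed
  then have "AE x in lebesgue. \<forall>X\<in>\<D>. x \<in> X \<longrightarrow> g x = 0" 
    by (intro AE_ball_countable[OF \<D>(1), THEN iffD2] ballI)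
  then have "AE x in lebesgue. x \<in> \<Omega> \<longrightarrow> g x = 0"
    by eventually_elim (use \<D>(4) in blast)
  then show ?thesis using \<Omega> by (simp add: AE_restrict_space_iff)
qed

section \<open>Weak derivatives\<close>

lemma Ck_on_diff:
  assumes "open S" "Ck_on k S f" "Ck_on k S g"
  shows "Ck_on k S (\<lambda>x. f x - g x)"
  using assms(2,3)
proof (induction k arbitrary: f g)
  case 0
  then show ?case by (auto intro: continuous_on_diff)
next
  case (Suc k)
  have d: "frechet_derivative (\<lambda>x. f x - g x) (at x) h = frechet_derivative f (at x) h - frechet_derivative g (at x) h"
    if "x \<in> S" for x h
    using Suc.prems that by (subst frechet_derivative_at[OF has_derivative_diff, symmetric])
      (auto simp: frechet_derivative_works[symmetric])
  \<comment> \<open>The derivative of a difference is the difference of the derivatives only on S,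
    so the induction needs to exchange functions agreeing on S. Openness of S makes derivatives at
    its points depend on the values on S alone.\<close>
  have cong: "Ck_on j S p \<longleftrightarrow> Ck_on j S q" if "\<And>x. x \<in> S \<Longrightarrow> p x = q x" for j and p q :: "'a \<Rightarrow> real"
    using that
  proof (induction j arbitrary: p q)
    case 0
    then show ?case by (simp cong: continuous_on_cong)
  next
    case (Suc j)
    have eq: "frechet_derivative p (at x) = frechet_derivative q (at x)" "p differentiable (at x) \<longleftrightarrow> q differentiable (at x)"
      if "x \<in> S" for x
    proof -
      have "(p has_derivative D) (at x) \<longleftrightarrow> (q has_derivative D) (at x)" for D
        using has_derivative_transform_within_open[OF _ assms(1) that, of p D UNIV q]
          has_derivative_transform_within_open[OF _ assms(1) that, of q D UNIV p] Suc.prems by auto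
      then show "frechet_derivative p (at x) = frechet_derivative q (at x)"
        "p differentiable (at x) \<longleftrightarrow> q differentiable (at x)"
        by (simp_all add: frechet_derivative_def differentiable_def)
    qed
    have "Ck_on j S (\<lambda>x. frechet_derivative p (at x) h) \<longleftrightarrow> Ck_on j S (\<lambda>x. frechet_derivative q (at x) h)" for h
      by (rule Suc.IH) (simp add: eq(1))
    then show ?case using eq(2) by simp
  qed
  have "Ck_on k S (\<lambda>x. frechet_derivative f (at x) h - frechet_derivative g (at x) h)" for h
    using Suc by auto
  then have "Ck_on k S (\<lambda>x. frechet_derivative (\<lambda>x. f x - g x) (at x) h)" for h
    by (subst cong) (auto simp: d)
  then show ?case using Suc.prems by auto
qed

lemma test_functions_diff:
  assumes "\<phi> \<in> test_functions \<Omega>" "\<psi> \<in> test_functions \<Omega>"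
  shows "(\<lambda>x. \<phi> x - \<psi> x) \<in> test_functions \<Omega>"
proof -
  let ?K = "closure {x. \<phi> x \<noteq> 0} \<union> closure {x. \<psi> x \<noteq> 0}"
  have sub: "closure {x. \<phi> x - \<psi> x \<noteq> 0} \<subseteq> ?K"
    unfolding closure_Un[symmetric] by (rule closure_mono) auto
  have K: "compact ?K" "?K \<subseteq> \<Omega>" using assms by (simp_all add: test_functions_def compact_Un)
  have "closure {x. \<phi> x - \<psi> x \<noteq> 0} \<subseteq> \<Omega>" by (rule order_trans[OF sub K(2)])
  moreover have "compact (closure {x. \<phi> x - \<psi> x \<noteq> 0})"
    using compact_Int_closed[OF K(1) closed_closure, of "{x. \<phi> x - \<psi> x \<noteq> 0}"] sub
    by (simp only: Int_absorb1)
  moreover have "smooth_on UNIV (\<lambda>x. \<phi> x - \<psi> x)"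
    using assms Ck_on_diff[OF open_UNIV] unfolding test_functions_def smooth_on_def by blast
  ultimately show ?thesis by (simp add: test_functions_def)
qed

lemma test_function_Ck: "\<phi> \<in> test_functions \<Omega> \<Longrightarrow> Ck_on k UNIV \<phi>"
  by (simp add: test_functions_def smooth_on_def)

lemma test_function_derivative:
  "\<phi> \<in> test_functions \<Omega> \<Longrightarrow> (\<phi> has_derivative frechet_derivative \<phi> (at x)) (at x)"
  using test_function_Ck[of \<phi> \<Omega> "Suc 0"] frechet_derivative_works[of \<phi> "at x"] by simp

lemma test_function_derivative_continuous:
  "\<phi> \<in> test_functions \<Omega> \<Longrightarrow> continuous_on UNIV (\<lambda>x. frechet_derivative \<phi> (at x) b)"
  using test_function_Ck[of \<phi> \<Omega> "Suc 0"] by simp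

lemma test_function_continuous: "\<phi> \<in> test_functions \<Omega> \<Longrightarrow> continuous_on UNIV \<phi>"
  using test_function_Ck[of \<phi> \<Omega> 0] by simp

text \<open>Outside the closed support the function vanishes on an open set, so its derivative
  vanishes too; one compact set serves for both.\<close>

lemma test_function_support:
  assumes "\<phi> \<in> test_functions \<Omega>"
  obtains K where "compact K" "K \<subseteq> \<Omega>" "\<And>x. x \<notin> K \<Longrightarrow> \<phi> x = 0"
    "\<And>x h. x \<notin> K \<Longrightarrow> frechet_derivative \<phi> (at x) h = 0"
proof -
  define K where "K = closure {x. \<phi> x \<noteq> 0}"
  have K: "compact K" "K \<subseteq> \<Omega>" using assms by (simp_all add: K_def test_functions_def)
  have z: "\<phi> x = 0" if "x \<notin> K" for x
  proof (rule ccontr)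
    assume "\<phi> x \<noteq> 0"
    then have "x \<in> K" unfolding K_def by (intro closure_subset[THEN subsetD] CollectI)
    with that show False ..
  qed
  have "frechet_derivative \<phi> (at x) h = 0" if "x \<notin> K" for x h
  proof -
    have "(\<phi> has_derivative (\<lambda>h. 0)) (at x)"
    proof (rule has_derivative_transform_within_open)
      show "((\<lambda>x. 0) has_derivative (\<lambda>h. 0)) (at x)" by simp
      show "open (- K)" using compact_imp_closed[OF K(1)] by (simp add: open_Compl)
    qed (use that z in auto)
    from frechet_derivative_at[OF this, symmetric] show ?thesis by simp
  qed
  with K z show ?thesis by (rule that)
qed

lemma continuous_compact_support_L2:
  fixes f :: "'a::euclidean_space \<Rightarrow> real"
  assumes "open \<Omega>" "continuous_on UNIV f" "compact K" "K \<subseteq> \<Omega>" "\<And>x. x \<notin> K \<Longrightarrow> f x = 0"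
  shows "f \<in> L2_space \<Omega>"
proof (rule L2_spaceI)
  show "f \<in> borel_measurable (lebesgue_on \<Omega>)"
    by (intro measurable_restrict_space1 measurable_completion) (simp add: assms(2) borel_measurable_continuous_onI)
  have "integrable lborel (\<lambda>x. (f x)\<^sup>2)"
    by (rule integrable_lborel_continuous_compact_support[OF _ assms(3)]) (auto intro!: continuous_intros assms)
  then have i: "integrable lebesgue (\<lambda>x. (f x)\<^sup>2)"
    by (subst integrable_completion) (auto intro!: borel_measurable_continuous_onI continuous_intros assms(2))
  have "(\<lambda>x. if x \<in> \<Omega> then (f x)\<^sup>2 else 0) = (\<lambda>x. (f x)\<^sup>2)"
    using assms(4,5) by (auto simp: fun_eq_iff)
  then show "integrable (lebesgue_on \<Omega>) (\<lambda>x. (f x)\<^sup>2)"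
    using i Lebesgue_Measure.integrable_restrict_UNIV[of \<Omega> "\<lambda>x. (f x)\<^sup>2"] assms(1) by simp
qed

lemma integral_lebesgue_on_eq_lborel:
  fixes f :: "'a::euclidean_space \<Rightarrow> real"
  assumes "open \<Omega>" "f \<in> borel_measurable borel" "\<And>x. x \<notin> \<Omega> \<Longrightarrow> f x = 0"
  shows "integral\<^sup>L (lebesgue_on \<Omega>) f = integral\<^sup>L lborel f"
proof -
  have "(\<lambda>x. if x \<in> \<Omega> then f x else 0) = f" using assms(3) by (auto simp: fun_eq_iff)
  then have "integral\<^sup>L (lebesgue_on \<Omega>) f = integral\<^sup>L lebesgue f"
    using Lebesgue_Measure.integral_restrict_UNIV[of \<Omega> f] assms(1) by simp
  then show ?thesis using assms(2) by (simp add: integral_completion)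
qed

lemma test_function_L2:
  assumes "open \<Omega>" "\<phi> \<in> test_functions \<Omega>"
  shows "\<phi> \<in> L2_space \<Omega>" "(\<lambda>x. frechet_derivative \<phi> (at x) b) \<in> L2_space \<Omega>"
proof -
  obtain K where K: "compact K" "K \<subseteq> \<Omega>" "\<And>x. x \<notin> K \<Longrightarrow> \<phi> x = 0"
    "\<And>x h. x \<notin> K \<Longrightarrow> frechet_derivative \<phi> (at x) h = 0"
    by (rule test_function_support[OF assms(2)], rule that)
  show "\<phi> \<in> L2_space \<Omega>" "(\<lambda>x. frechet_derivative \<phi> (at x) b) \<in> L2_space \<Omega>"
    using continuous_compact_support_L2[OF assms(1) _ K(1,2)] K(3,4)
      test_function_continuous[OF assms(2)] test_function_derivative_continuous[OF assms(2)] by auto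
qed

text \<open>The product of the two test functions has compact support, so its derivative integrates
  to zero; the product rule splits this into the two sides of integration by parts.\<close>

lemma has_weak_deriv_test_function:
  assumes \<Omega>: "open \<Omega>" and \<phi>: "\<phi> \<in> test_functions \<Omega>"
  shows "has_weak_deriv \<Omega> b \<phi> (\<lambda>x. frechet_derivative \<phi> (at x) b)"
  unfolding has_weak_deriv_def
proof (intro conjI ballI test_function_L2[OF assms])
  fix \<psi> assume \<psi>: "\<psi> \<in> test_functions \<Omega>"
  let ?d = "\<lambda>x. \<phi> x * frechet_derivative \<psi> (at x) b + frechet_derivative \<phi> (at x) b * \<psi> x"
  obtain K where K: "compact K" "K \<subseteq> \<Omega>" "\<And>x. x \<notin> K \<Longrightarrow> \<phi> x = 0"
    "\<And>x h. x \<notin> K \<Longrightarrow> frechet_derivative \<phi> (at x) h = 0"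
    by (rule test_function_support[OF \<phi>], rule that)
  note c = test_function_continuous[OF \<phi>] test_function_derivative_continuous[OF \<phi>]
    test_function_continuous[OF \<psi>] test_function_derivative_continuous[OF \<psi>]
  have cd: "continuous_on UNIV ?d" by (intro continuous_intros c)
  have "integral\<^sup>L lborel ?d = 0"
    by (rule integral_derivative_compact_support[where f="\<lambda>x. \<phi> x * \<psi> x" and K=K
          and f'="\<lambda>x h. \<phi> x * frechet_derivative \<psi> (at x) h + frechet_derivative \<phi> (at x) h * \<psi> x"])
      (use cd K in \<open>auto intro!: has_derivative_mult test_function_derivative[OF \<phi>] test_function_derivative[OF \<psi>]\<close>)
  moreover have "\<phi> x = 0 \<and> frechet_derivative \<phi> (at x) b = 0" if "x \<notin> \<Omega>" for x
    using that K by blast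
  ultimately have "integral\<^sup>L (lebesgue_on \<Omega>) ?d = 0"
    by (subst integral_lebesgue_on_eq_lborel[OF \<Omega> borel_measurable_continuous_onI[OF cd]]) auto
  moreover have "integral\<^sup>L (lebesgue_on \<Omega>) ?d = integral\<^sup>L (lebesgue_on \<Omega>) (\<lambda>x. \<phi> x * frechet_derivative \<psi> (at x) b)
      + integral\<^sup>L (lebesgue_on \<Omega>) (\<lambda>x. frechet_derivative \<phi> (at x) b * \<psi> x)"
    by (intro Bochner_Integration.integral_add L2_space_integrable_mult test_function_L2 \<Omega> \<phi> \<psi>)
  ultimately show "integral\<^sup>L (lebesgue_on \<Omega>) (\<lambda>x. \<phi> x * frechet_derivative \<psi> (at x) b)
      = - integral\<^sup>L (lebesgue_on \<Omega>) (\<lambda>x. frechet_derivative \<phi> (at x) b * \<psi> x)" by simp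
qed

section \<open>Weak derivatives up to null sets, and the first-order Sobolev norm\<close>

lemma has_weak_deriv_L2:
  "has_weak_deriv \<Omega> b f g \<Longrightarrow> f \<in> L2_space \<Omega>" "has_weak_deriv \<Omega> b f g \<Longrightarrow> g \<in> L2_space \<Omega>"
  by (auto simp: has_weak_deriv_def)

lemma has_weak_deriv_ip:
  "has_weak_deriv \<Omega> b f g \<Longrightarrow> \<phi> \<in> test_functions \<Omega> \<Longrightarrow>
    L2_ip \<Omega> f (\<lambda>x. frechet_derivative \<phi> (at x) b) = - L2_ip \<Omega> g \<phi>"
  by (auto simp: has_weak_deriv_def L2_ip_def)

lemma has_weak_deriv_diff:
  assumes "open \<Omega>" and fg: "has_weak_deriv \<Omega> b f f'" "has_weak_deriv \<Omega> b g g'"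
  shows "has_weak_deriv \<Omega> b (\<lambda>x. f x - g x) (\<lambda>x. f' x - g' x)"
  unfolding has_weak_deriv_def L2_ip_def[symmetric]
  using has_weak_deriv_ip[OF fg(1)] has_weak_deriv_ip[OF fg(2)] test_function_L2[OF assms(1)]
  by (auto simp: L2_ip_diff_left has_weak_deriv_L2[OF fg(1)] has_weak_deriv_L2[OF fg(2)] intro!: L2_space_diff)

text \<open>This is what gives access to \<open>weak_deriv\<close>, an arbitrary choice: any weak
  derivative found by other means agrees with it almost everywhere. In particular
  \<open>weak_deriv\<close> is additive almost everywhere.\<close>

lemma has_weak_deriv_unique:
  assumes "open \<Omega>" and "has_weak_deriv \<Omega> b f g" "has_weak_deriv \<Omega> b f h"
  shows "AE x in lebesgue_on \<Omega>. g x = h x"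
proof -
  have L: "g \<in> L2_space \<Omega>" "h \<in> L2_space \<Omega>" using assms has_weak_deriv_L2 by blast+
  have "AE x in lebesgue_on \<Omega>. g x - h x = 0"
  proof (rule fundamental_lemma[OF assms(1) L2_space_diff[OF L]])
    fix \<phi> assume \<phi>: "\<phi> \<in> test_functions \<Omega>"
    have "L2_ip \<Omega> (\<lambda>x. g x - h x) \<phi> = 0"
      using has_weak_deriv_ip[OF assms(2) \<phi>] has_weak_deriv_ip[OF assms(3) \<phi>]
      by (simp add: L2_ip_diff_left L test_function_L2(1)[OF assms(1) \<phi>])
    then show "integral\<^sup>L (lebesgue_on \<Omega>) (\<lambda>x. (g x - h x) * \<phi> x) = 0" by (simp add: L2_ip_def)
  qed
  then show ?thesis by simp
qed

lemma H1_has_weak_deriv: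
  assumes "f \<in> H1_space \<Omega>" "b \<in> Basis"
  shows "has_weak_deriv \<Omega> b f (weak_deriv \<Omega> b f)"
proof -
  have "\<exists>g. has_weak_deriv \<Omega> b f g" using assms by (simp add: H1_space_def)
  then show ?thesis unfolding weak_deriv_def by (rule someI_ex)
qed

lemma H1_L2: "f \<in> H1_space \<Omega> \<Longrightarrow> f \<in> L2_space \<Omega>"
  by (simp add: H1_space_def)

lemma weak_deriv_L2: "f \<in> H1_space \<Omega> \<Longrightarrow> b \<in> Basis \<Longrightarrow> weak_deriv \<Omega> b f \<in> L2_space \<Omega>"
  using H1_has_weak_deriv has_weak_deriv_L2(2) by blast

lemma H1_diff:
  assumes "open \<Omega>" "f \<in> H1_space \<Omega>" "g \<in> H1_space \<Omega>"
  shows "(\<lambda>x. f x - g x) \<in> H1_space \<Omega>"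
  using has_weak_deriv_diff[OF assms(1) H1_has_weak_deriv[OF assms(2)] H1_has_weak_deriv[OF assms(3)]]
    L2_space_diff[OF H1_L2[OF assms(2)] H1_L2[OF assms(3)]]
  unfolding H1_space_def by blast

lemma weak_deriv_diff:
  assumes "open \<Omega>" "f \<in> H1_space \<Omega>" "g \<in> H1_space \<Omega>" "b \<in> Basis"
  shows "AE x in lebesgue_on \<Omega>. weak_deriv \<Omega> b (\<lambda>x. f x - g x) x = weak_deriv \<Omega> b f x - weak_deriv \<Omega> b g x"
  by (rule has_weak_deriv_unique[OF assms(1) H1_has_weak_deriv[OF H1_diff[OF assms(1-3)] assms(4)]
        has_weak_deriv_diff[OF assms(1) H1_has_weak_deriv[OF assms(2,4)] H1_has_weak_deriv[OF assms(3,4)]]])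

lemma L2_norm_weak_deriv_diff:
  assumes "open \<Omega>" "f \<in> H1_space \<Omega>" "g \<in> H1_space \<Omega>" "b \<in> Basis"
  shows "L2_norm \<Omega> (weak_deriv \<Omega> b (\<lambda>x. f x - g x)) = L2_norm \<Omega> (\<lambda>x. weak_deriv \<Omega> b f x - weak_deriv \<Omega> b g x)"
  by (rule L2_norm_cong_AE[OF weak_deriv_diff[OF assms]])
    (auto intro!: L2_space_diff weak_deriv_L2 H1_diff assms)

lemma test_function_H1:
  assumes "open \<Omega>" "\<phi> \<in> test_functions \<Omega>"
  shows "\<phi> \<in> H1_space \<Omega>"
  using has_weak_deriv_test_function[OF assms] test_function_L2[OF assms] by (auto simp: H1_space_def)

lemma weak_deriv_test_function:
  assumes "open \<Omega>" "\<phi> \<in> test_functions \<Omega>" "b \<in> Basis"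
  shows "AE x in lebesgue_on \<Omega>. weak_deriv \<Omega> b \<phi> x = frechet_derivative \<phi> (at x) b"
  by (rule has_weak_deriv_unique[OF assms(1) H1_has_weak_deriv[OF test_function_H1[OF assms(1,2)] assms(3)]
        has_weak_deriv_test_function[OF assms(1,2)]])

definition grad_sq :: "'a::euclidean_space set \<Rightarrow> ('a \<Rightarrow> real) \<Rightarrow> real" where
  "grad_sq \<Omega> f = (\<Sum>b\<in>Basis. (L2_norm \<Omega> (weak_deriv \<Omega> b f))\<^sup>2)"

lemma grad_sq_nonneg [simp]: "0 \<le> grad_sq \<Omega> f"
  by (simp add: grad_sq_def sum_nonneg)

lemma H1_norm_sq: "(H1_norm \<Omega> f)\<^sup>2 = (L2_norm \<Omega> f)\<^sup>2 + grad_sq \<Omega> f"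
  by (simp add: H1_norm_def grad_sq_def sum_nonneg)

lemma H1_norm_nonneg [simp]: "0 \<le> H1_norm \<Omega> f"
  by (simp add: H1_norm_def sum_nonneg)

lemma grad_sq_diff_le:
  assumes "open \<Omega>" "f \<in> H1_space \<Omega>" "g \<in> H1_space \<Omega>"
  shows "grad_sq \<Omega> (\<lambda>x. f x - g x) \<le> 2 * grad_sq \<Omega> f + 2 * grad_sq \<Omega> g"
  unfolding grad_sq_def sum_distrib_left sum.distrib[symmetric]
proof (rule sum_mono)
  fix b :: 'a assume b: "b \<in> Basis"
  let ?f = "weak_deriv \<Omega> b f" and ?g = "weak_deriv \<Omega> b g"
  have "(L2_norm \<Omega> (\<lambda>x. ?f x - ?g x))\<^sup>2 \<le> (L2_norm \<Omega> ?f + L2_norm \<Omega> ?g)\<^sup>2"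
    by (intro power_mono L2_norm_triangle_diff weak_deriv_L2 assms b) simp
  also have "\<dots> \<le> 2 * (L2_norm \<Omega> ?f)\<^sup>2 + 2 * (L2_norm \<Omega> ?g)\<^sup>2"
    using sum_squares_bound[of "L2_norm \<Omega> ?f" "L2_norm \<Omega> ?g"] by (simp add: power2_sum)
  finally show "(L2_norm \<Omega> (weak_deriv \<Omega> b (\<lambda>x. f x - g x)))\<^sup>2 \<le> 2 * (L2_norm \<Omega> ?f)\<^sup>2 + 2 * (L2_norm \<Omega> ?g)\<^sup>2"
    by (simp add: L2_norm_weak_deriv_diff[OF assms b])
qed

lemma H1_norm_diff_sq_le:
  assumes "open \<Omega>" "f \<in> H1_space \<Omega>" "g \<in> H1_space \<Omega>"
  shows "(H1_norm \<Omega> (\<lambda>x. f x - g x))\<^sup>2 \<le> 2 * (H1_norm \<Omega> f)\<^sup>2 + 2 * (H1_norm \<Omega> g)\<^sup>2"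
proof -
  have "(L2_norm \<Omega> (\<lambda>x. f x - g x))\<^sup>2 \<le> (L2_norm \<Omega> f + L2_norm \<Omega> g)\<^sup>2"
    by (intro power_mono L2_norm_triangle_diff H1_L2 assms) simp
  also have "\<dots> \<le> 2 * (L2_norm \<Omega> f)\<^sup>2 + 2 * (L2_norm \<Omega> g)\<^sup>2"
    using sum_squares_bound[of "L2_norm \<Omega> f" "L2_norm \<Omega> g"] by (simp add: power2_sum)
  finally show ?thesis using grad_sq_diff_le[OF assms] by (simp add: H1_norm_sq)
qed

section \<open>Functions vanishing on the boundary: approximation, Green's identity, Poincare's
  inequality\<close>

lemma H10_H1: "f \<in> H10_space \<Omega> \<Longrightarrow> f \<in> H1_space \<Omega>"
  by (simp add: H10_space_def)

lemma H10_diff: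
  assumes \<Omega>: "open \<Omega>" and f: "f \<in> H10_space \<Omega>" and g: "g \<in> H10_space \<Omega>"
  shows "(\<lambda>x. f x - g x) \<in> H10_space \<Omega>"
proof -
  have "\<exists>\<phi>\<in>test_functions \<Omega>. H1_norm \<Omega> (\<lambda>x. (f x - g x) - \<phi> x) < \<delta>" if "\<delta> > 0" for \<delta>
  proof -
    \<comment> \<open>Half of \<delta> suffices although the squared norm of a difference costs a
      factor 2 on each side: four times the square of \<delta> / 2 is the square of
      \<delta>.\<close>
    have "\<delta> / 2 > 0" using \<open>\<delta> > 0\<close> by simp
    then obtain \<phi> \<psi> where t: "\<phi> \<in> test_functions \<Omega>" "\<psi> \<in> test_functions \<Omega>"
      "H1_norm \<Omega> (\<lambda>x. f x - \<phi> x) < \<delta> / 2" "H1_norm \<Omega> (\<lambda>x. g x - \<psi> x) < \<delta> / 2"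
      using f g unfolding H10_space_def by blast
    have "(\<lambda>x. (f x - g x) - (\<phi> x - \<psi> x)) = (\<lambda>x. (f x - \<phi> x) - (g x - \<psi> x))" by auto
    then have "(H1_norm \<Omega> (\<lambda>x. (f x - g x) - (\<phi> x - \<psi> x)))\<^sup>2
        \<le> 2 * (H1_norm \<Omega> (\<lambda>x. f x - \<phi> x))\<^sup>2 + 2 * (H1_norm \<Omega> (\<lambda>x. g x - \<psi> x))\<^sup>2"
      using H1_norm_diff_sq_le[OF \<Omega> H1_diff[OF \<Omega> H10_H1[OF f] test_function_H1[OF \<Omega> t(1)]]
          H1_diff[OF \<Omega> H10_H1[OF g] test_function_H1[OF \<Omega> t(2)]]] by simp
    also have "\<dots> < 2 * (\<delta> / 2)\<^sup>2 + 2 * (\<delta> / 2)\<^sup>2"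
      using t(3,4) by (intro add_strict_mono mult_strict_left_mono power_strict_mono) auto
    finally have "(H1_norm \<Omega> (\<lambda>x. (f x - g x) - (\<phi> x - \<psi> x)))\<^sup>2 < \<delta>\<^sup>2"
      by (simp add: power2_eq_square)
    then have "H1_norm \<Omega> (\<lambda>x. (f x - g x) - (\<phi> x - \<psi> x)) < \<delta>"
      using \<open>\<delta> > 0\<close> by (simp add: power_less_imp_less_base)
    then show ?thesis by (intro bexI[of _ "\<lambda>x. \<phi> x - \<psi> x"] test_functions_diff[OF t(1,2)])
  qed
  then show ?thesis using H1_diff[OF \<Omega> H10_H1[OF f] H10_H1[OF g]] by (auto simp: H10_space_def)
qed

text \<open>Stated with classical derivatives of the test functions, the form in which they occur in
  the definition of weak derivatives and in Poincare's inequality.\<close>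

lemma H10_approximation:
  assumes \<Omega>: "open \<Omega>" and f: "f \<in> H10_space \<Omega>"
  obtains \<phi> where "\<And>n. \<phi> n \<in> test_functions \<Omega>" "(\<lambda>n. L2_norm \<Omega> (\<lambda>x. \<phi> n x - f x)) \<longlonglongrightarrow> 0"
    "\<And>b. b \<in> Basis \<Longrightarrow> (\<lambda>n. L2_norm \<Omega> (\<lambda>x. frechet_derivative (\<phi> n) (at x) b - weak_deriv \<Omega> b f x)) \<longlonglongrightarrow> 0"
proof -
  have "\<exists>\<phi>\<in>test_functions \<Omega>. H1_norm \<Omega> (\<lambda>x. f x - \<phi> x) < inverse (real (Suc n))" for n
    using f unfolding H10_space_def by auto
  then obtain \<phi> where \<phi>: "\<And>n. \<phi> n \<in> test_functions \<Omega>"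
    "\<And>n. H1_norm \<Omega> (\<lambda>x. f x - \<phi> n x) < inverse (real (Suc n))" by metis
  have N: "L2_norm \<Omega> (\<lambda>x. \<phi> n x - f x) \<le> H1_norm \<Omega> (\<lambda>x. f x - \<phi> n x)" for n
    by (rule power2_le_imp_le) (auto simp: H1_norm_sq L2_norm_minus_commute[of \<Omega> f])
  have G: "L2_norm \<Omega> (\<lambda>x. frechet_derivative (\<phi> n) (at x) b - weak_deriv \<Omega> b f x) \<le> H1_norm \<Omega> (\<lambda>x. f x - \<phi> n x)"
    if b: "b \<in> Basis" for n b
  proof (rule power2_le_imp_le)
    have "L2_norm \<Omega> (weak_deriv \<Omega> b (\<lambda>x. f x - \<phi> n x)) = L2_norm \<Omega> (\<lambda>x. weak_deriv \<Omega> b f x - weak_deriv \<Omega> b (\<phi> n) x)"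
      by (rule L2_norm_weak_deriv_diff[OF \<Omega> H10_H1[OF f] test_function_H1[OF \<Omega> \<phi>(1)] b])
    also have "\<dots> = L2_norm \<Omega> (\<lambda>x. weak_deriv \<Omega> b f x - frechet_derivative (\<phi> n) (at x) b)"
      using weak_deriv_test_function[OF \<Omega> \<phi>(1) b, of n]
      by (intro L2_norm_cong_AE L2_space_diff weak_deriv_L2 test_function_L2 test_function_H1 H10_H1 \<Omega> f \<phi>(1) b) auto
    finally have "(L2_norm \<Omega> (\<lambda>x. frechet_derivative (\<phi> n) (at x) b - weak_deriv \<Omega> b f x))\<^sup>2
        = (L2_norm \<Omega> (weak_deriv \<Omega> b (\<lambda>x. f x - \<phi> n x)))\<^sup>2"
      by (simp add: L2_norm_minus_commute[of \<Omega> "weak_deriv \<Omega> b f"])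
    also have "\<dots> \<le> grad_sq \<Omega> (\<lambda>x. f x - \<phi> n x)"
      unfolding grad_sq_def by (rule member_le_sum[OF b]) auto
    finally show "(L2_norm \<Omega> (\<lambda>x. frechet_derivative (\<phi> n) (at x) b - weak_deriv \<Omega> b f x))\<^sup>2
        \<le> (H1_norm \<Omega> (\<lambda>x. f x - \<phi> n x))\<^sup>2"
      by (simp add: H1_norm_sq add_increasing)
  qed simp
  show ?thesis
  proof (rule that[of \<phi>, OF \<phi>(1)])
    show "(\<lambda>n. L2_norm \<Omega> (\<lambda>x. \<phi> n x - f x)) \<longlonglongrightarrow> 0"
      by (rule Lim_null_comparison[OF _ LIMSEQ_inverse_real_of_nat])
        (auto intro!: always_eventually order.trans[OF N less_imp_le[OF \<phi>(2)]] simp del: of_nat_Suc)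
    show "(\<lambda>n. L2_norm \<Omega> (\<lambda>x. frechet_derivative (\<phi> n) (at x) b - weak_deriv \<Omega> b f x)) \<longlonglongrightarrow> 0"
      if "b \<in> Basis" for b
      by (rule Lim_null_comparison[OF _ LIMSEQ_inverse_real_of_nat])
        (auto intro!: always_eventually order.trans[OF G[OF that] less_imp_le[OF \<phi>(2)]] simp del: of_nat_Suc)
  qed
qed

lemma weak_laplacian_L2:
  assumes "g \<in> H2_space \<Omega>"
  shows "weak_laplacian \<Omega> g \<in> L2_space \<Omega>"
  unfolding weak_laplacian_def
  using assms by (auto simp: H2_space_def intro!: L2_space_sum weak_deriv_L2)

text \<open>Each first derivative of g has a weak derivative itself. Its defining identity is tested
  with functions approximating f, and both sides pass to the limit; no boundary term appears because
  test functions vanish near the boundary.\<close>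

lemma green_identity:
  assumes \<Omega>: "open \<Omega>" and f: "f \<in> H10_space \<Omega>" and g: "g \<in> H2_space \<Omega>"
  shows "L2_ip \<Omega> (weak_laplacian \<Omega> g) f = - (\<Sum>b\<in>Basis. L2_ip \<Omega> (weak_deriv \<Omega> b g) (weak_deriv \<Omega> b f))"
proof -
  obtain \<phi> where \<phi>: "\<And>n. \<phi> n \<in> test_functions \<Omega>" "(\<lambda>n. L2_norm \<Omega> (\<lambda>x. \<phi> n x - f x)) \<longlonglongrightarrow> 0"
    "\<And>b. b \<in> Basis \<Longrightarrow> (\<lambda>n. L2_norm \<Omega> (\<lambda>x. frechet_derivative (\<phi> n) (at x) b - weak_deriv \<Omega> b f x)) \<longlonglongrightarrow> 0"
    by (rule H10_approximation[OF \<Omega> f], rule that)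
  have g1: "g \<in> H1_space \<Omega>" "\<And>b. b \<in> Basis \<Longrightarrow> weak_deriv \<Omega> b g \<in> H1_space \<Omega>"
    using g by (auto simp: H2_space_def)
  have "L2_ip \<Omega> (weak_deriv \<Omega> b g) (weak_deriv \<Omega> b f) = - L2_ip \<Omega> (weak_deriv \<Omega> b (weak_deriv \<Omega> b g)) f"
    if b: "b \<in> Basis" for b
  proof (rule LIMSEQ_unique)
    have c: "((\<lambda>n. L2_norm \<Omega> (\<lambda>x. a x - a x)) \<longlongrightarrow> 0) sequentially" for a by simp
    show "(\<lambda>n. L2_ip \<Omega> (weak_deriv \<Omega> b g) (\<lambda>x. frechet_derivative (\<phi> n) (at x) b))
        \<longlonglongrightarrow> L2_ip \<Omega> (weak_deriv \<Omega> b g) (weak_deriv \<Omega> b f)"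
      by (rule L2_tendsto_ip[OF c \<phi>(3)[OF b]])
        (auto intro!: always_eventually weak_deriv_L2 g1 H10_H1[of f] f b test_function_L2(2)[OF \<Omega> \<phi>(1)])
    have "(\<lambda>n. - L2_ip \<Omega> (weak_deriv \<Omega> b (weak_deriv \<Omega> b g)) (\<phi> n))
        \<longlonglongrightarrow> - L2_ip \<Omega> (weak_deriv \<Omega> b (weak_deriv \<Omega> b g)) f"
      by (rule tendsto_minus, rule L2_tendsto_ip[OF c \<phi>(2)])
        (auto intro!: always_eventually weak_deriv_L2 g1 H10_H1[of f] H1_L2[of f] f b test_function_L2(1)[OF \<Omega> \<phi>(1)])
    then show "(\<lambda>n. L2_ip \<Omega> (weak_deriv \<Omega> b g) (\<lambda>x. frechet_derivative (\<phi> n) (at x) b))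
        \<longlonglongrightarrow> - L2_ip \<Omega> (weak_deriv \<Omega> b (weak_deriv \<Omega> b g)) f"
      using has_weak_deriv_ip[OF H1_has_weak_deriv[OF g1(2)[OF b] b] \<phi>(1)] by simp
  qed
  then show ?thesis
    unfolding weak_laplacian_def
    by (subst L2_ip_sum_left) (auto intro!: weak_deriv_L2 g1 H1_L2[of f] H10_H1[of f] f simp: sum_negf[symmetric])
qed

text \<open>Integrate the derivative of \<open>x \<mapsto> (\<phi> x)\<^sup>2 * (x \<bullet> b)\<close>.\<close>

lemma poincare_test_function:
  fixes \<Omega> :: "'a::euclidean_space set"
  assumes \<Omega>: "open \<Omega>" "\<Omega> \<subseteq> cball 0 R" and \<phi>: "\<phi> \<in> test_functions \<Omega>" and b: "b \<in> Basis" and R: "R \<ge> 0"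
  shows "L2_norm \<Omega> \<phi> \<le> 2 * R * L2_norm \<Omega> (\<lambda>x. frechet_derivative \<phi> (at x) b)"
proof -
  let ?D = "\<lambda>x. frechet_derivative \<phi> (at x) b"
  let ?e = "\<lambda>x. (\<phi> x)\<^sup>2 + 2 * (\<phi> x * (x \<bullet> b) * ?D x)"
  obtain K where K: "compact K" "K \<subseteq> \<Omega>" "\<And>x. x \<notin> K \<Longrightarrow> \<phi> x = 0"
    by (rule test_function_support[OF \<phi>], rule that)
  note c = test_function_continuous[OF \<phi>] test_function_derivative_continuous[OF \<phi>]
  have ce: "continuous_on UNIV ?e" by (intro continuous_intros c)
  have "integral\<^sup>L lborel (\<lambda>x. (\<phi> x)\<^sup>2 * (b \<bullet> b) + (2 * \<phi> x * ?D x) * (x \<bullet> b)) = 0"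
  proof (rule integral_derivative_compact_support[where f="\<lambda>x. (\<phi> x)\<^sup>2 * (x \<bullet> b)" and K=K
      and f'="\<lambda>x h. (\<phi> x)\<^sup>2 * (h \<bullet> b) + (2 * \<phi> x * frechet_derivative \<phi> (at x) h) * (x \<bullet> b)"])
    show "((\<lambda>x. (\<phi> x)\<^sup>2 * (x \<bullet> b)) has_derivative (\<lambda>h. (\<phi> x)\<^sup>2 * (h \<bullet> b) + 2 * \<phi> x * frechet_derivative \<phi> (at x) h * (x \<bullet> b))) (at x)" for x
      by (auto intro!: derivative_eq_intros test_function_derivative[OF \<phi>])
    show "continuous_on UNIV (\<lambda>x. (\<phi> x)\<^sup>2 * (b \<bullet> b) + 2 * \<phi> x * ?D x * (x \<bullet> b))"
      by (intro continuous_intros c)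
  qed (use K in auto)
  then have "integral\<^sup>L lborel ?e = 0" using b by (simp add: algebra_simps)
  moreover have "\<phi> x = 0" if "x \<notin> \<Omega>" for x
    using that K by blast
  ultimately have e0: "integral\<^sup>L (lebesgue_on \<Omega>) ?e = 0"
    by (subst integral_lebesgue_on_eq_lborel[OF \<Omega>(1) borel_measurable_continuous_onI[OF ce]]) auto
  have p: "\<phi> \<in> L2_space \<Omega>" "?D \<in> L2_space \<Omega>" using test_function_L2[OF \<Omega>(1) \<phi>] by auto
  have xp: "(\<lambda>x. \<phi> x * (x \<bullet> b)) \<in> L2_space \<Omega>"
    by (rule continuous_compact_support_L2[OF \<Omega>(1) _ K(1,2)]) (use K(3) in \<open>auto intro!: continuous_intros c\<close>)
  have "L2_ip \<Omega> \<phi> \<phi> + 2 * L2_ip \<Omega> (\<lambda>x. \<phi> x * (x \<bullet> b)) ?D = integral\<^sup>L (lebesgue_on \<Omega>) ?e"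
    using L2_space_integrable_mult[OF xp p(2)] L2_space_integrable_sq[OF p(1)]
    by (simp add: L2_ip_def power2_eq_square)
  then have "(L2_norm \<Omega> \<phi>)\<^sup>2 = - 2 * L2_ip \<Omega> (\<lambda>x. \<phi> x * (x \<bullet> b)) ?D"
    using e0 by (simp add: L2_ip_self)
  also have "\<dots> \<le> 2 * (L2_norm \<Omega> (\<lambda>x. \<phi> x * (x \<bullet> b)) * L2_norm \<Omega> ?D)"
    using L2_Cauchy_Schwarz[OF xp p(2)] by linarith
  also have "L2_norm \<Omega> (\<lambda>x. \<phi> x * (x \<bullet> b)) \<le> R * L2_norm \<Omega> \<phi>"
  proof -
    have "integral\<^sup>L (lebesgue_on \<Omega>) (\<lambda>x. (\<phi> x * (x \<bullet> b))\<^sup>2) \<le> integral\<^sup>L (lebesgue_on \<Omega>) (\<lambda>x. (R * \<phi> x)\<^sup>2)"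
    proof (rule integral_mono[OF L2_space_integrable_sq[OF xp] L2_space_integrable_sq[OF L2_space_scale[OF p(1)]]])
      fix x assume "x \<in> space (lebesgue_on \<Omega>)"
      then have "\<bar>x \<bullet> b\<bar> \<le> R" using \<Omega>(2) b Basis_le_norm[of b x] by auto
      then have "\<bar>\<phi> x * (x \<bullet> b)\<bar> \<le> \<bar>R * \<phi> x\<bar>"
        using R by (simp add: abs_mult mult.commute[of R] mult_left_mono)
      then show "(\<phi> x * (x \<bullet> b))\<^sup>2 \<le> (R * \<phi> x)\<^sup>2" by (simp add: abs_le_square_iff)
    qed
    then have "L2_norm \<Omega> (\<lambda>x. \<phi> x * (x \<bullet> b)) \<le> L2_norm \<Omega> (\<lambda>x. R * \<phi> x)"
      unfolding L2_norm_def by simp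
    then show ?thesis using R by (simp add: L2_norm_scale)
  qed
  finally have "L2_norm \<Omega> \<phi> * L2_norm \<Omega> \<phi> \<le> L2_norm \<Omega> \<phi> * (2 * R * L2_norm \<Omega> ?D)"
    by (simp add: power2_eq_square algebra_simps mult_right_mono)
  then show ?thesis
  proof (cases "L2_norm \<Omega> \<phi> = 0")
    case False
    then have "L2_norm \<Omega> \<phi> > 0" using L2_norm_nonneg[of \<Omega> \<phi>] by linarith
    then show ?thesis using \<open>L2_norm \<Omega> \<phi> * L2_norm \<Omega> \<phi> \<le> _\<close> by simp
  qed (use R in simp)
qed

text \<open>The inequality for test functions survives the limit. One coordinate direction already
  controls f, and the full gradient only enlarges the right-hand side.\<close>

lemma poincare_inequality:
  fixes \<Omega> :: "'a::euclidean_space set"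
  assumes \<Omega>: "open \<Omega>" "\<Omega> \<subseteq> cball 0 R" and R: "R \<ge> 0" and f: "f \<in> H10_space \<Omega>"
  shows "(L2_norm \<Omega> f)\<^sup>2 \<le> 4 * R\<^sup>2 * grad_sq \<Omega> f"
proof -
  obtain b :: 'a where b: "b \<in> Basis" using nonempty_Basis by blast
  obtain \<phi> where \<phi>: "\<And>n. \<phi> n \<in> test_functions \<Omega>" "(\<lambda>n. L2_norm \<Omega> (\<lambda>x. \<phi> n x - f x)) \<longlonglongrightarrow> 0"
    "\<And>b. b \<in> Basis \<Longrightarrow> (\<lambda>n. L2_norm \<Omega> (\<lambda>x. frechet_derivative (\<phi> n) (at x) b - weak_deriv \<Omega> b f x)) \<longlonglongrightarrow> 0"
    by (rule H10_approximation[OF \<Omega>(1) f], rule that)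
  have "(\<lambda>n. L2_norm \<Omega> (\<phi> n)) \<longlonglongrightarrow> L2_norm \<Omega> f"
    by (rule L2_tendsto_norm[OF \<phi>(2)])
      (auto intro!: always_eventually test_function_L2(1)[OF \<Omega>(1) \<phi>(1)] H10_H1 H1_L2[of f] f)
  moreover have "(\<lambda>n. L2_norm \<Omega> (\<lambda>x. frechet_derivative (\<phi> n) (at x) b)) \<longlonglongrightarrow> L2_norm \<Omega> (weak_deriv \<Omega> b f)"
    by (rule L2_tendsto_norm[OF \<phi>(3)[OF b]])
      (auto intro!: always_eventually test_function_L2(2)[OF \<Omega>(1) \<phi>(1)] weak_deriv_L2 H10_H1[of f] f b)
  ultimately have "L2_norm \<Omega> f \<le> 2 * R * L2_norm \<Omega> (weak_deriv \<Omega> b f)"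
    using poincare_test_function[OF \<Omega> \<phi>(1) b R]
    by (intro LIMSEQ_le[of _ _ "\<lambda>n. 2 * R * L2_norm \<Omega> (\<lambda>x. frechet_derivative (\<phi> n) (at x) b)"] tendsto_mult tendsto_const) auto
  then have "(L2_norm \<Omega> f)\<^sup>2 \<le> (2 * R * L2_norm \<Omega> (weak_deriv \<Omega> b f))\<^sup>2" by (intro power_mono) auto
  also have "\<dots> = 4 * R\<^sup>2 * (L2_norm \<Omega> (weak_deriv \<Omega> b f))\<^sup>2" by (simp add: power_mult_distrib)
  also have "\<dots> \<le> 4 * R\<^sup>2 * grad_sq \<Omega> f"
    unfolding grad_sq_def by (intro mult_left_mono member_le_sum[OF b]) auto
  finally show ?thesis .
qed

section \<open>Differential inequalities\<close>

lemma has_real_derivative_eventually: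
  assumes "(f has_real_derivative d) (at x within S)" "\<eta> > 0"
  shows "\<forall>\<^sub>F y in at x within S. \<bar>f y - f x - d * (y - x)\<bar> \<le> \<eta> * \<bar>y - x\<bar>"
proof -
  have "((\<lambda>y. (f y - f x) / (y - x)) \<longlongrightarrow> d) (at x within S)"
    using assms(1) by (simp add: has_field_derivative_iff)
  then have "\<forall>\<^sub>F y in at x within S. \<bar>(f y - f x) / (y - x) - d\<bar> < \<eta>"
    using assms(2) by (auto dest!: tendstoD simp: dist_real_def)
  moreover have "\<forall>\<^sub>F y in at x within S. y \<noteq> x" by (auto simp: eventually_at_filter)
  ultimately show ?thesis
  proof eventually_elim
    case (elim y)
    then have "f y - f x - d * (y - x) = ((f y - f x) / (y - x) - d) * (y - x)"
      by (subst left_diff_distrib) simp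
    then show ?case using elim(1) by (simp add: abs_mult mult_right_mono)
  qed
qed

text \<open>The slope d may vary with the point and the error \<kappa> does not shrink, so \<Phi>
  need not be differentiable. The estimate is additive over adjacent intervals and holds on all
  short intervals around each point, where the errors to the left and to the right add up to
  \<kappa> times the length; bisection does the rest.\<close>

lemma dini_bound:
  fixes \<Phi> :: "real \<Rightarrow> real"
  assumes "a \<le> b"
    and loc: "\<And>x. x \<in> {a..b} \<Longrightarrow>
      \<exists>d\<le>D. \<forall>\<^sub>F y in at x within {a..b}. \<bar>\<Phi> y - \<Phi> x - d * (y - x)\<bar> \<le> \<kappa> * \<bar>y - x\<bar>"
  shows "\<Phi> b - \<Phi> a \<le> (D + \<kappa>) * (b - a)"
proof -
  have "a \<le> a \<and> b \<le> b \<longrightarrow> \<Phi> b - \<Phi> a \<le> (D + \<kappa>) * (b - a)"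
    using assms(1)
  proof (induction rule: Bolzano[where P="\<lambda>s t. a \<le> s \<and> t \<le> b \<longrightarrow> \<Phi> t - \<Phi> s \<le> (D + \<kappa>) * (t - s)"])
    case (trans s r t)
    then show ?case by (auto simp: algebra_simps)
  next
    case (local x)
    then obtain d where d: "d \<le> D"
      "\<forall>\<^sub>F y in at x within {a..b}. \<bar>\<Phi> y - \<Phi> x - d * (y - x)\<bar> \<le> \<kappa> * \<bar>y - x\<bar>"
      using loc by fastforce
    then obtain \<delta> where \<delta>: "\<delta> > 0"
      "\<And>y. y \<in> {a..b} \<Longrightarrow> y \<noteq> x \<Longrightarrow> dist y x < \<delta> \<Longrightarrow> \<bar>\<Phi> y - \<Phi> x - d * (y - x)\<bar> \<le> \<kappa> * \<bar>y - x\<bar>"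
      unfolding eventually_at by auto
    have near: "\<bar>\<Phi> y - \<Phi> x - d * (y - x)\<bar> \<le> \<kappa> * \<bar>y - x\<bar>" if "y \<in> {a..b}" "\<bar>y - x\<bar> < \<delta>" for y
      using \<delta>(2)[of y] that by (cases "y = x") (auto simp: dist_real_def)
    show ?case
    proof (intro exI[of _ \<delta>] conjI \<delta>(1) allI impI)
      fix s t assume st: "s \<le> x \<and> x \<le> t \<and> t - s < \<delta>" "a \<le> s \<and> t \<le> b"
      have "\<bar>\<Phi> t - \<Phi> x - d * (t - x)\<bar> \<le> \<kappa> * (t - x)" "\<bar>\<Phi> s - \<Phi> x - d * (s - x)\<bar> \<le> \<kappa> * (x - s)"
        using near[of t] near[of s] st by auto
      moreover have "d * (t - s) \<le> D * (t - s)" using d(1) st by (intro mult_right_mono) auto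
      ultimately show "\<Phi> t - \<Phi> s \<le> (D + \<kappa>) * (t - s)" by (auto simp: algebra_simps abs_le_iff)
    qed
  qed
  then show ?thesis by simp
qed

lemma derivative_within_bound:
  fixes \<Phi> :: "real \<Rightarrow> real"
  assumes "a \<le> b" and der: "\<And>x. x \<in> {a..b} \<Longrightarrow> (\<Phi> has_real_derivative d x) (at x within {a..b})"
    and d: "\<And>x. x \<in> {a..b} \<Longrightarrow> d x \<le> D"
  shows "\<Phi> b - \<Phi> a \<le> D * (b - a)"
proof (rule field_le_epsilon)
  fix e :: real assume "e > 0"
  \<comment> \<open>The added 1 keeps the denominator positive when a = b.\<close>
  define \<eta> where "\<eta> = e / (b - a + 1)"
  have \<eta>: "\<eta> > 0" using \<open>e > 0\<close> assms(1) by (simp add: \<eta>_def)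
  have "\<Phi> b - \<Phi> a \<le> (D + \<eta>) * (b - a)"
    by (rule dini_bound[OF assms(1)]) (use has_real_derivative_eventually[OF der \<eta>] d in blast)
  also have "\<dots> \<le> D * (b - a) + e"
    using \<open>e > 0\<close> assms(1) by (simp add: \<eta>_def field_simps)
  finally show "\<Phi> b - \<Phi> a \<le> D * (b - a) + e" .
qed

text \<open>The error \<open>\<kappa>\<close> will absorb the missing time derivative of the solution for \<open>\<xi> = 0\<close>.\<close>

lemma gronwall_dini:
  fixes \<Psi> g :: "real \<Rightarrow> real"
  assumes ab: "a \<le> b" and C: "C \<ge> 0" and \<kappa>: "\<kappa> \<ge> 0"
    and g: "continuous_on {a..b} g" "\<And>x. x \<in> {a..b} \<Longrightarrow> g x \<ge> 0"
    and loc: "\<And>x. x \<in> {a..b} \<Longrightarrow>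
      \<exists>d\<le>C * \<Psi> x - g x. \<forall>\<^sub>F y in at x within {a..b}. \<bar>\<Psi> y - \<Psi> x - d * (y - x)\<bar> \<le> \<kappa> * \<bar>y - x\<bar>"
  shows "\<Psi> b + integral {a..b} g \<le> exp (C * (b - a)) * (\<Psi> a + \<kappa> * (b - a))"
proof -
  \<comment> \<open>The local condition bounds increments linearly and so forces continuity; \<Psi>
    may therefore be integrated below.\<close>
  have cont: "continuous_on {a..b} \<Psi>"
    unfolding continuous_on_def
  proof
    fix x assume "x \<in> {a..b}"
    then obtain d where d: "\<forall>\<^sub>F y in at x within {a..b}. \<bar>\<Psi> y - \<Psi> x - d * (y - x)\<bar> \<le> \<kappa> * \<bar>y - x\<bar>"
      using loc by blast
    show "(\<Psi> \<longlongrightarrow> \<Psi> x) (at x within {a..b})"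
    proof (rule Lim_null[THEN iffD2], rule Lim_null_comparison)
      show "\<forall>\<^sub>F y in at x within {a..b}. norm (\<Psi> y - \<Psi> x) \<le> (\<bar>d\<bar> + \<kappa>) * \<bar>y - x\<bar>"
        using d
      proof eventually_elim
        case (elim y)
        have "\<bar>\<Psi> y - \<Psi> x\<bar> \<le> \<bar>\<Psi> y - \<Psi> x - d * (y - x)\<bar> + \<bar>d * (y - x)\<bar>" by linarith
        then show ?case using elim by (simp add: abs_mult distrib_right)
      qed
      have "((\<lambda>y. (\<bar>d\<bar> + \<kappa>) * \<bar>y - x\<bar>) \<longlongrightarrow> (\<bar>d\<bar> + \<kappa>) * \<bar>x - x\<bar>) (at x within {a..b})"
        by (intro tendsto_intros)
      then show "((\<lambda>y. (\<bar>d\<bar> + \<kappa>) * \<bar>y - x\<bar>) \<longlongrightarrow> 0) (at x within {a..b})" by simp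
    qed
  qed
  define h where "h s = C * \<Psi> s - g s" for s
  have ch: "continuous_on {a..b} h" unfolding h_def[abs_def] by (intro continuous_intros cont g)
  have main: "\<Psi> t + integral {a..t} g \<le> \<Psi> a + \<kappa> * (t - a) + C * integral {a..t} \<Psi>" if t: "t \<in> {a..b}" for t
  proof (rule field_le_epsilon)
    fix e :: real assume "e > 0"
    define \<eta> where "\<eta> = e / (t - a + 1)"
    have \<eta>: "\<eta> > 0" using \<open>e > 0\<close> t by (simp add: \<eta>_def)
    have sub: "{a..t} \<subseteq> {a..b}" using t by auto
    \<comment> \<open>After subtracting the integral of the majorant \<open>h\<close>, the local
      slopes are at most 0 up to the error \<kappa>, enlarged by \<eta> for differentiating the
      integral.\<close>
    let ?\<Phi> = "\<lambda>s. \<Psi> s - integral {a..s} h"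
    have "?\<Phi> t - ?\<Phi> a \<le> (0 + (\<kappa> + \<eta>)) * (t - a)"
    proof (rule dini_bound)
      fix x assume x: "x \<in> {a..t}"
      then obtain d where d: "d \<le> h x" "\<forall>\<^sub>F y in at x within {a..b}. \<bar>\<Psi> y - \<Psi> x - d * (y - x)\<bar> \<le> \<kappa> * \<bar>y - x\<bar>"
        using loc[of x] sub unfolding h_def by blast
      have "((\<lambda>s. integral {a..s} h) has_real_derivative h x) (at x within {a..t})"
        by (rule integral_has_real_derivative[OF continuous_on_subset[OF ch sub] x])
      from has_real_derivative_eventually[OF this \<eta>] filter_leD[OF at_le[OF sub] d(2)]
      have "\<forall>\<^sub>F y in at x within {a..t}. \<bar>?\<Phi> y - ?\<Phi> x - (d - h x) * (y - x)\<bar> \<le> (\<kappa> + \<eta>) * \<bar>y - x\<bar>"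
        by eventually_elim (simp add: algebra_simps abs_le_iff)
      then show "\<exists>d\<le>0. \<forall>\<^sub>F y in at x within {a..t}. \<bar>?\<Phi> y - ?\<Phi> x - d * (y - x)\<bar> \<le> (\<kappa> + \<eta>) * \<bar>y - x\<bar>"
        using d(1) by (intro exI[of _ "d - h x"]) auto
    qed (use t in auto)
    moreover have "integral {a..t} h = C * integral {a..t} \<Psi> - integral {a..t} g"
    proof -
      have "integral {a..t} h = integral {a..t} (\<lambda>s. C * \<Psi> s) - integral {a..t} g"
        unfolding h_def[abs_def]
        by (intro Henstock_Kurzweil_Integration.integral_diff integrable_continuous_real continuous_on_subset[OF _ sub]
            continuous_intros cont g)
      then show ?thesis by simp
    qed
    moreover have "\<eta> * (t - a) \<le> e" using \<open>e > 0\<close> t by (simp add: \<eta>_def field_simps)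
    ultimately show "\<Psi> t + integral {a..t} g \<le> \<Psi> a + \<kappa> * (t - a) + C * integral {a..t} \<Psi> + e"
      by (simp add: algebra_simps)
  qed
  define c where "c = \<Psi> a + \<kappa> * (b - a)"
  have sub: "{a..t} \<subseteq> {a..b}" if "t \<in> {a..b}" for t using that by auto
  have le: "\<Psi> t \<le> c + C * integral {a..t} \<Psi>" if t: "t \<in> {a..b}" for t
  proof -
    have "0 \<le> integral {a..t} g"
      using t by (intro Henstock_Kurzweil_Integration.integral_nonneg integrable_continuous_real
          continuous_on_subset[OF g(1) sub[OF t]]) (auto intro: g)
    moreover have "\<kappa> * (t - a) \<le> \<kappa> * (b - a)" using t \<kappa> by (intro mult_left_mono) auto
    ultimately show ?thesis using main[OF t] by (simp add: c_def)
  qed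
  \<comment> \<open>The integrating factor of Gronwall's inequality: by \<open>le\<close> this
    product is nonincreasing on the interval.\<close>
  let ?F = "\<lambda>t. exp (- C * (t - a)) * (c + C * integral {a..t} \<Psi>)"
  have "?F b - ?F a \<le> 0 * (b - a)"
  proof (rule derivative_within_bound[OF ab])
    fix x assume x: "x \<in> {a..b}"
    show "(?F has_real_derivative exp (- C * (x - a)) * (C * (\<Psi> x - (c + C * integral {a..x} \<Psi>)))) (at x within {a..b})"
      by (rule derivative_eq_intros integral_has_real_derivative[OF cont x] refl)+ (simp add: algebra_simps)
    show "exp (- C * (x - a)) * (C * (\<Psi> x - (c + C * integral {a..x} \<Psi>))) \<le> 0"
      using le[OF x] C by (intro mult_nonneg_nonpos) auto
  qed
  then have "exp (- (C * (b - a))) * (c + C * integral {a..b} \<Psi>) \<le> c" by simp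
  then have "exp (C * (b - a)) * (exp (- (C * (b - a))) * (c + C * integral {a..b} \<Psi>)) \<le> exp (C * (b - a)) * c"
    by (intro mult_left_mono) auto
  then have "c + C * integral {a..b} \<Psi> \<le> exp (C * (b - a)) * c"
    by (simp only: mult.assoc[symmetric] mult_exp_exp) simp
  then show ?thesis using main[of b] ab by (simp add: c_def)
qed

section \<open>Curves in function spaces\<close>

abbreviation C_L2 :: "real set \<Rightarrow> 'a::euclidean_space set \<Rightarrow> (real \<Rightarrow> 'a \<Rightarrow> real) set" where
  "C_L2 I \<Omega> \<equiv> C_time I (L2_space \<Omega>) (L2_norm \<Omega>)"

abbreviation C_H2 :: "real set \<Rightarrow> 'a::euclidean_space set \<Rightarrow> (real \<Rightarrow> 'a \<Rightarrow> real) set" where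
  "C_H2 I \<Omega> \<equiv> C_time I (H10_space \<Omega> \<inter> H2_space \<Omega>) (H2_norm \<Omega>)"

abbreviation C1_L2 ::
    "real set \<Rightarrow> 'a::euclidean_space set \<Rightarrow> (real \<Rightarrow> 'a \<Rightarrow> real) \<Rightarrow> (real \<Rightarrow> 'a \<Rightarrow> real) \<Rightarrow> bool" where
  "C1_L2 I \<Omega> \<equiv> has_C1_deriv I (L2_space \<Omega>) (L2_norm \<Omega>)"

lemma C_timeD:
  assumes "w \<in> C_time I X N" "t \<in> I"
  shows "w t \<in> X" "((\<lambda>s. N (\<lambda>x. w s x - w t x)) \<longlongrightarrow> 0) (at t within I)"
  using assms by (auto simp: C_time_def)

lemma C_time_subset:
  assumes "w \<in> C_time I X N" "J \<subseteq> I"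
  shows "w \<in> C_time J X N"
  using assms tendsto_within_subset unfolding C_time_def by blast

lemma eventually_at_withinI:
  "(\<And>s. s \<in> I \<Longrightarrow> P s) \<Longrightarrow> \<forall>\<^sub>F s in at t within I. P s"
  by (auto simp: eventually_at_filter intro: always_eventually)

lemma C_time_L2_diff:
  assumes "w \<in> C_L2 I \<Omega>" "p \<in> C_L2 I \<Omega>"
  shows "(\<lambda>t x. w t x - p t x) \<in> C_L2 I \<Omega>"
  unfolding C_time_def mem_Collect_eq
proof (intro conjI ballI)
  fix t assume t: "t \<in> I"
  show "(\<lambda>x. w t x - p t x) \<in> L2_space \<Omega>" using C_timeD[OF _ t] assms by (auto intro: L2_space_diff)
  show "((\<lambda>s. L2_norm \<Omega> (\<lambda>x. w s x - p s x - (w t x - p t x))) \<longlongrightarrow> 0) (at t within I)"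
    by (rule L2_tendsto_diff)
      (use C_timeD[OF assms(1)] C_timeD[OF assms(2)] t in \<open>auto intro!: eventually_at_withinI\<close>)
qed

lemma C_time_L2_norm_continuous:
  assumes "w \<in> C_L2 I \<Omega>"
  shows "continuous_on I (\<lambda>t. L2_norm \<Omega> (w t))"
  unfolding continuous_on_def
proof
  fix t assume t: "t \<in> I"
  show "((\<lambda>t. L2_norm \<Omega> (w t)) \<longlongrightarrow> L2_norm \<Omega> (w t)) (at t within I)"
    by (rule L2_tendsto_norm) (use C_timeD[OF assms] t in \<open>auto intro!: eventually_at_withinI\<close>)
qed

text \<open>The sum \<open>V s + V t\<close> appears because a difference of squared norms is the
  inner product of the difference with the sum. V is kept independent of w so that V = w - p can be
  inserted when only w is differentiable.\<close>

lemma L2_difference_quotient_ip: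
  assumes q: "((\<lambda>s. L2_norm \<Omega> (\<lambda>x. (w s x - w t x) / (s - t) - w' x)) \<longlongrightarrow> 0) (at t within I)"
    and V: "((\<lambda>s. L2_norm \<Omega> (\<lambda>x. V s x - V t x)) \<longlongrightarrow> 0) (at t within I)"
    and L: "\<And>s. s \<in> I \<Longrightarrow> w s \<in> L2_space \<Omega>" "\<And>s. s \<in> I \<Longrightarrow> V s \<in> L2_space \<Omega>" "w' \<in> L2_space \<Omega>" "t \<in> I"
  shows "((\<lambda>s. L2_ip \<Omega> (\<lambda>x. w s x - w t x) (\<lambda>x. V s x + V t x) / (s - t)) \<longlongrightarrow> 2 * L2_ip \<Omega> w' (V t)) (at t within I)"
proof -
  have "((\<lambda>s. L2_ip \<Omega> (\<lambda>x. (w s x - w t x) / (s - t)) (\<lambda>x. V s x + V t x)) \<longlongrightarrow> L2_ip \<Omega> w' (\<lambda>x. V t x + V t x)) (at t within I)"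
  proof (rule L2_tendsto_ip[OF q])
    show "((\<lambda>s. L2_norm \<Omega> (\<lambda>x. V s x + V t x - (V t x + V t x))) \<longlongrightarrow> 0) (at t within I)"
      using V by (simp add: algebra_simps)
  qed (use L in \<open>auto intro!: eventually_at_withinI L2_space_divide L2_space_diff L2_space_add L2_space_scale\<close>)
  moreover have "L2_ip \<Omega> w' (\<lambda>x. V t x + V t x) = 2 * L2_ip \<Omega> w' (V t)"
    by (subst L2_ip_add_right) (use L in auto)
  ultimately show ?thesis by (simp only: L2_ip_divide_left)
qed

lemma L2_norm_sq_difference:
  assumes "f \<in> L2_space \<Omega>" "g \<in> L2_space \<Omega>"
  shows "(L2_norm \<Omega> f)\<^sup>2 - (L2_norm \<Omega> g)\<^sup>2 = L2_ip \<Omega> (\<lambda>x. f x - g x) (\<lambda>x. f x + g x)"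
  using assms L2_space_add[OF assms]
  by (simp add: L2_ip_diff_left L2_ip_add_right L2_ip_self[symmetric] L2_ip_commute[of \<Omega> g f])

lemma L2_norm_sq_derivative:
  assumes "C1_L2 I \<Omega> w w'" "t \<in> I"
  shows "((\<lambda>s. (L2_norm \<Omega> (w s))\<^sup>2) has_real_derivative 2 * L2_ip \<Omega> (w' t) (w t)) (at t within I)"
proof -
  have w: "w \<in> C_L2 I \<Omega>" "w' \<in> C_L2 I \<Omega>"
    "((\<lambda>s. L2_norm \<Omega> (\<lambda>x. (w s x - w t x) / (s - t) - w' t x)) \<longlongrightarrow> 0) (at t within I)"
    using assms by (auto simp: has_C1_deriv_def)
  have "((\<lambda>s. L2_ip \<Omega> (\<lambda>x. w s x - w t x) (\<lambda>x. w s x + w t x) / (s - t)) \<longlongrightarrow> 2 * L2_ip \<Omega> (w' t) (w t)) (at t within I)"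
    by (rule L2_difference_quotient_ip[OF w(3) C_timeD(2)[OF w(1) assms(2)]])
      (use C_timeD[OF w(1)] C_timeD[OF w(2)] assms(2) in auto)
  then have "((\<lambda>s. ((L2_norm \<Omega> (w s))\<^sup>2 - (L2_norm \<Omega> (w t))\<^sup>2) / (s - t)) \<longlongrightarrow> 2 * L2_ip \<Omega> (w' t) (w t)) (at t within I)"
    by (rule Lim_transform_eventually)
      (auto intro!: eventually_at_withinI simp: L2_norm_sq_difference C_timeD[OF w(1)] assms(2))
  then show ?thesis by (simp add: has_field_derivative_iff)
qed

lemma has_C1_deriv_L2_diff:
  assumes "C1_L2 I \<Omega> w w'" "C1_L2 I \<Omega> p p'"
  shows "C1_L2 I \<Omega> (\<lambda>t x. w t x - p t x) (\<lambda>t x. w' t x - p' t x)"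
  unfolding has_C1_deriv_def
proof (intro conjI ballI)
  have w: "w \<in> C_L2 I \<Omega>" "w' \<in> C_L2 I \<Omega>"
    and p: "p \<in> C_L2 I \<Omega>" "p' \<in> C_L2 I \<Omega>"
    using assms by (auto simp: has_C1_deriv_def)
  show "(\<lambda>t x. w t x - p t x) \<in> C_L2 I \<Omega>"
    "(\<lambda>t x. w' t x - p' t x) \<in> C_L2 I \<Omega>"
    by (intro C_time_L2_diff w p)+
  fix t assume t: "t \<in> I"
  have "((\<lambda>s. L2_norm \<Omega> (\<lambda>x. ((w s x - w t x) / (s - t) - (p s x - p t x) / (s - t)) - (w' t x - p' t x))) \<longlongrightarrow> 0) (at t within I)"
    by (rule L2_tendsto_diff)
      (use assms t C_timeD[OF w(1)] C_timeD[OF w(2)] C_timeD[OF p(1)] C_timeD[OF p(2)] in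
        \<open>auto simp: has_C1_deriv_def intro!: eventually_at_withinI L2_space_divide L2_space_diff\<close>)
  moreover have "((w s x - p s x) - (w t x - p t x)) / (s - t) - (w' t x - p' t x)
      = ((w s x - w t x) / (s - t) - (p s x - p t x) / (s - t)) - (w' t x - p' t x)" for s x
    by (simp add: diff_divide_distrib)
  ultimately show "((\<lambda>s. L2_norm \<Omega> (\<lambda>x. ((w s x - p s x) - (w t x - p t x)) / (s - t) - (w' t x - p' t x))) \<longlongrightarrow> 0) (at t within I)"
    by simp
qed

text \<open>A substitute for the derivative of the squared norm of w - p when p is merely Lipschitz.
  In the inner product of increment and sum, the increment of w yields the slope up to a tolerance
  1, while the increment of p is at most \<Lambda> \<bar>s - t\<bar> and meets a sum of norm at most
  2 K.\<close>

lemma L2_norm_sq_dini: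
  assumes w: "C1_L2 I \<Omega> w w'" and t: "t \<in> I"
    and p: "\<And>s. s \<in> I \<Longrightarrow> p s \<in> L2_space \<Omega>"
    and lip: "\<forall>\<^sub>F s in at t within I. L2_norm \<Omega> (\<lambda>x. p s x - p t x) \<le> \<Lambda> * \<bar>s - t\<bar>"
    and K: "\<And>s. s \<in> I \<Longrightarrow> L2_norm \<Omega> (\<lambda>x. w s x - p s x) \<le> K"
  shows "\<forall>\<^sub>F s in at t within I. \<bar>(L2_norm \<Omega> (\<lambda>x. w s x - p s x))\<^sup>2 - (L2_norm \<Omega> (\<lambda>x. w t x - p t x))\<^sup>2
      - 2 * L2_ip \<Omega> (w' t) (\<lambda>x. w t x - p t x) * (s - t)\<bar> \<le> (2 * K * \<Lambda> + 1) * \<bar>s - t\<bar>"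
proof -
  let ?V = "\<lambda>s x. w s x - p s x" and ?d = "2 * L2_ip \<Omega> (w' t) (\<lambda>x. w t x - p t x)"
  have wc: "w \<in> C_L2 I \<Omega>" "w' \<in> C_L2 I \<Omega>"
    "((\<lambda>s. L2_norm \<Omega> (\<lambda>x. (w s x - w t x) / (s - t) - w' t x)) \<longlongrightarrow> 0) (at t within I)"
    using w t by (auto simp: has_C1_deriv_def)
  note wL = C_timeD(1)[OF wc(1)] C_timeD(1)[OF wc(2)]
  have VL: "?V s \<in> L2_space \<Omega>" if "s \<in> I" for s using wL p that by (auto intro: L2_space_diff)
  have "((\<lambda>s. \<Lambda> * \<bar>s - t\<bar>) \<longlongrightarrow> \<Lambda> * \<bar>t - t\<bar>) (at t within I)" by (intro tendsto_intros)
  then have pc: "((\<lambda>s. L2_norm \<Omega> (\<lambda>x. p s x - p t x)) \<longlongrightarrow> 0) (at t within I)"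
    using lip by (intro Lim_null_comparison[of "\<lambda>s. L2_norm \<Omega> (\<lambda>x. p s x - p t x)" "\<lambda>s. \<Lambda> * \<bar>s - t\<bar>"]) auto
  have "((\<lambda>s. L2_norm \<Omega> (\<lambda>x. ?V s x - ?V t x)) \<longlongrightarrow> 0) (at t within I)"
    by (rule L2_tendsto_diff[OF C_timeD(2)[OF wc(1) t] pc]) (use wL p t in \<open>auto intro!: eventually_at_withinI\<close>)
  then have "((\<lambda>s. L2_ip \<Omega> (\<lambda>x. w s x - w t x) (\<lambda>x. ?V s x + ?V t x) / (s - t)) \<longlongrightarrow> ?d) (at t within I)"
    using wL VL t by (intro L2_difference_quotient_ip[where V="?V", OF wc(3)]) auto
  then have "\<forall>\<^sub>F s in at t within I. \<bar>L2_ip \<Omega> (\<lambda>x. w s x - w t x) (\<lambda>x. ?V s x + ?V t x) / (s - t) - ?d\<bar> < 1"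
    by (auto dest!: tendstoD[of _ _ _ 1] simp: dist_real_def)
  moreover have "\<forall>\<^sub>F s in at t within I. s \<in> I \<and> s \<noteq> t" by (auto simp: eventually_at_filter)
  ultimately show ?thesis
    using lip
  proof eventually_elim
    case (elim s)
    let ?A = "L2_ip \<Omega> (\<lambda>x. w s x - w t x) (\<lambda>x. ?V s x + ?V t x)"
      and ?B = "L2_ip \<Omega> (\<lambda>x. p s x - p t x) (\<lambda>x. ?V s x + ?V t x)"
    have s: "s \<in> I" "s \<noteq> t" using elim by auto
    have "(L2_norm \<Omega> (?V s))\<^sup>2 - (L2_norm \<Omega> (?V t))\<^sup>2 = L2_ip \<Omega> (\<lambda>x. ?V s x - ?V t x) (\<lambda>x. ?V s x + ?V t x)"
      by (rule L2_norm_sq_difference[OF VL[OF s(1)] VL[OF t]])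
    also have "(\<lambda>x. ?V s x - ?V t x) = (\<lambda>x. (w s x - w t x) - (p s x - p t x))" by auto
    also have "L2_ip \<Omega> \<dots> (\<lambda>x. ?V s x + ?V t x) = ?A - ?B"
      using wL p s t VL by (intro L2_ip_diff_left L2_space_diff L2_space_add) auto
    finally have eq: "(L2_norm \<Omega> (?V s))\<^sup>2 - (L2_norm \<Omega> (?V t))\<^sup>2 = ?A - ?B" .
    have "?A - ?d * (s - t) = (?A / (s - t) - ?d) * (s - t)"
      using s by (simp only: left_diff_distrib) simp
    then have "\<bar>?A - ?d * (s - t)\<bar> = \<bar>?A / (s - t) - ?d\<bar> * \<bar>s - t\<bar>"
      by (simp only: abs_mult)
    also have "\<dots> \<le> 1 * \<bar>s - t\<bar>" using elim(1) by (intro mult_right_mono) auto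
    finally have A: "\<bar>?A - ?d * (s - t)\<bar> \<le> \<bar>s - t\<bar>" by simp
    have "\<bar>?B\<bar> \<le> L2_norm \<Omega> (\<lambda>x. p s x - p t x) * L2_norm \<Omega> (\<lambda>x. ?V s x + ?V t x)"
      using wL p s t by (intro L2_Cauchy_Schwarz L2_space_diff L2_space_add) auto
    also have "\<dots> \<le> (\<Lambda> * \<bar>s - t\<bar>) * (2 * K)"
    proof (rule mult_mono[OF elim(3)])
      show "L2_norm \<Omega> (\<lambda>x. ?V s x + ?V t x) \<le> 2 * K"
        using L2_norm_triangle[OF VL[OF s(1)] VL[OF t]] K[OF s(1)] K[OF t] by simp
      show "0 \<le> \<Lambda> * \<bar>s - t\<bar>" using elim(3) L2_norm_nonneg order_trans by blast
    qed simp
    finally show ?case using A unfolding eq by (simp add: algebra_simps)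
  qed
qed

lemma H2_norm_ge:
  assumes "b \<in> Basis"
  shows "L2_norm \<Omega> f \<le> H2_norm \<Omega> f" "L2_norm \<Omega> (weak_deriv \<Omega> b f) \<le> H2_norm \<Omega> f"
proof -
  have "(L2_norm \<Omega> f)\<^sup>2 \<le> (L2_norm \<Omega> f)\<^sup>2 + (\<Sum>b\<in>Basis. (H1_norm \<Omega> (weak_deriv \<Omega> b f))\<^sup>2)"
    by (simp add: sum_nonneg)
  then show "L2_norm \<Omega> f \<le> H2_norm \<Omega> f" unfolding H2_norm_def by (rule real_le_rsqrt)
  have "(L2_norm \<Omega> (weak_deriv \<Omega> b f))\<^sup>2 \<le> (H1_norm \<Omega> (weak_deriv \<Omega> b f))\<^sup>2"
    by (simp add: H1_norm_sq)
  also have "\<dots> \<le> (\<Sum>b\<in>Basis. (H1_norm \<Omega> (weak_deriv \<Omega> b f))\<^sup>2)"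
    by (rule member_le_sum[OF assms]) auto
  finally show "L2_norm \<Omega> (weak_deriv \<Omega> b f) \<le> H2_norm \<Omega> f"
    unfolding H2_norm_def by (intro real_le_rsqrt) (simp add: add_increasing)
qed

lemma C_time_H2_L2:
  assumes "w \<in> C_H2 I \<Omega>"
  shows "w \<in> C_L2 I \<Omega>"
  unfolding C_time_def mem_Collect_eq
proof (intro conjI ballI)
  fix t assume t: "t \<in> I"
  show "w t \<in> L2_space \<Omega>" using C_timeD(1)[OF assms t] by (auto intro: H1_L2 H10_H1)
  show "((\<lambda>s. L2_norm \<Omega> (\<lambda>x. w s x - w t x)) \<longlongrightarrow> 0) (at t within I)"
    by (rule Lim_null_comparison[OF _ C_timeD(2)[OF assms t]]) (auto intro: always_eventually H2_norm_ge SOME_Basis)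
qed

lemma C_time_H2_weak_deriv:
  assumes "open \<Omega>" "w \<in> C_H2 I \<Omega>" "b \<in> Basis"
  shows "(\<lambda>t. weak_deriv \<Omega> b (w t)) \<in> C_L2 I \<Omega>"
  unfolding C_time_def mem_Collect_eq
proof (intro conjI ballI)
  fix t assume t: "t \<in> I"
  have H1: "w s \<in> H1_space \<Omega>" if "s \<in> I" for s using C_timeD(1)[OF assms(2) that] by (auto intro: H10_H1)
  show "weak_deriv \<Omega> b (w t) \<in> L2_space \<Omega>" using H1[OF t] assms(3) by (rule weak_deriv_L2)
  show "((\<lambda>s. L2_norm \<Omega> (\<lambda>x. weak_deriv \<Omega> b (w s) x - weak_deriv \<Omega> b (w t) x)) \<longlongrightarrow> 0) (at t within I)"
  proof (rule Lim_null_comparison[OF _ C_timeD(2)[OF assms(2) t]], rule eventually_at_withinI)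
    fix s assume "s \<in> I"
    then show "norm (L2_norm \<Omega> (\<lambda>x. weak_deriv \<Omega> b (w s) x - weak_deriv \<Omega> b (w t) x)) \<le> H2_norm \<Omega> (\<lambda>x. w s x - w t x)"
      using H2_norm_ge(2)[OF assms(3), of \<Omega> "\<lambda>x. w s x - w t x"] L2_norm_weak_deriv_diff[OF assms(1) H1 H1 assms(3)] t by simp
  qed
qed

text \<open>Weak derivatives are additive only almost everywhere. Continuity is therefore proved for
  the differences of the derivative curves and carried over through equality of the norms.\<close>

lemma C_time_H2_grad_diff_continuous:
  assumes "open \<Omega>" "w \<in> C_H2 I \<Omega>"
    "p \<in> C_H2 I \<Omega>"
  shows "continuous_on I (\<lambda>t. grad_sq \<Omega> (\<lambda>x. w t x - p t x))"
proof -
  have H1: "w s \<in> H1_space \<Omega>" "p s \<in> H1_space \<Omega>" if "s \<in> I" for s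
    using C_timeD(1)[OF assms(2) that] C_timeD(1)[OF assms(3) that] by (auto intro: H10_H1)
  have "continuous_on I (\<lambda>t. \<Sum>b\<in>Basis. (L2_norm \<Omega> (\<lambda>x. weak_deriv \<Omega> b (w t) x - weak_deriv \<Omega> b (p t) x))\<^sup>2)"
    by (intro continuous_on_sum continuous_on_power C_time_L2_norm_continuous C_time_L2_diff
        C_time_H2_weak_deriv assms)
  moreover have "grad_sq \<Omega> (\<lambda>x. w t x - p t x) = (\<Sum>b\<in>Basis. (L2_norm \<Omega> (\<lambda>x. weak_deriv \<Omega> b (w t) x - weak_deriv \<Omega> b (p t) x))\<^sup>2)"
    if "t \<in> I" for t
    unfolding grad_sq_def by (intro sum.cong refl arg_cong[where f="\<lambda>r. r\<^sup>2"] L2_norm_weak_deriv_diff assms H1 that)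
  ultimately show ?thesis by (simp cong: continuous_on_cong)
qed

lemma C_time_H2_grad_continuous:
  assumes "w \<in> C_H2 I \<Omega>" "open \<Omega>"
  shows "continuous_on I (\<lambda>t. grad_sq \<Omega> (w t))"
  unfolding grad_sq_def
  by (intro continuous_on_sum continuous_on_power C_time_L2_norm_continuous C_time_H2_weak_deriv assms)

section \<open>Estimates at a fixed time\<close>

lemma L2_space_abs: "f \<in> L2_space S \<Longrightarrow> (\<lambda>x. \<bar>f x\<bar>) \<in> L2_space S"
  using borel_measurable_abs by (auto simp: L2_space_def)

lemma L2_norm_abs [simp]: "L2_norm S (\<lambda>x. \<bar>f x\<bar>) = L2_norm S f"
  by (simp add: L2_norm_def)

lemma weighted_AM_GM:
  fixes a b c :: real
  assumes "c > 0"
  shows "a * b \<le> a\<^sup>2 / (4 * c) + c * b\<^sup>2"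
proof -
  have "0 \<le> (a / (2 * c) - b)\<^sup>2 * c" using assms by simp
  also have "\<dots> = a\<^sup>2 / (4 * c) + c * b\<^sup>2 - a * b"
    using assms by (simp add: power2_eq_square field_simps)
  finally show ?thesis by simp
qed

text \<open>Green's identity is applied to f and g separately with the common test function f - g;
  this avoids additivity of the weak Laplacian, whose second derivatives are again arbitrary
  choices.\<close>

lemma green_identity_diff:
  assumes \<Omega>: "open \<Omega>" and f: "f \<in> H10_space \<Omega> \<inter> H2_space \<Omega>" and g: "g \<in> H10_space \<Omega> \<inter> H2_space \<Omega>"
  shows "L2_ip \<Omega> (\<lambda>x. weak_laplacian \<Omega> f x - weak_laplacian \<Omega> g x) (\<lambda>x. f x - g x)
    = - grad_sq \<Omega> (\<lambda>x. f x - g x)"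
proof -
  let ?h = "\<lambda>x. f x - g x"
  have h: "?h \<in> H10_space \<Omega>" using f g by (auto intro: H10_diff[OF \<Omega>])
  have H1: "f \<in> H1_space \<Omega>" "g \<in> H1_space \<Omega>" "?h \<in> H1_space \<Omega>" using f g h by (auto intro: H10_H1)
  have "L2_ip \<Omega> (weak_deriv \<Omega> b f) (weak_deriv \<Omega> b ?h) - L2_ip \<Omega> (weak_deriv \<Omega> b g) (weak_deriv \<Omega> b ?h)
      = (L2_norm \<Omega> (weak_deriv \<Omega> b ?h))\<^sup>2" if b: "b \<in> Basis" for b
  proof -
    have "L2_ip \<Omega> (weak_deriv \<Omega> b f) (weak_deriv \<Omega> b ?h) - L2_ip \<Omega> (weak_deriv \<Omega> b g) (weak_deriv \<Omega> b ?h)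
        = L2_ip \<Omega> (\<lambda>x. weak_deriv \<Omega> b f x - weak_deriv \<Omega> b g x) (weak_deriv \<Omega> b ?h)"
      by (intro L2_ip_diff_left[symmetric] weak_deriv_L2 H1 b)
    also have "\<dots> = L2_ip \<Omega> (weak_deriv \<Omega> b ?h) (weak_deriv \<Omega> b ?h)"
      using weak_deriv_diff[OF \<Omega> H1(1,2) b]
      by (intro L2_ip_cong_AE L2_space_diff weak_deriv_L2 H1 b) auto
    finally show ?thesis by (simp add: L2_ip_self)
  qed
  then have "grad_sq \<Omega> ?h = (\<Sum>b\<in>Basis. L2_ip \<Omega> (weak_deriv \<Omega> b f) (weak_deriv \<Omega> b ?h))
      - (\<Sum>b\<in>Basis. L2_ip \<Omega> (weak_deriv \<Omega> b g) (weak_deriv \<Omega> b ?h))"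
    by (simp add: grad_sq_def sum_subtractf[symmetric])
  then show ?thesis
    using f g by (simp add: L2_ip_diff_left weak_laplacian_L2 H1_L2[OF H1(3)] green_identity[OF \<Omega> h])
qed

locale reaction_diffusion =
  fixes \<Omega> :: "'a::euclidean_space set" and \<alpha> :: "real \<Rightarrow> real" and \<mu> \<epsilon> M L R :: real
  assumes open_domain: "open \<Omega>" and bounded_domain: "\<Omega> \<subseteq> cball 0 R" and R_pos: "R > 0"
    and \<alpha>_mono: "mono \<alpha>" and \<alpha>_zero: "\<alpha> 0 = 0" and \<alpha>_lipschitz: "L-lipschitz_on {-M..M} \<alpha>"
    and M_pos: "M > 0" and L_pos: "L > 0" and \<mu>_pos: "\<mu> > 0" and \<epsilon>_pos: "\<epsilon> > 0" and L_\<mu>: "L * \<mu> < 1"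
begin

text \<open>The bound on \<mu> u + v is part of the notion because \<alpha> is known to be Lipschitz
  with constant L only on [-M, M].\<close>

definition admissible :: "('a \<Rightarrow> real) \<Rightarrow> ('a \<Rightarrow> real) \<Rightarrow> bool" where
  "admissible u v \<longleftrightarrow> u \<in> H10_space \<Omega> \<inter> H2_space \<Omega> \<and> v \<in> H10_space \<Omega> \<inter> H2_space \<Omega> \<and>
     (AE x in lebesgue_on \<Omega>. \<bar>\<mu> * u x + v x\<bar> \<le> M)"

definition reaction :: "('a \<Rightarrow> real) \<Rightarrow> ('a \<Rightarrow> real) \<Rightarrow> 'a \<Rightarrow> real" where
  "reaction u v x = u x - \<alpha> (\<mu> * u x + v x)"

definition vol :: real where "vol = measure lebesgue \<Omega>"

definition poincare_const :: real where "poincare_const = 4 * R\<^sup>2"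

text \<open>The first summand comes from Young's inequality for the product of U and V, weighted so
  that V costs half of the gradient; the second is \<mu> / \<epsilon> times the factor \<mu> / 4
  left over from \<alpha>. See \<open>V_estimate\<close>.\<close>

definition V_const :: real where
  "V_const = poincare_const * \<mu>\<^sup>2 / (2 * \<epsilon>\<^sup>2) + \<mu>\<^sup>2 / (4 * \<epsilon>)"

text \<open>Young's inequality is weighted so that V costs a quarter of the gradient. Since
  \<open>V_estimate\<close> provides half of it, a quarter survives in the sum.\<close>

definition U_const :: real where "U_const = 4 * poincare_const / \<epsilon>\<^sup>2"

lemma domain_lmeasurable: "\<Omega> \<in> lmeasurable"
  using open_domain bounded_domain bounded_subset[OF bounded_cball] by (intro lmeasurable_open) blast

lemma vol_nonneg: "vol \<ge> 0" by (simp add: vol_def)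

lemma poincare_const_pos: "poincare_const > 0"
  using R_pos by (simp add: poincare_const_def)

lemma poincare: "f \<in> H10_space \<Omega> \<Longrightarrow> (L2_norm \<Omega> f)\<^sup>2 \<le> poincare_const * grad_sq \<Omega> f"
  unfolding poincare_const_def
  using poincare_inequality[OF open_domain bounded_domain] R_pos by simp

text \<open>The first inequality is the cocoercivity of a monotone Lipschitz function. It gains the
  full square of the difference of the values, which \<open>V_estimate\<close> spends on a term of
  unknown sign.\<close>

lemma \<alpha>_difference:
  assumes "\<bar>x\<bar> \<le> M" "\<bar>y\<bar> \<le> M"
  shows "(\<alpha> x - \<alpha> y)\<^sup>2 \<le> L * ((\<alpha> x - \<alpha> y) * (x - y))" "\<bar>\<alpha> x - \<alpha> y\<bar> \<le> L * \<bar>x - y\<bar>"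
proof -
  show l: "\<bar>\<alpha> x - \<alpha> y\<bar> \<le> L * \<bar>x - y\<bar>"
    using lipschitz_onD[OF \<alpha>_lipschitz, of x y] assms by (auto simp: dist_real_def abs_le_iff)
  have "(\<alpha> x - \<alpha> y) * (x - y) \<ge> 0"
    using monoD[OF \<alpha>_mono, of x y] monoD[OF \<alpha>_mono, of y x] by (cases "x \<le> y") (auto simp: mult_nonpos_nonpos)
  then have "\<bar>\<alpha> x - \<alpha> y\<bar> * \<bar>x - y\<bar> = (\<alpha> x - \<alpha> y) * (x - y)" by (simp add: abs_mult[symmetric])
  moreover have "\<bar>\<alpha> x - \<alpha> y\<bar> * \<bar>\<alpha> x - \<alpha> y\<bar> \<le> \<bar>\<alpha> x - \<alpha> y\<bar> * (L * \<bar>x - y\<bar>)"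
    by (intro mult_left_mono l) simp
  moreover have "\<bar>\<alpha> x - \<alpha> y\<bar> * (L * \<bar>x - y\<bar>) = L * (\<bar>\<alpha> x - \<alpha> y\<bar> * \<bar>x - y\<bar>)" by simp
  ultimately show "(\<alpha> x - \<alpha> y)\<^sup>2 \<le> L * ((\<alpha> x - \<alpha> y) * (x - y))"
    by (simp add: power2_eq_square)
qed

lemma \<alpha>_bounded:
  assumes "\<bar>z\<bar> \<le> M"
  shows "\<bar>\<alpha> z\<bar> \<le> L * M"
proof -
  have "\<bar>\<alpha> z\<bar> \<le> L * \<bar>z\<bar>" using \<alpha>_difference(2)[of z 0] assms M_pos \<alpha>_zero by simp
  also have "\<dots> \<le> L * M" using assms L_pos by (intro mult_left_mono) auto
  finally show ?thesis .
qed

lemma \<alpha>_L2: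
  assumes "z \<in> borel_measurable (lebesgue_on \<Omega>)" "AE x in lebesgue_on \<Omega>. \<bar>z x\<bar> \<le> M"
  shows "(\<lambda>x. \<alpha> (z x)) \<in> L2_space \<Omega>" "(L2_norm \<Omega> (\<lambda>x. \<alpha> (z x)))\<^sup>2 \<le> (L * M)\<^sup>2 * vol"
proof -
  have m: "(\<lambda>x. \<alpha> (z x)) \<in> borel_measurable (lebesgue_on \<Omega>)"
    using measurable_compose[OF assms(1) borel_measurable_mono[OF \<alpha>_mono]] .
  have b: "AE x in lebesgue_on \<Omega>. \<bar>\<alpha> (z x)\<bar> \<le> L * M"
    using assms(2) by eventually_elim (rule \<alpha>_bounded)
  show "(\<lambda>x. \<alpha> (z x)) \<in> L2_space \<Omega>" "(L2_norm \<Omega> (\<lambda>x. \<alpha> (z x)))\<^sup>2 \<le> (L * M)\<^sup>2 * vol"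
    unfolding vol_def by (rule L2_space_AE_bounded[OF domain_lmeasurable m b])+
qed

lemma admissible_L2:
  assumes "admissible u v"
  shows "u \<in> L2_space \<Omega>" "v \<in> L2_space \<Omega>" "(\<lambda>x. \<alpha> (\<mu> * u x + v x)) \<in> L2_space \<Omega>"
    "reaction u v \<in> L2_space \<Omega>" "weak_laplacian \<Omega> u \<in> L2_space \<Omega>" "weak_laplacian \<Omega> v \<in> L2_space \<Omega>"
proof -
  show uv: "u \<in> L2_space \<Omega>" "v \<in> L2_space \<Omega>" using assms by (auto simp: admissible_def intro: H1_L2 H10_H1)
  have "(\<lambda>x. \<mu> * u x + v x) \<in> L2_space \<Omega>" by (intro L2_space_add L2_space_scale uv)
  then show a: "(\<lambda>x. \<alpha> (\<mu> * u x + v x)) \<in> L2_space \<Omega>"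
    using assms by (intro \<alpha>_L2(1) L2_space_measurable) (auto simp: admissible_def)
  show "reaction u v \<in> L2_space \<Omega>" unfolding reaction_def[abs_def] by (intro L2_space_diff uv a)
  show "weak_laplacian \<Omega> u \<in> L2_space \<Omega>" "weak_laplacian \<Omega> v \<in> L2_space \<Omega>"
    using assms by (auto simp: admissible_def intro: weak_laplacian_L2)
qed

lemma admissible_\<alpha>_norm:
  assumes "admissible u v"
  shows "L2_norm \<Omega> (\<lambda>x. \<alpha> (\<mu> * u x + v x)) \<le> L * M * sqrt vol"
proof (rule power2_le_imp_le)
  have "(\<lambda>x. \<mu> * u x + v x) \<in> L2_space \<Omega>" by (intro L2_space_add L2_space_scale admissible_L2[OF assms])
  from \<alpha>_L2(2)[OF L2_space_measurable[OF this]] show "(L2_norm \<Omega> (\<lambda>x. \<alpha> (\<mu> * u x + v x)))\<^sup>2 \<le> (L * M * sqrt vol)\<^sup>2"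
    using assms vol_nonneg by (simp add: admissible_def power_mult_distrib)
qed (use L_pos M_pos vol_nonneg in simp)

text \<open>Writing v = z - \<mu> u with \<bar>z\<bar> \<le> M controls v without its equation, and
  hence independently of \<xi>.\<close>

lemma admissible_v_norm:
  assumes "admissible u v"
  shows "L2_norm \<Omega> v \<le> M * sqrt vol + \<mu> * L2_norm \<Omega> u"
proof -
  let ?z = "\<lambda>x. \<mu> * u x + v x"
  have z: "?z \<in> L2_space \<Omega>" by (intro L2_space_add L2_space_scale admissible_L2[OF assms])
  have "(L2_norm \<Omega> ?z)\<^sup>2 \<le> M\<^sup>2 * vol"
    using assms L2_space_AE_bounded(2)[OF domain_lmeasurable L2_space_measurable[OF z]]
    by (simp add: admissible_def vol_def)
  then have "L2_norm \<Omega> ?z \<le> M * sqrt vol"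
    using M_pos vol_nonneg by - (rule power2_le_imp_le, simp_all add: power_mult_distrib)
  moreover have "L2_norm \<Omega> (\<lambda>x. ?z x - \<mu> * u x) \<le> L2_norm \<Omega> ?z + L2_norm \<Omega> (\<lambda>x. \<mu> * u x)"
    by (intro L2_norm_triangle_diff z L2_space_scale admissible_L2[OF assms])
  ultimately show ?thesis using \<mu>_pos by (simp add: L2_norm_scale)
qed

section \<open>Energy estimates for one solution\<close>

text \<open>Diffusion has the good sign, and pointwise \<alpha>(z) u - u^2 \<le> \<alpha>(z)^2 / 4.
  The resulting constant contains neither \<xi> nor any norm of v.\<close>

lemma u_estimate:
  assumes ad: "admissible u v" and u': "u' \<in> L2_space \<Omega>"
    and eq: "AE x in lebesgue_on \<Omega>. 1 / \<mu> * u' x = weak_laplacian \<Omega> u x - 1 / \<epsilon> * reaction u v x"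
  shows "2 * L2_ip \<Omega> u' u \<le> \<mu> / (2 * \<epsilon>) * (L * M)\<^sup>2 * vol"
proof -
  interpret finite_measure "lebesgue_on \<Omega>" by (rule finite_measure_lebesgue_on[OF domain_lmeasurable])
  note l2 = admissible_L2[OF ad]
  have "1 / \<mu> * L2_ip \<Omega> u' u = L2_ip \<Omega> (\<lambda>x. 1 / \<mu> * u' x) u" by (simp only: L2_ip_scale_left)
  also have "\<dots> = L2_ip \<Omega> (\<lambda>x. weak_laplacian \<Omega> u x - 1 / \<epsilon> * reaction u v x) u"
    by (intro L2_ip_cong_AE eq AE_I2 refl L2_space_scale L2_space_diff l2 u')
  also have "\<dots> = L2_ip \<Omega> (weak_laplacian \<Omega> u) u - 1 / \<epsilon> * L2_ip \<Omega> (reaction u v) u"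
    by (simp only: L2_ip_diff_left[OF l2(5) L2_space_scale[OF l2(4)] l2(1)] L2_ip_scale_left)
  also have "L2_ip \<Omega> (weak_laplacian \<Omega> u) u = - grad_sq \<Omega> u"
    using ad by (auto simp: admissible_def green_identity[OF open_domain] grad_sq_def L2_ip_self)
  finally have e: "1 / \<mu> * L2_ip \<Omega> u' u \<le> - (1 / \<epsilon> * L2_ip \<Omega> (reaction u v) u)" by simp
  have "- L2_ip \<Omega> (reaction u v) u \<le> (L * M)\<^sup>2 / 4 * vol"
  proof -
    have "- L2_ip \<Omega> (reaction u v) u = integral\<^sup>L (lebesgue_on \<Omega>) (\<lambda>x. - (reaction u v x * u x))"
      by (simp add: L2_ip_def)
    also have "\<dots> \<le> integral\<^sup>L (lebesgue_on \<Omega>) (\<lambda>x. (L * M)\<^sup>2 / 4)"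
    proof (rule integral_mono_AE)
      show "integrable (lebesgue_on \<Omega>) (\<lambda>x. - (reaction u v x * u x))"
        using L2_space_integrable_mult[OF l2(4,1)] by simp
      have "AE x in lebesgue_on \<Omega>. \<bar>\<mu> * u x + v x\<bar> \<le> M" using ad by (simp add: admissible_def)
      then show "AE x in lebesgue_on \<Omega>. - (reaction u v x * u x) \<le> (L * M)\<^sup>2 / 4"
      proof eventually_elim
        case (elim x)
        let ?a = "\<alpha> (\<mu> * u x + v x)"
        have "?a * u x \<le> ?a\<^sup>2 / 4 + (u x)\<^sup>2" using weighted_AM_GM[of 1 ?a "u x"] by simp
        moreover have "?a\<^sup>2 \<le> (L * M)\<^sup>2"
          using \<alpha>_bounded[OF elim] L_pos M_pos by (simp add: abs_le_square_iff[symmetric])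
        ultimately show ?case by (simp add: reaction_def power2_eq_square algebra_simps)
      qed
    qed simp
    also have "\<dots> = (L * M)\<^sup>2 / 4 * vol"
      using domain_lmeasurable by (simp add: vol_def measure_restrict_space space_restrict_space fmeasurableD)
    finally show ?thesis .
  qed
  then have "1 / \<epsilon> * (- L2_ip \<Omega> (reaction u v) u) \<le> 1 / \<epsilon> * ((L * M)\<^sup>2 / 4 * vol)"
    using \<epsilon>_pos by (intro mult_left_mono) auto
  with e have "1 / \<mu> * L2_ip \<Omega> u' u \<le> 1 / \<epsilon> * ((L * M)\<^sup>2 / 4 * vol)" by simp
  then have "2 * \<mu> * (1 / \<mu> * L2_ip \<Omega> u' u) \<le> 2 * \<mu> * (1 / \<epsilon> * ((L * M)\<^sup>2 / 4 * vol))"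
    using \<mu>_pos by (intro mult_left_mono) auto
  then show ?thesis using \<mu>_pos by (simp add: mult_ac)
qed

text \<open>\<open>G\<close> stands for \<xi> times the time derivative of v, so that the parabolic
  and the elliptic equation are covered together.\<close>

lemma v_estimate:
  assumes ad: "admissible u v" and G: "G \<in> L2_space \<Omega>"
    and eq: "AE x in lebesgue_on \<Omega>. G x = weak_laplacian \<Omega> v x + \<mu> / \<epsilon> * reaction u v x"
  shows "L2_ip \<Omega> G v + grad_sq \<Omega> v \<le> \<mu> / \<epsilon> * ((L2_norm \<Omega> u + L * M * sqrt vol) * L2_norm \<Omega> v)"
proof -
  note l2 = admissible_L2[OF ad]
  have "L2_ip \<Omega> G v = L2_ip \<Omega> (\<lambda>x. weak_laplacian \<Omega> v x + \<mu> / \<epsilon> * reaction u v x) v"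
    by (intro L2_ip_cong_AE eq AE_I2 refl L2_space_scale L2_space_add l2 G)
  also have "\<dots> = L2_ip \<Omega> (weak_laplacian \<Omega> v) v + \<mu> / \<epsilon> * L2_ip \<Omega> (reaction u v) v"
    by (simp only: L2_ip_add_left[OF l2(6) L2_space_scale[OF l2(4)] l2(2)] L2_ip_scale_left)
  also have "L2_ip \<Omega> (weak_laplacian \<Omega> v) v = - grad_sq \<Omega> v"
    using ad by (auto simp: admissible_def green_identity[OF open_domain] grad_sq_def L2_ip_self)
  finally have e: "L2_ip \<Omega> G v + grad_sq \<Omega> v = \<mu> / \<epsilon> * L2_ip \<Omega> (reaction u v) v" by simp
  have "L2_ip \<Omega> (reaction u v) v \<le> L2_norm \<Omega> (reaction u v) * L2_norm \<Omega> v"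
    using L2_Cauchy_Schwarz[OF l2(4,2)] by simp
  also have "\<dots> \<le> (L2_norm \<Omega> u + L * M * sqrt vol) * L2_norm \<Omega> v"
    using L2_norm_triangle_diff[OF l2(1,3)] admissible_\<alpha>_norm[OF ad]
    unfolding reaction_def[abs_def] by (intro mult_right_mono) auto
  finally show ?thesis unfolding e using \<mu>_pos \<epsilon>_pos by (intro mult_left_mono) auto
qed

section \<open>Energy estimates for the difference of two solutions\<close>

lemma U_estimate:
  assumes ad: "admissible u1 v1" "admissible u2 v2" and U': "U' \<in> L2_space \<Omega>"
    and eq: "AE x in lebesgue_on \<Omega>. 1 / \<mu> * U' x =
      (weak_laplacian \<Omega> u1 x - weak_laplacian \<Omega> u2 x) - 1 / \<epsilon> * (reaction u1 v1 x - reaction u2 v2 x)"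
  shows "2 * L2_ip \<Omega> U' (\<lambda>x. u1 x - u2 x) \<le> 2 / \<epsilon> * (L2_norm \<Omega> (\<lambda>x. u1 x - u2 x) * L2_norm \<Omega> (\<lambda>x. v1 x - v2 x))"
proof -
  let ?U = "\<lambda>x. u1 x - u2 x" and ?V = "\<lambda>x. v1 x - v2 x" and ?r = "\<lambda>x. reaction u1 v1 x - reaction u2 v2 x"
  let ?l = "\<lambda>x. weak_laplacian \<Omega> u1 x - weak_laplacian \<Omega> u2 x"
  note l2 = admissible_L2[OF ad(1)] admissible_L2[OF ad(2)]
  have L: "?U \<in> L2_space \<Omega>" "?V \<in> L2_space \<Omega>" "?r \<in> L2_space \<Omega>" "?l \<in> L2_space \<Omega>"
    by (intro L2_space_diff l2)+
  have "1 / \<mu> * L2_ip \<Omega> U' ?U = L2_ip \<Omega> (\<lambda>x. 1 / \<mu> * U' x) ?U" by (simp only: L2_ip_scale_left)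
  also have "\<dots> = L2_ip \<Omega> (\<lambda>x. ?l x - 1 / \<epsilon> * ?r x) ?U"
    by (intro L2_ip_cong_AE eq AE_I2 refl L2_space_scale L2_space_diff[OF L(4)] L U')
  also have "\<dots> = L2_ip \<Omega> ?l ?U - 1 / \<epsilon> * L2_ip \<Omega> ?r ?U"
    by (simp only: L2_ip_diff_left[OF L(4) L2_space_scale[OF L(3)] L(1)] L2_ip_scale_left)
  also have "L2_ip \<Omega> ?l ?U = - grad_sq \<Omega> ?U"
    using ad by (intro green_identity_diff[OF open_domain]) (auto simp: admissible_def)
  finally have e: "1 / \<mu> * L2_ip \<Omega> U' ?U \<le> - (1 / \<epsilon> * L2_ip \<Omega> ?r ?U)" by simp
  have "- L2_ip \<Omega> ?r ?U \<le> L * (L2_norm \<Omega> ?U * L2_norm \<Omega> ?V)"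
  proof -
    have "- L2_ip \<Omega> ?r ?U = integral\<^sup>L (lebesgue_on \<Omega>) (\<lambda>x. - (?r x * ?U x))"
      by (simp add: L2_ip_def)
    also have "\<dots> \<le> integral\<^sup>L (lebesgue_on \<Omega>) (\<lambda>x. L * (\<bar>?U x\<bar> * \<bar>?V x\<bar>))"
    proof (rule integral_mono_AE)
      show "integrable (lebesgue_on \<Omega>) (\<lambda>x. - (?r x * ?U x))"
        using L2_space_integrable_mult[OF L(3,1)] by simp
      show "integrable (lebesgue_on \<Omega>) (\<lambda>x. L * (\<bar>?U x\<bar> * \<bar>?V x\<bar>))"
        by (intro integrable_mult_right L2_space_integrable_mult L2_space_abs L)
      have "AE x in lebesgue_on \<Omega>. \<bar>\<mu> * u1 x + v1 x\<bar> \<le> M" "AE x in lebesgue_on \<Omega>. \<bar>\<mu> * u2 x + v2 x\<bar> \<le> M"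
        using ad by (simp_all add: admissible_def)
      then show "AE x in lebesgue_on \<Omega>. - (?r x * ?U x) \<le> L * (\<bar>?U x\<bar> * \<bar>?V x\<bar>)"
      proof eventually_elim
        case (elim x)
        let ?A = "\<alpha> (\<mu> * u1 x + v1 x) - \<alpha> (\<mu> * u2 x + v2 x)"
        have "\<bar>?A\<bar> \<le> L * \<bar>\<mu> * ?U x + ?V x\<bar>"
          using \<alpha>_difference(2)[OF elim] by (simp add: algebra_simps)
        also have "\<dots> \<le> L * (\<mu> * \<bar>?U x\<bar> + \<bar>?V x\<bar>)"
          using L_pos \<mu>_pos abs_triangle_ineq[of "\<mu> * ?U x" "?V x"] by (intro mult_left_mono) (auto simp: abs_mult)
        finally have "\<bar>?A\<bar> * \<bar>?U x\<bar> \<le> L * (\<mu> * \<bar>?U x\<bar> + \<bar>?V x\<bar>) * \<bar>?U x\<bar>" by (intro mult_right_mono) auto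
        moreover have "?A * ?U x \<le> \<bar>?A\<bar> * \<bar>?U x\<bar>" by (simp add: abs_mult[symmetric])
        \<comment> \<open>The smallness of L against 1 / \<mu> enters here: the part of \<alpha>
          that is quadratic in U is absorbed by the damping term, and only the mixed product of U
          and V remains.\<close>
        moreover have "L * \<mu> * (\<bar>?U x\<bar> * \<bar>?U x\<bar>) \<le> 1 * (\<bar>?U x\<bar> * \<bar>?U x\<bar>)"
          using L_\<mu> by (intro mult_right_mono) auto
        moreover have "?r x * ?U x = \<bar>?U x\<bar> * \<bar>?U x\<bar> - ?A * ?U x"
          by (simp add: reaction_def algebra_simps)
        ultimately show ?case by (simp add: algebra_simps)
      qed
    qed
    also have "\<dots> = L * L2_ip \<Omega> (\<lambda>x. \<bar>?U x\<bar>) (\<lambda>x. \<bar>?V x\<bar>)" by (simp add: L2_ip_def)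
    also have "\<dots> \<le> L * (L2_norm \<Omega> ?U * L2_norm \<Omega> ?V)"
      using L2_Cauchy_Schwarz[OF L2_space_abs[OF L(1)] L2_space_abs[OF L(2)]] L_pos
      by (intro mult_left_mono) auto
    finally show ?thesis .
  qed
  then have "1 / \<epsilon> * (- L2_ip \<Omega> ?r ?U) \<le> 1 / \<epsilon> * (L * (L2_norm \<Omega> ?U * L2_norm \<Omega> ?V))"
    using \<epsilon>_pos by (intro mult_left_mono) auto
  with e have "1 / \<mu> * L2_ip \<Omega> U' ?U \<le> 1 / \<epsilon> * (L * (L2_norm \<Omega> ?U * L2_norm \<Omega> ?V))" by simp
  then have "2 * \<mu> * (1 / \<mu> * L2_ip \<Omega> U' ?U) \<le> 2 * \<mu> * (1 / \<epsilon> * (L * (L2_norm \<Omega> ?U * L2_norm \<Omega> ?V)))"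
    using \<mu>_pos by (intro mult_left_mono) auto
  then have "2 * L2_ip \<Omega> U' ?U \<le> (L * \<mu>) * (2 / \<epsilon> * (L2_norm \<Omega> ?U * L2_norm \<Omega> ?V))"
    using \<mu>_pos by (simp add: algebra_simps)
  also have "\<dots> \<le> 1 * (2 / \<epsilon> * (L2_norm \<Omega> ?U * L2_norm \<Omega> ?V))"
    using L_\<mu> \<epsilon>_pos by (intro mult_right_mono) auto
  finally show ?thesis by simp
qed

lemma U_estimate_grad:
  assumes ad: "admissible u1 v1" "admissible u2 v2" and U': "U' \<in> L2_space \<Omega>"
    and eq: "AE x in lebesgue_on \<Omega>. 1 / \<mu> * U' x =
      (weak_laplacian \<Omega> u1 x - weak_laplacian \<Omega> u2 x) - 1 / \<epsilon> * (reaction u1 v1 x - reaction u2 v2 x)"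
  shows "2 * L2_ip \<Omega> U' (\<lambda>x. u1 x - u2 x)
    \<le> 1 / 4 * grad_sq \<Omega> (\<lambda>x. v1 x - v2 x) + U_const * (L2_norm \<Omega> (\<lambda>x. u1 x - u2 x))\<^sup>2"
proof -
  let ?U = "L2_norm \<Omega> (\<lambda>x. u1 x - u2 x)" and ?V = "L2_norm \<Omega> (\<lambda>x. v1 x - v2 x)"
  have "?V * (2 / \<epsilon> * ?U) \<le> ?V\<^sup>2 / (4 * poincare_const) + poincare_const * (2 / \<epsilon> * ?U)\<^sup>2"
    by (rule weighted_AM_GM[OF poincare_const_pos])
  moreover have "?V\<^sup>2 / (4 * poincare_const) \<le> 1 / 4 * grad_sq \<Omega> (\<lambda>x. v1 x - v2 x)"
    using poincare[OF H10_diff[OF open_domain, of v1 v2]] ad poincare_const_pos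
    by (simp add: admissible_def divide_simps mult.commute)
  moreover have "poincare_const * (2 / \<epsilon> * ?U)\<^sup>2 = U_const * ?U\<^sup>2"
    by (simp add: U_const_def power_mult_distrib power_divide)
  ultimately show ?thesis using U_estimate[OF assms] by (simp add: algebra_simps)
qed

text \<open>The reactions differ by U - A with A the difference of the values of \<alpha>, and A V
  has no definite sign. Cocoercivity gives L A V \<ge> A^2 - L \<mu> A U, and A^2 compensates the
  mixed term A U up to a multiple of U^2. No smallness of V is needed, so the gradient can absorb
  the product of U and V.\<close>

lemma V_estimate:
  assumes ad: "admissible u1 v1" "admissible u2 v2" and G: "G \<in> L2_space \<Omega>"
    and eq: "AE x in lebesgue_on \<Omega>. G x =
      (weak_laplacian \<Omega> v1 x - weak_laplacian \<Omega> v2 x) + \<mu> / \<epsilon> * (reaction u1 v1 x - reaction u2 v2 x)"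
  shows "L2_ip \<Omega> G (\<lambda>x. v1 x - v2 x) + 1 / 2 * grad_sq \<Omega> (\<lambda>x. v1 x - v2 x)
    \<le> V_const * (L2_norm \<Omega> (\<lambda>x. u1 x - u2 x))\<^sup>2"
proof -
  let ?U = "\<lambda>x. u1 x - u2 x" and ?V = "\<lambda>x. v1 x - v2 x" and ?r = "\<lambda>x. reaction u1 v1 x - reaction u2 v2 x"
  let ?l = "\<lambda>x. weak_laplacian \<Omega> v1 x - weak_laplacian \<Omega> v2 x"
  note l2 = admissible_L2[OF ad(1)] admissible_L2[OF ad(2)]
  have L: "?U \<in> L2_space \<Omega>" "?V \<in> L2_space \<Omega>" "?r \<in> L2_space \<Omega>" "?l \<in> L2_space \<Omega>"
    by (intro L2_space_diff l2)+
  have "L2_ip \<Omega> G ?V = L2_ip \<Omega> (\<lambda>x. ?l x + \<mu> / \<epsilon> * ?r x) ?V"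
    by (intro L2_ip_cong_AE eq AE_I2 refl L2_space_scale L2_space_add[OF L(4)] L G)
  also have "\<dots> = L2_ip \<Omega> ?l ?V + \<mu> / \<epsilon> * L2_ip \<Omega> ?r ?V"
    by (simp only: L2_ip_add_left[OF L(4) L2_space_scale[OF L(3)] L(2)] L2_ip_scale_left)
  also have "L2_ip \<Omega> ?l ?V = - grad_sq \<Omega> ?V"
    using ad by (intro green_identity_diff[OF open_domain]) (auto simp: admissible_def)
  finally have e: "L2_ip \<Omega> G ?V + grad_sq \<Omega> ?V = \<mu> / \<epsilon> * L2_ip \<Omega> ?r ?V" by simp
  have "L2_ip \<Omega> ?r ?V \<le> L2_norm \<Omega> ?U * L2_norm \<Omega> ?V + \<mu> / 4 * (L2_norm \<Omega> ?U)\<^sup>2"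
  proof -
    have "L2_ip \<Omega> ?r ?V \<le> integral\<^sup>L (lebesgue_on \<Omega>) (\<lambda>x. ?U x * ?V x + \<mu> / 4 * (?U x)\<^sup>2)"
      unfolding L2_ip_def
    proof (rule integral_mono_AE)
      show "integrable (lebesgue_on \<Omega>) (\<lambda>x. ?r x * ?V x)" by (rule L2_space_integrable_mult[OF L(3,2)])
      show "integrable (lebesgue_on \<Omega>) (\<lambda>x. ?U x * ?V x + \<mu> / 4 * (?U x)\<^sup>2)"
        by (intro Bochner_Integration.integrable_add integrable_mult_right L2_space_integrable_mult L2_space_integrable_sq L)
      have "AE x in lebesgue_on \<Omega>. \<bar>\<mu> * u1 x + v1 x\<bar> \<le> M" "AE x in lebesgue_on \<Omega>. \<bar>\<mu> * u2 x + v2 x\<bar> \<le> M"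
        using ad by (simp_all add: admissible_def)
      then show "AE x in lebesgue_on \<Omega>. ?r x * ?V x \<le> ?U x * ?V x + \<mu> / 4 * (?U x)\<^sup>2"
      proof eventually_elim
        case (elim x)
        let ?A = "\<alpha> (\<mu> * u1 x + v1 x) - \<alpha> (\<mu> * u2 x + v2 x)"
        have "?A\<^sup>2 \<le> L * (?A * (\<mu> * ?U x + ?V x))"
          using \<alpha>_difference(1)[OF elim] by (simp add: algebra_simps)
        then have AV: "L * (?A * ?V x) \<ge> ?A\<^sup>2 - L * \<mu> * (?A * ?U x)" by (simp add: algebra_simps)
        have "(L * \<mu> * ?U x) * ?A \<le> (L * \<mu> * ?U x)\<^sup>2 / (4 * 1) + 1 * ?A\<^sup>2" by (rule weighted_AM_GM) simp
        moreover have "L * \<mu> * (?A * ?U x) = (L * \<mu> * ?U x) * ?A" by simp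
        moreover have "(L * \<mu> * ?U x)\<^sup>2 / (4 * 1) = L * (L * \<mu> * (\<mu> / 4 * (?U x)\<^sup>2))"
          by (simp add: power2_eq_square)
        moreover have "L * (- (?A * ?V x)) = - (L * (?A * ?V x))" by simp
        ultimately have "L * (- (?A * ?V x)) \<le> L * (L * \<mu> * (\<mu> / 4 * (?U x)\<^sup>2))"
          using AV by linarith
        then have "- (?A * ?V x) \<le> L * \<mu> * (\<mu> / 4 * (?U x)\<^sup>2)" using L_pos by (simp only: mult_le_cancel_left_pos)
        also have "\<dots> \<le> 1 * (\<mu> / 4 * (?U x)\<^sup>2)" using L_\<mu> \<mu>_pos by (intro mult_right_mono) auto
        finally show ?case by (simp add: reaction_def algebra_simps)
      qed
    qed
    also have "\<dots> = L2_ip \<Omega> ?U ?V + \<mu> / 4 * (L2_norm \<Omega> ?U)\<^sup>2"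
      using L2_space_integrable_mult[OF L(1,2)] L2_space_integrable_sq[OF L(1)] L2_ip_self[of \<Omega> ?U]
      by (simp add: L2_ip_def power2_eq_square)
    also have "\<dots> \<le> L2_norm \<Omega> ?U * L2_norm \<Omega> ?V + \<mu> / 4 * (L2_norm \<Omega> ?U)\<^sup>2"
      using L2_Cauchy_Schwarz[OF L(1,2)] by simp
    finally show ?thesis .
  qed
  then have "\<mu> / \<epsilon> * L2_ip \<Omega> ?r ?V \<le> \<mu> / \<epsilon> * (L2_norm \<Omega> ?U * L2_norm \<Omega> ?V + \<mu> / 4 * (L2_norm \<Omega> ?U)\<^sup>2)"
    using \<mu>_pos \<epsilon>_pos by (intro mult_left_mono) auto
  \<comment> \<open>With the weight \<open>poincare_const / 2\<close>, Poincare's inequality bounds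
    the term in V by exactly half of the gradient energy.\<close>
  moreover have "L2_norm \<Omega> ?V * (\<mu> / \<epsilon> * L2_norm \<Omega> ?U)
      \<le> (L2_norm \<Omega> ?V)\<^sup>2 / (4 * (poincare_const / 2)) + poincare_const / 2 * (\<mu> / \<epsilon> * L2_norm \<Omega> ?U)\<^sup>2"
    using poincare_const_pos by (intro weighted_AM_GM) simp
  moreover have "(L2_norm \<Omega> ?V)\<^sup>2 / (4 * (poincare_const / 2)) \<le> 1 / 2 * grad_sq \<Omega> ?V"
    using poincare[OF H10_diff[OF open_domain, of v1 v2]] ad poincare_const_pos
    by (simp add: admissible_def divide_simps mult.commute)
  moreover have "poincare_const / 2 * (\<mu> / \<epsilon> * L2_norm \<Omega> ?U)\<^sup>2 + \<mu> / \<epsilon> * (\<mu> / 4 * (L2_norm \<Omega> ?U)\<^sup>2)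
      = V_const * (L2_norm \<Omega> ?U)\<^sup>2"
    using \<epsilon>_pos by (simp add: V_const_def power2_eq_square field_simps)
  moreover have "\<mu> / \<epsilon> * (L2_norm \<Omega> ?U * L2_norm \<Omega> ?V + \<mu> / 4 * (L2_norm \<Omega> ?U)\<^sup>2)
      = L2_norm \<Omega> ?V * (\<mu> / \<epsilon> * L2_norm \<Omega> ?U) + \<mu> / \<epsilon> * (\<mu> / 4 * (L2_norm \<Omega> ?U)\<^sup>2)"
    by (simp add: distrib_left)
  ultimately show ?thesis using e by linarith
qed

end

section \<open>Estimates in time\<close>

text \<open>The derivative exists only for positive times. The inequality is integrated from s > 0,
  and s tends to 0 by continuity in L2 up to the initial time.\<close>

lemma L2_norm_sq_growth:
  assumes W: "W \<in> C_L2 {0..T} \<Omega>"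
    and W': "C1_L2 {0<..T} \<Omega> W W'"
    and D: "\<And>t. t \<in> {0<..T} \<Longrightarrow> 2 * L2_ip \<Omega> (W' t) (W t) \<le> D" and t: "t \<in> {0<..T}"
  shows "(L2_norm \<Omega> (W t))\<^sup>2 \<le> (L2_norm \<Omega> (W 0))\<^sup>2 + D * t"
proof -
  let ?y = "\<lambda>t. (L2_norm \<Omega> (W t))\<^sup>2"
  have "continuous_on {0..T} ?y" by (intro continuous_on_power C_time_L2_norm_continuous W)
  then have "(?y \<longlongrightarrow> ?y 0) (at 0 within {0..T})" using t by (auto simp: continuous_on_def)
  then have "(?y \<longlongrightarrow> ?y 0) (at_right 0)"
    using t by (simp add: at_within_Icc_at_right)
  then have "((\<lambda>s. ?y s + D * (t - s)) \<longlongrightarrow> ?y 0 + D * (t - 0)) (at_right 0)"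
    by (intro tendsto_add tendsto_mult_left tendsto_diff tendsto_const tendsto_ident_at)
  moreover have "\<forall>\<^sub>F s in at_right 0. ?y t \<le> ?y s + D * (t - s)"
    unfolding eventually_at_right_field
  proof (intro exI[of _ t] conjI allI impI)
    fix s assume s: "0 < s" "s < t"
    have "?y t - ?y s \<le> D * (t - s)"
    proof (rule derivative_within_bound)
      fix x assume x: "x \<in> {s..t}"
      then have x': "x \<in> {0<..T}" using s t by auto
      show "(?y has_real_derivative 2 * L2_ip \<Omega> (W' x) (W x)) (at x within {s..t})"
        by (rule has_field_derivative_subset[OF L2_norm_sq_derivative[OF W' x']]) (use s t in auto)
      show "2 * L2_ip \<Omega> (W' x) (W x) \<le> D" by (rule D[OF x'])
    qed (use s in simp)
    then show "?y t \<le> ?y s + D * (t - s)" by simp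
  qed (use t in simp)
  ultimately have "?y t \<le> ?y 0 + D * (t - 0)"
    by (intro tendsto_lowerbound[OF _ _ trivial_limit_at_right_real])
  then show ?thesis by simp
qed

context reaction_diffusion
begin

text \<open>For \<open>\<xi> = 0\<close> one may take \<open>v' = 0\<close>, which allows both cases to be treated together.\<close>

definition evolution ::
    "real \<Rightarrow> real \<Rightarrow> (real \<Rightarrow> 'a \<Rightarrow> real) \<Rightarrow> (real \<Rightarrow> 'a \<Rightarrow> real) \<Rightarrow> (real \<Rightarrow> 'a \<Rightarrow> real) \<Rightarrow> (real \<Rightarrow> 'a \<Rightarrow> real) \<Rightarrow> bool" where
  "evolution T \<xi> u v u' v' \<longleftrightarrow>
     (\<forall>t\<in>{0<..T}. admissible (u t) (v t)) \<and>
     u \<in> C_L2 {0..T} \<Omega> \<and>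
     C1_L2 {0<..T} \<Omega> u u' \<and>
     v \<in> C_H2 {0<..T} \<Omega> \<and>
     (\<xi> > 0 \<longrightarrow> C1_L2 {0<..T} \<Omega> v v') \<and>
     (\<forall>t\<in>{0<..T}. v' t \<in> L2_space \<Omega>) \<and>
     (\<forall>t\<in>{0<..T}. AE x in lebesgue_on \<Omega>.
        1 / \<mu> * u' t x = weak_laplacian \<Omega> (u t) x - 1 / \<epsilon> * reaction (u t) (v t) x) \<and>
     (\<forall>t\<in>{0<..T}. AE x in lebesgue_on \<Omega>.
        \<xi> * v' t x = weak_laplacian \<Omega> (v t) x + \<mu> / \<epsilon> * reaction (u t) (v t) x)"

text \<open>One constant for both unknowns: the square root bounds u, while the factor 1 + \<mu> and
  the last summand make room for v = z - \<mu> u.\<close>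

definition size_bound :: "real \<Rightarrow> real \<Rightarrow> real" where
  "size_bound T N = sqrt (N\<^sup>2 + \<mu> / (2 * \<epsilon>) * (L * M)\<^sup>2 * vol * T) * (1 + \<mu>) + M * sqrt vol"

definition grad_const :: "real \<Rightarrow> real" where
  "grad_const K = \<mu> / \<epsilon> * ((K + L * M * sqrt vol) * K)"

section \<open>Bounds uniform in the relaxation parameter\<close>

lemma evolution_deriv_L2:
  "evolution T \<xi> u v u' v' \<Longrightarrow> t \<in> {0<..T} \<Longrightarrow> u' t \<in> L2_space \<Omega>"
  by (auto simp: evolution_def has_C1_deriv_def dest: C_timeD)

lemma evolution_size:
  assumes e: "evolution T \<xi> u v u' v'" and t: "t \<in> {0<..T}"
  shows "L2_norm \<Omega> (u t) \<le> size_bound T (L2_norm \<Omega> (u 0))" "L2_norm \<Omega> (v t) \<le> size_bound T (L2_norm \<Omega> (u 0))"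
proof -
  let ?c = "\<mu> / (2 * \<epsilon>) * (L * M)\<^sup>2 * vol"
  have c: "?c \<ge> 0" using \<mu>_pos \<epsilon>_pos vol_nonneg by simp
  define r where "r = sqrt ((L2_norm \<Omega> (u 0))\<^sup>2 + ?c * T)"
  have r: "r \<ge> 0"
    unfolding r_def using mult_nonneg_nonneg[OF c, of T] t by (intro real_sqrt_ge_zero add_nonneg_nonneg) auto
  have "(L2_norm \<Omega> (u t))\<^sup>2 \<le> (L2_norm \<Omega> (u 0))\<^sup>2 + ?c * t"
  proof (rule L2_norm_sq_growth[OF _ _ _ t])
    fix s assume s: "s \<in> {0<..T}"
    show "2 * L2_ip \<Omega> (u' s) (u s) \<le> ?c"
      using e s by (intro u_estimate[where v="v s"] evolution_deriv_L2[OF e]) (auto simp: evolution_def)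
  qed (use e in \<open>auto simp: evolution_def\<close>)
  also have "\<dots> \<le> (L2_norm \<Omega> (u 0))\<^sup>2 + ?c * T" using c t by (intro add_left_mono mult_left_mono) auto
  finally have u: "L2_norm \<Omega> (u t) \<le> r" unfolding r_def by (rule real_le_rsqrt)
  have vol: "M * sqrt vol \<ge> 0" using M_pos vol_nonneg by simp
  have eq: "size_bound T (L2_norm \<Omega> (u 0)) = r + \<mu> * r + M * sqrt vol"
    unfolding size_bound_def r_def[symmetric] by (simp add: algebra_simps)
  have mr: "\<mu> * r \<ge> 0" using \<mu>_pos r by simp
  show "L2_norm \<Omega> (u t) \<le> size_bound T (L2_norm \<Omega> (u 0))" unfolding eq using u vol mr by linarith
  have "admissible (u t) (v t)" using e t by (simp add: evolution_def)
  then have "L2_norm \<Omega> (v t) \<le> M * sqrt vol + \<mu> * L2_norm \<Omega> (u t)" by (rule admissible_v_norm)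
  moreover have "\<mu> * L2_norm \<Omega> (u t) \<le> \<mu> * r" using u \<mu>_pos by (intro mult_left_mono) auto
  ultimately show "L2_norm \<Omega> (v t) \<le> size_bound T (L2_norm \<Omega> (u 0))" unfolding eq using r by linarith
qed

lemma evolution_grad_continuous:
  "evolution T \<xi> u v u' v' \<Longrightarrow> continuous_on {0<..T} (\<lambda>t. grad_sq \<Omega> (v t))"
  by (intro C_time_H2_grad_continuous open_domain) (simp add: evolution_def)

text \<open>\<xi> times the inner product of \<open>v'\<close> and v is the derivative of \<xi> / 2
  times the squared norm of v. Its value at s is bounded through K, so the initial value of v plays
  no part, and the gradient energy over short intervals is small uniformly for small \<xi>.\<close>

lemma evolution_grad_integral:
  assumes e: "evolution T \<xi> u v u' v'" and \<xi>: "\<xi> \<ge> 0" and st: "0 < s" "s \<le> t" "t \<le> T"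
    and K: "\<And>t. t \<in> {0<..T} \<Longrightarrow> L2_norm \<Omega> (u t) \<le> K" "\<And>t. t \<in> {0<..T} \<Longrightarrow> L2_norm \<Omega> (v t) \<le> K"
  shows "integral {s..t} (\<lambda>r. grad_sq \<Omega> (v r)) \<le> grad_const K * (t - s) + \<xi> / 2 * K\<^sup>2"
proof -
  let ?g = "\<lambda>r. grad_sq \<Omega> (v r)"
  have sub: "{s..t} \<subseteq> {0<..T}" using st by auto
  have K0: "K \<ge> 0" using K(1)[of t] st order_trans[OF L2_norm_nonneg] by auto
  have gc: "continuous_on {s..t} ?g" by (rule continuous_on_subset[OF evolution_grad_continuous[OF e] sub])
  have der: "((\<lambda>r. \<xi> / 2 * (L2_norm \<Omega> (v r))\<^sup>2) has_real_derivative \<xi> * L2_ip \<Omega> (v' r) (v r)) (at r within {s..t})"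
    if r: "r \<in> {s..t}" for r
  \<comment> \<open>For \<xi> = 0 nothing is known about differentiability of v, but both function
    and derivative are identically zero.\<close>
  proof (cases "\<xi> = 0")
    case False
    then have "C1_L2 {0<..T} \<Omega> v v'" using e \<xi> by (auto simp: evolution_def)
    from DERIV_cmult[OF has_field_derivative_subset[OF L2_norm_sq_derivative[OF this] sub], of r "\<xi> / 2"]
    show ?thesis using r sub by auto
  qed simp
  let ?\<Phi> = "\<lambda>r. \<xi> / 2 * (L2_norm \<Omega> (v r))\<^sup>2 + integral {s..r} ?g"
  have "?\<Phi> t - ?\<Phi> s \<le> grad_const K * (t - s)"
  proof (rule derivative_within_bound)
    fix r assume r: "r \<in> {s..t}"
    then have r': "r \<in> {0<..T}" using sub by auto
    show "(?\<Phi> has_real_derivative \<xi> * L2_ip \<Omega> (v' r) (v r) + ?g r) (at r within {s..t})"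
      by (intro DERIV_add der[OF r] integral_has_real_derivative[OF gc r])
    have ad: "admissible (u r) (v r)" using e r' by (simp add: evolution_def)
    have "L2_ip \<Omega> (\<lambda>x. \<xi> * v' r x) (v r) + ?g r \<le> \<mu> / \<epsilon> * ((L2_norm \<Omega> (u r) + L * M * sqrt vol) * L2_norm \<Omega> (v r))"
      using e r' by (intro v_estimate[OF ad] L2_space_scale) (auto simp: evolution_def)
    also have "\<dots> \<le> grad_const K"
      unfolding grad_const_def using K[OF r'] K0 \<mu>_pos \<epsilon>_pos L_pos M_pos vol_nonneg
      by (intro mult_left_mono mult_mono) auto
    finally show "\<xi> * L2_ip \<Omega> (v' r) (v r) + ?g r \<le> grad_const K" by (simp add: L2_ip_scale_left)
  qed (use st in simp)
  moreover have "\<xi> / 2 * (L2_norm \<Omega> (v s))\<^sup>2 \<le> \<xi> / 2 * K\<^sup>2"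
    using K(2)[of s] st \<xi> by (intro mult_left_mono power_mono) auto
  moreover have "0 \<le> \<xi> / 2 * (L2_norm \<Omega> (v t))\<^sup>2" using \<xi> by simp
  ultimately show ?thesis by simp
qed

section \<open>The difference of two solutions in time\<close>

lemma evolution_difference_U:
  assumes e: "evolution T \<xi> u v u' v'" "evolution T \<xi>' p q p' q'" and t: "t \<in> {0<..T}"
  shows "2 * L2_ip \<Omega> (\<lambda>x. u' t x - p' t x) (\<lambda>x. u t x - p t x)
      \<le> 2 / \<epsilon> * (L2_norm \<Omega> (\<lambda>x. u t x - p t x) * L2_norm \<Omega> (\<lambda>x. v t x - q t x))"
    "2 * L2_ip \<Omega> (\<lambda>x. u' t x - p' t x) (\<lambda>x. u t x - p t x)
      \<le> 1 / 4 * grad_sq \<Omega> (\<lambda>x. v t x - q t x) + U_const * (L2_norm \<Omega> (\<lambda>x. u t x - p t x))\<^sup>2"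
proof -
  have ad: "admissible (u t) (v t)" "admissible (p t) (q t)" using e t by (auto simp: evolution_def)
  have L: "(\<lambda>x. u' t x - p' t x) \<in> L2_space \<Omega>"
    using t by (intro L2_space_diff evolution_deriv_L2[OF e(1)] evolution_deriv_L2[OF e(2)])
  have "AE x in lebesgue_on \<Omega>. 1 / \<mu> * u' t x = weak_laplacian \<Omega> (u t) x - 1 / \<epsilon> * reaction (u t) (v t) x"
    "AE x in lebesgue_on \<Omega>. 1 / \<mu> * p' t x = weak_laplacian \<Omega> (p t) x - 1 / \<epsilon> * reaction (p t) (q t) x"
    using e t by (auto simp: evolution_def)
  then have eq: "AE x in lebesgue_on \<Omega>. 1 / \<mu> * (u' t x - p' t x) = (weak_laplacian \<Omega> (u t) x - weak_laplacian \<Omega> (p t) x)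
      - 1 / \<epsilon> * (reaction (u t) (v t) x - reaction (p t) (q t) x)"
    by eventually_elim (simp only: right_diff_distrib)
  show "2 * L2_ip \<Omega> (\<lambda>x. u' t x - p' t x) (\<lambda>x. u t x - p t x)
      \<le> 2 / \<epsilon> * (L2_norm \<Omega> (\<lambda>x. u t x - p t x) * L2_norm \<Omega> (\<lambda>x. v t x - q t x))"
    by (rule U_estimate[OF ad L eq])
  show "2 * L2_ip \<Omega> (\<lambda>x. u' t x - p' t x) (\<lambda>x. u t x - p t x)
      \<le> 1 / 4 * grad_sq \<Omega> (\<lambda>x. v t x - q t x) + U_const * (L2_norm \<Omega> (\<lambda>x. u t x - p t x))\<^sup>2"
    by (rule U_estimate_grad[OF ad L eq])
qed

text \<open>Since the second pair has parameter 0, only the time derivative of the first pair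
  occurs; it is paired with v - q, whose own derivative may not exist.\<close>

lemma evolution_difference_V:
  assumes e: "evolution T \<xi> u v u' v'" "evolution T 0 p q p' q'" and t: "t \<in> {0<..T}"
  shows "\<xi> * L2_ip \<Omega> (v' t) (\<lambda>x. v t x - q t x) + 1 / 2 * grad_sq \<Omega> (\<lambda>x. v t x - q t x)
      \<le> V_const * (L2_norm \<Omega> (\<lambda>x. u t x - p t x))\<^sup>2"
proof -
  have ad: "admissible (u t) (v t)" "admissible (p t) (q t)" using e t by (auto simp: evolution_def)
  have L: "(\<lambda>x. \<xi> * v' t x) \<in> L2_space \<Omega>" using e t by (auto simp: evolution_def intro: L2_space_scale)
  have "AE x in lebesgue_on \<Omega>. \<xi> * v' t x = weak_laplacian \<Omega> (v t) x + \<mu> / \<epsilon> * reaction (u t) (v t) x"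
    "AE x in lebesgue_on \<Omega>. 0 * q' t x = weak_laplacian \<Omega> (q t) x + \<mu> / \<epsilon> * reaction (p t) (q t) x"
    using e t unfolding evolution_def by blast+
  then have eq: "AE x in lebesgue_on \<Omega>. \<xi> * v' t x = (weak_laplacian \<Omega> (v t) x - weak_laplacian \<Omega> (q t) x)
      + \<mu> / \<epsilon> * (reaction (u t) (v t) x - reaction (p t) (q t) x)"
    by eventually_elim (simp add: right_diff_distrib)
  show ?thesis using V_estimate[OF ad L eq] by (simp add: L2_ip_scale_left)
qed

text \<open>From \<open>V_estimate\<close> with vanishing left inner product: half the gradient
  energy is at most \<open>V_const\<close> times the squared difference of the first components, and
  Poincare's inequality turns this into a bound on the norm.\<close>

definition lip_const :: real where "lip_const = sqrt (2 * poincare_const * V_const)"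

lemma V_const_nonneg: "V_const \<ge> 0"
  using poincare_const_pos \<mu>_pos \<epsilon>_pos by (simp add: V_const_def)

text \<open>\<open>V_estimate\<close> compares two arbitrary admissible pairs, so it may be applied
  to one and the same solution at two times, here with \<open>G\<close> equal to zero.\<close>

lemma elliptic_lipschitz:
  assumes e: "evolution T 0 p q p' q'" and s: "s \<in> {0<..T}" and t: "t \<in> {0<..T}"
  shows "L2_norm \<Omega> (\<lambda>x. q s x - q t x) \<le> lip_const * L2_norm \<Omega> (\<lambda>x. p s x - p t x)"
proof (rule power2_le_imp_le)
  have ad: "admissible (p s) (q s)" "admissible (p t) (q t)" using e s t by (auto simp: evolution_def)
  have "AE x in lebesgue_on \<Omega>. 0 * q' s x = weak_laplacian \<Omega> (q s) x + \<mu> / \<epsilon> * reaction (p s) (q s) x"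
    "AE x in lebesgue_on \<Omega>. 0 * q' t x = weak_laplacian \<Omega> (q t) x + \<mu> / \<epsilon> * reaction (p t) (q t) x"
    using e s t unfolding evolution_def by blast+
  then have eq: "AE x in lebesgue_on \<Omega>. 0 = (weak_laplacian \<Omega> (q s) x - weak_laplacian \<Omega> (q t) x)
      + \<mu> / \<epsilon> * (reaction (p s) (q s) x - reaction (p t) (q t) x)"
    by eventually_elim (simp add: right_diff_distrib)
  have V: "1 / 2 * grad_sq \<Omega> (\<lambda>x. q s x - q t x) \<le> V_const * (L2_norm \<Omega> (\<lambda>x. p s x - p t x))\<^sup>2"
    using V_estimate[OF ad L2_space_zero eq] by (simp add: L2_ip_def)
  have "(L2_norm \<Omega> (\<lambda>x. q s x - q t x))\<^sup>2 \<le> poincare_const * grad_sq \<Omega> (\<lambda>x. q s x - q t x)"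
    using ad by (intro poincare H10_diff open_domain) (auto simp: admissible_def)
  also have "\<dots> \<le> poincare_const * (2 * (V_const * (L2_norm \<Omega> (\<lambda>x. p s x - p t x))\<^sup>2))"
    using V poincare_const_pos by (intro mult_left_mono) auto
  finally show "(L2_norm \<Omega> (\<lambda>x. q s x - q t x))\<^sup>2 \<le> (lip_const * L2_norm \<Omega> (\<lambda>x. p s x - p t x))\<^sup>2"
    using V_const_nonneg poincare_const_pos by (simp add: lip_const_def power_mult_distrib mult_ac)
qed (use V_const_nonneg poincare_const_pos in \<open>simp add: lip_const_def\<close>)

text \<open>Near t the difference quotient of p lies within 1 of \<open>p' t\<close>, whence the
  factor B + 1; the elliptic equation passes this rate on to q.\<close>

lemma elliptic_locally_lipschitz:
  assumes e: "evolution T 0 p q p' q'" and t: "t \<in> {0<..T}" and B: "L2_norm \<Omega> (p' t) \<le> B"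
  shows "\<forall>\<^sub>F s in at t within {0<..T}. L2_norm \<Omega> (\<lambda>x. q s x - q t x) \<le> lip_const * (B + 1) * \<bar>s - t\<bar>"
proof -
  have p: "C1_L2 {0<..T} \<Omega> p p'" using e by (simp add: evolution_def)
  then have pc: "p \<in> C_L2 {0<..T} \<Omega>" by (simp add: has_C1_deriv_def)
  have "\<forall>\<^sub>F s in at t within {0<..T}. L2_norm \<Omega> (\<lambda>x. (p s x - p t x) / (s - t) - p' t x) < 1"
    using p t unfolding has_C1_deriv_def by (auto dest!: bspec[of _ _ t] tendstoD[of _ _ _ 1])
  moreover have "\<forall>\<^sub>F s in at t within {0<..T}. s \<in> {0<..T} \<and> s \<noteq> t" by (auto simp: eventually_at_filter)
  ultimately show ?thesis
  proof eventually_elim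
    case (elim s)
    let ?Q = "\<lambda>x. (p s x - p t x) / (s - t)"
    have d: "(\<lambda>x. p s x - p t x) \<in> L2_space \<Omega>" using C_timeD(1)[OF pc] elim(2) t by (auto intro: L2_space_diff)
    have "L2_norm \<Omega> ?Q \<le> L2_norm \<Omega> (p' t) + L2_norm \<Omega> (\<lambda>x. ?Q x - p' t x)"
      by (intro L2_norm_triangle_sub L2_space_divide d evolution_deriv_L2[OF e t])
    then have Q: "L2_norm \<Omega> ?Q \<le> B + 1" using elim(1) B by simp
    have "(\<lambda>x. p s x - p t x) = (\<lambda>x. (s - t) * ?Q x)" using elim(2) by auto
    then have "L2_norm \<Omega> (\<lambda>x. p s x - p t x) = L2_norm \<Omega> (\<lambda>x. (s - t) * ?Q x)" by (rule arg_cong)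
    also have "\<dots> = \<bar>s - t\<bar> * L2_norm \<Omega> ?Q" by (rule L2_norm_scale)
    also have "\<dots> \<le> \<bar>s - t\<bar> * (B + 1)" using Q by (intro mult_left_mono) auto
    finally have "lip_const * L2_norm \<Omega> (\<lambda>x. p s x - p t x) \<le> lip_const * (\<bar>s - t\<bar> * (B + 1))"
      using V_const_nonneg poincare_const_pos by (intro mult_left_mono) (auto simp: lip_const_def)
    then show ?case using elliptic_lipschitz[OF e _ t, of s] elim(2) by (auto simp: mult_ac)
  qed
qed

text \<open>A crude bound linear in time, valid from time 0 on and with any parameters. It serves
  for times before \<delta> and supplies the starting value at \<delta> for Gronwall's
  inequality.\<close>

lemma evolution_difference_growth:
  assumes e: "evolution T \<xi> u v u' v'" "evolution T \<xi>' p q p' q'"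
    and K: "\<And>t. t \<in> {0<..T} \<Longrightarrow> L2_norm \<Omega> (\<lambda>x. u t x - p t x) \<le> K"
      "\<And>t. t \<in> {0<..T} \<Longrightarrow> L2_norm \<Omega> (\<lambda>x. v t x - q t x) \<le> K"
    and init: "L2_norm \<Omega> (\<lambda>x. u 0 x - p 0 x) = 0" and t: "t \<in> {0<..T}"
  shows "(L2_norm \<Omega> (\<lambda>x. u t x - p t x))\<^sup>2 \<le> 2 / \<epsilon> * (K * K) * t"
proof -
  have K0: "K \<ge> 0" using K(1)[OF t] order_trans[OF L2_norm_nonneg] by auto
  have "(L2_norm \<Omega> (\<lambda>x. u t x - p t x))\<^sup>2 \<le> (L2_norm \<Omega> (\<lambda>x. u 0 x - p 0 x))\<^sup>2 + 2 / \<epsilon> * (K * K) * t"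
  proof (rule L2_norm_sq_growth[OF _ _ _ t])
    show "(\<lambda>t x. u t x - p t x) \<in> C_L2 {0..T} \<Omega>"
      using e by (intro C_time_L2_diff) (auto simp: evolution_def)
    show "C1_L2 {0<..T} \<Omega> (\<lambda>t x. u t x - p t x) (\<lambda>t x. u' t x - p' t x)"
      using e by (intro has_C1_deriv_L2_diff) (auto simp: evolution_def)
    fix s assume s: "s \<in> {0<..T}"
    have "2 / \<epsilon> * (L2_norm \<Omega> (\<lambda>x. u s x - p s x) * L2_norm \<Omega> (\<lambda>x. v s x - q s x)) \<le> 2 / \<epsilon> * (K * K)"
      using K[OF s] K0 \<epsilon>_pos by (intro mult_left_mono mult_mono) auto
    then show "2 * L2_ip \<Omega> (\<lambda>x. u' s x - p' s x) (\<lambda>x. u s x - p s x) \<le> 2 / \<epsilon> * (K * K)"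
      using evolution_difference_U(1)[OF e s] by linarith
  qed
  then show ?thesis using init by simp
qed

lemma evolution_difference_estimate:
  assumes \<xi>: "\<xi> > 0" and e: "evolution T \<xi> u v u' v'" "evolution T 0 p q p' q'"
    and K: "\<And>t. t \<in> {0<..T} \<Longrightarrow> L2_norm \<Omega> (\<lambda>x. u t x - p t x) \<le> K"
      "\<And>t. t \<in> {0<..T} \<Longrightarrow> L2_norm \<Omega> (\<lambda>x. v t x - q t x) \<le> K"
    and init: "L2_norm \<Omega> (\<lambda>x. u 0 x - p 0 x) = 0"
    and B: "\<And>t. t \<in> {\<delta>..T} \<Longrightarrow> L2_norm \<Omega> (p' t) \<le> B"
    and \<delta>: "\<delta> > 0" and t: "t \<in> {\<delta>..T}"
  shows "(L2_norm \<Omega> (\<lambda>x. u t x - p t x))\<^sup>2 + 1 / 4 * integral {\<delta>..t} (\<lambda>r. grad_sq \<Omega> (\<lambda>x. v r x - q r x))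
    \<le> exp ((U_const + V_const) * T) *
        (2 / \<epsilon> * (K * K) * \<delta> + \<xi> * (K\<^sup>2 / 2 + (1 + (2 * K * (lip_const * (B + 1)) + 1) / 2) * T))"
proof -
  let ?U = "\<lambda>r. L2_norm \<Omega> (\<lambda>x. u r x - p r x)" and ?V = "\<lambda>r. L2_norm \<Omega> (\<lambda>x. v r x - q r x)"
  let ?g = "\<lambda>r. grad_sq \<Omega> (\<lambda>x. v r x - q r x)" and ?C = "U_const + V_const"
  \<comment> \<open>The weight \<xi> / 2 matches the term with \<open>v'\<close> in the second
    equation, and it makes the unknown value of V at \<delta> harmless.\<close>
  let ?\<Psi> = "\<lambda>r. (?U r)\<^sup>2 + \<xi> / 2 * (?V r)\<^sup>2"
  let ?D = "2 * K * (lip_const * (B + 1)) + 1"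
  \<comment> \<open>Both contributions carry a factor \<xi>: \<xi> itself is the tolerance allowed
    in differentiating the first summand, and \<open>?D\<close> with the weight \<xi> / 2 comes from
    \<open>L2_norm_sq_dini\<close>.\<close>
  let ?\<kappa> = "\<xi> * (1 + ?D / 2)"
  have sub: "{\<delta>..t} \<subseteq> {0<..T}" using \<delta> t by auto
  have K0: "K \<ge> 0" using K(1)[of t] \<delta> t order_trans[OF L2_norm_nonneg] by auto
  have B0: "B \<ge> 0" using B[OF t] order_trans[OF L2_norm_nonneg] by auto
  have arith: "\<xi> * (1 + d / 2) * x = \<xi> * x + \<xi> / 2 * (d * x)" for d x by (simp add: field_simps)
  have lc: "lip_const \<ge> 0" using V_const_nonneg poincare_const_pos by (simp add: lip_const_def)
  have \<kappa>: "?\<kappa> \<ge> 0" using \<xi> K0 B0 lc by simp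
  have C: "?C \<ge> 0" using V_const_nonneg poincare_const_pos by (simp add: U_const_def)
  have U': "C1_L2 {0<..T} \<Omega> (\<lambda>t x. u t x - p t x) (\<lambda>t x. u' t x - p' t x)"
    using e by (intro has_C1_deriv_L2_diff) (auto simp: evolution_def)
  have v': "C1_L2 {0<..T} \<Omega> v v'" using e(1) \<xi> by (simp add: evolution_def)
  have q: "q \<in> C_L2 {0<..T} \<Omega>"
    using e(2) by (intro C_time_H2_L2) (simp add: evolution_def)
  have gc: "continuous_on {0<..T} ?g"
    using e by (intro C_time_H2_grad_diff_continuous open_domain) (auto simp: evolution_def)
  have "?\<Psi> t + integral {\<delta>..t} (\<lambda>r. 1 / 4 * ?g r) \<le> exp (?C * (t - \<delta>)) * (?\<Psi> \<delta> + ?\<kappa> * (t - \<delta>))"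
  proof (rule gronwall_dini[OF _ C \<kappa>])
    show "continuous_on {\<delta>..t} (\<lambda>r. 1 / 4 * ?g r)"
      by (intro continuous_intros continuous_on_subset[OF gc sub])
    fix r assume r: "r \<in> {\<delta>..t}"
    then have r': "r \<in> {0<..T}" using sub by auto
    let ?a = "2 * L2_ip \<Omega> (\<lambda>x. u' r x - p' r x) (\<lambda>x. u r x - p r x)"
      and ?b = "L2_ip \<Omega> (v' r) (\<lambda>x. v r x - q r x)"
    \<comment> \<open>The positive number \<xi> is used as tolerance so that this error, too,
      disappears in the limit.\<close>
    have "\<forall>\<^sub>F y in at r within {\<delta>..t}. \<bar>(?U y)\<^sup>2 - (?U r)\<^sup>2 - ?a * (y - r)\<bar> \<le> \<xi> * \<bar>y - r\<bar>"
      by (rule has_real_derivative_eventually[OF has_field_derivative_subset[OF L2_norm_sq_derivative[OF U' r'] sub] \<xi>])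
    moreover have "\<forall>\<^sub>F y in at r within {\<delta>..t}. \<bar>(?V y)\<^sup>2 - (?V r)\<^sup>2 - 2 * ?b * (y - r)\<bar> \<le> ?D * \<bar>y - r\<bar>"
    proof (rule filter_leD[OF at_le[OF sub] L2_norm_sq_dini[OF v' r' C_timeD(1)[OF q] _ K(2)]])
      show "\<forall>\<^sub>F s in at r within {0<..T}. L2_norm \<Omega> (\<lambda>x. q s x - q r x) \<le> lip_const * (B + 1) * \<bar>s - r\<bar>"
        by (rule elliptic_locally_lipschitz[OF e(2) r' B]) (use r t in auto)
    qed auto
    ultimately have "\<forall>\<^sub>F y in at r within {\<delta>..t}. \<bar>?\<Psi> y - ?\<Psi> r - (?a + \<xi> * ?b) * (y - r)\<bar> \<le> ?\<kappa> * \<bar>y - r\<bar>"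
    proof eventually_elim
      case (elim y)
      have eq: "?\<Psi> y - ?\<Psi> r - (?a + \<xi> * ?b) * (y - r)
          = ((?U y)\<^sup>2 - (?U r)\<^sup>2 - ?a * (y - r)) + \<xi> / 2 * ((?V y)\<^sup>2 - (?V r)\<^sup>2 - 2 * ?b * (y - r))"
        by (simp add: algebra_simps)
      have "\<bar>\<xi> / 2 * ((?V y)\<^sup>2 - (?V r)\<^sup>2 - 2 * ?b * (y - r))\<bar> \<le> \<xi> / 2 * (?D * \<bar>y - r\<bar>)"
        unfolding abs_mult using \<xi> elim(2) by (intro mult_mono) auto
      moreover have "?\<kappa> * \<bar>y - r\<bar> = \<xi> * \<bar>y - r\<bar> + \<xi> / 2 * (?D * \<bar>y - r\<bar>)"
        using arith[of "?D" "\<bar>y - r\<bar>"] .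
      ultimately show ?case unfolding eq using elim(1) by linarith
    qed
    moreover have "?a + \<xi> * ?b \<le> ?C * ?\<Psi> r - 1 / 4 * ?g r"
    proof -
      have "?a \<le> 1 / 4 * ?g r + U_const * (?U r)\<^sup>2" by (rule evolution_difference_U(2)[OF e r'])
      moreover have "\<xi> * ?b + 1 / 2 * ?g r \<le> V_const * (?U r)\<^sup>2" by (rule evolution_difference_V[OF e r'])
      moreover have "?C * (?U r)\<^sup>2 \<le> ?C * ?\<Psi> r" using C \<xi> by (intro mult_left_mono) auto
      ultimately show ?thesis by (simp add: distrib_right)
    qed
    ultimately show "\<exists>d\<le>?C * ?\<Psi> r - 1 / 4 * ?g r.
        \<forall>\<^sub>F y in at r within {\<delta>..t}. \<bar>?\<Psi> y - ?\<Psi> r - d * (y - r)\<bar> \<le> ?\<kappa> * \<bar>y - r\<bar>" by blast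
  qed (use t in auto)
  also have "\<dots> \<le> exp (?C * T) * (2 / \<epsilon> * (K * K) * \<delta> + \<xi> / 2 * K\<^sup>2 + ?\<kappa> * T)"
  proof (rule mult_mono)
    show "exp (?C * (t - \<delta>)) \<le> exp (?C * T)" using t \<delta> C by (simp add: mult_left_mono)
    have \<delta>': "\<delta> \<in> {0<..T}" using \<delta> t by auto
    have "(?U \<delta>)\<^sup>2 \<le> 2 / \<epsilon> * (K * K) * \<delta>" by (rule evolution_difference_growth[OF e K init \<delta>'])
    \<comment> \<open>This is the whole cost of the mismatch between the second components at the
      starting time.\<close>
    moreover have "\<xi> / 2 * (?V \<delta>)\<^sup>2 \<le> \<xi> / 2 * K\<^sup>2"
      using \<xi> K(2)[OF \<delta>'] by (intro mult_left_mono power_mono) auto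
    moreover have "?\<kappa> * (t - \<delta>) \<le> ?\<kappa> * T" using \<kappa> t \<delta> by (intro mult_left_mono) auto
    ultimately show "?\<Psi> \<delta> + ?\<kappa> * (t - \<delta>) \<le> 2 / \<epsilon> * (K * K) * \<delta> + \<xi> / 2 * K\<^sup>2 + ?\<kappa> * T" by linarith
    show "0 \<le> ?\<Psi> \<delta> + ?\<kappa> * (t - \<delta>)" using \<xi> mult_nonneg_nonneg[OF \<kappa>, of "t - \<delta>"] t by simp
  qed simp
  also have "2 / \<epsilon> * (K * K) * \<delta> + \<xi> / 2 * K\<^sup>2 + ?\<kappa> * T = 2 / \<epsilon> * (K * K) * \<delta> + \<xi> * (K\<^sup>2 / 2 + (1 + ?D / 2) * T)"
    by (simp add: algebra_simps)
  finally have "?\<Psi> t + 1 / 4 * integral {\<delta>..t} ?g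
      \<le> exp (?C * T) * (2 / \<epsilon> * (K * K) * \<delta> + \<xi> * (K\<^sup>2 / 2 + (1 + ?D / 2) * T))" by simp
  moreover have "0 \<le> \<xi> / 2 * (?V t)\<^sup>2" using \<xi> by simp
  ultimately show ?thesis by linarith
qed

end

section \<open>Slices of functions on the space-time cylinder\<close>

lemma Q_borel:
  assumes "open (\<Omega> :: 'a::euclidean_space set)"
  shows "Q \<Omega> T \<in> sets borel"
proof -
  have "\<Omega> \<times> {0<..T} \<in> sets (borel \<Otimes>\<^sub>M borel)" using assms by (intro pair_measureI) auto
  then show ?thesis unfolding Q_def borel_prod .
qed

text \<open>The space variable comes first in the product, while slices are taken at fixed time; the
  product is therefore swapped before Fubini's theorem for null sets is applied.\<close>

lemma AE_lborel_slices:
  fixes P :: "'a::euclidean_space \<times> real \<Rightarrow> bool"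
  assumes "AE p in lborel. P p"
  shows "AE t in lborel. AE x in lborel. P (x, t)"
proof -
  have "AE p in lborel \<Otimes>\<^sub>M lborel. P p"
    unfolding lborel_prod by (rule assms)
  then have "AE p in distr (lborel \<Otimes>\<^sub>M lborel) (lborel \<Otimes>\<^sub>M lborel) (\<lambda>(t :: real, x :: 'a). (x, t)). P p"
    by (subst (asm) lborel_pair.distr_pair_swap)
  then have "AE q in lborel \<Otimes>\<^sub>M lborel. P (case q of (t, x) \<Rightarrow> (x, t))"
    by (rule AE_distrD[OF measurable_pair_swap'])
  from lborel_pair.AE_pair[OF this] show ?thesis by simp
qed

lemma AE_slices:
  fixes P :: "'a::euclidean_space \<Rightarrow> real \<Rightarrow> bool"
  assumes \<Omega>: "open \<Omega>" and ae: "AE (x, t) in lebesgue_on (Q \<Omega> T). P x t"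
  shows "AE t in lborel. t \<in> {0<..T} \<longrightarrow> (AE x in lebesgue_on \<Omega>. P x t)"
proof -
  have "AE p in lebesgue. p \<in> Q \<Omega> T \<longrightarrow> (case p of (x, t) \<Rightarrow> P x t)"
    using ae Q_borel[OF \<Omega>, of T] by (simp add: AE_restrict_space_iff)
  then have "AE p in lborel. p \<in> Q \<Omega> T \<longrightarrow> (case p of (x, t) \<Rightarrow> P x t)" by (simp only: AE_completion_iff)
  from AE_lborel_slices[OF this] show ?thesis
  proof eventually_elim
    case (elim t)
    show ?case
    proof
      assume "t \<in> {0<..T}"
      with elim have "AE x in lborel. x \<in> \<Omega> \<longrightarrow> P x t" by (simp add: Q_def)
      then have "AE x in lebesgue. x \<in> \<Omega> \<longrightarrow> P x t" by (rule AE_completion)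
      then show "AE x in lebesgue_on \<Omega>. P x t" using \<Omega> by (simp add: AE_restrict_space_iff)
    qed
  qed
qed

text \<open>For a function measurable only after completion, Fubini's theorem is applied to a Borel
  representative. Its slices agree with those of f for almost every t, so a bound on the slices of f
  transfers.\<close>

lemma nn_integral_slices_le:
  fixes f :: "'a::euclidean_space \<times> real \<Rightarrow> ennreal"
  assumes f: "f \<in> borel_measurable lebesgue" and B: "\<And>t. (\<integral>\<^sup>+ x. f (x, t) \<partial>lebesgue) \<le> B t"
  shows "(\<integral>\<^sup>+ p. f p \<partial>lebesgue) \<le> (\<integral>\<^sup>+ t. B t \<partial>lborel)"
proof -
  obtain g where g: "g \<in> borel_measurable lborel" "AE p in lborel. f p = g p"
    using completion_ex_borel_measurable[OF f] by blast
  have "(\<integral>\<^sup>+ p. f p \<partial>lebesgue) = (\<integral>\<^sup>+ p. g p \<partial>lborel)"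
    unfolding nn_integral_completion by (rule nn_integral_cong_AE[OF g(2)])
  also have "\<dots> = (\<integral>\<^sup>+ t. (\<integral>\<^sup>+ x. g (x, t) \<partial>lborel) \<partial>lborel)"
    using lborel_pair.nn_integral_snd[of g] g(1) by (simp add: lborel_prod)
  also have "\<dots> \<le> (\<integral>\<^sup>+ t. B t \<partial>lborel)"
  proof (rule nn_integral_mono_AE)
    show "AE t in lborel. (\<integral>\<^sup>+ x. g (x, t) \<partial>lborel) \<le> B t"
      using AE_lborel_slices[OF g(2)]
    proof eventually_elim
      case (elim t)
      have "(\<integral>\<^sup>+ x. g (x, t) \<partial>lborel) = (\<integral>\<^sup>+ x. f (x, t) \<partial>lborel)"
        by (rule nn_integral_cong_AE) (use elim in eventually_elim, simp)
      then show ?case using B[of t] by (simp add: nn_integral_completion)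
    qed
  qed
  finally show ?thesis .
qed

lemma L2_Q_bound:
  fixes \<Omega> :: "'a::euclidean_space set"
  assumes \<Omega>: "open \<Omega>" and T: "T \<ge> 0" and B: "B \<ge> 0" and m: "jointly_measurable \<Omega> T w"
    and w: "\<And>t. t \<in> {0<..T} \<Longrightarrow> w t \<in> L2_space \<Omega>" "\<And>t. t \<in> {0<..T} \<Longrightarrow> (L2_norm \<Omega> (w t))\<^sup>2 \<le> B"
  shows "(\<lambda>(x, t). w t x) \<in> L2_space (Q \<Omega> T)" "(L2_norm (Q \<Omega> T) (\<lambda>(x, t). w t x))\<^sup>2 \<le> B * T"
proof -
  let ?W = "\<lambda>(x, t). w t x"
  have Q: "Q \<Omega> T \<inter> space lebesgue \<in> sets lebesgue" using Q_borel[OF \<Omega>] by simp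
  have O: "\<Omega> \<inter> space lebesgue \<in> sets lebesgue" using \<Omega> by simp
  have Wm: "?W \<in> borel_measurable (lebesgue_on (Q \<Omega> T))" using m by (simp add: jointly_measurable_def)
  define f where "f p = ennreal ((?W p)\<^sup>2) * indicator (Q \<Omega> T) p" for p
  have W2m: "(\<lambda>p. (?W p)\<^sup>2) \<in> borel_measurable (lebesgue_on (Q \<Omega> T))"
    by (rule borel_measurable_power[OF Wm])
  have fm: "f \<in> borel_measurable lebesgue"
    unfolding f_def[abs_def]
    using borel_measurable_restrict_space_iff_ennreal[OF Q, of "\<lambda>p. ennreal ((?W p)\<^sup>2)"] W2m by simp
  have "(\<integral>\<^sup>+ p. ennreal ((?W p)\<^sup>2) \<partial>lebesgue_on (Q \<Omega> T)) = (\<integral>\<^sup>+ p. f p \<partial>lebesgue)"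
    unfolding f_def by (rule nn_integral_restrict_space[OF Q])
  also have "\<dots> \<le> (\<integral>\<^sup>+ t. ennreal B * indicator {0<..T} t \<partial>lborel)"
  proof (rule nn_integral_slices_le[OF fm])
    fix t
    show "(\<integral>\<^sup>+ x. f (x, t) \<partial>lebesgue) \<le> ennreal B * indicator {0<..T} t"
    proof (cases "t \<in> {0<..T}")
      case True
      have "(\<integral>\<^sup>+ x. f (x, t) \<partial>lebesgue) = (\<integral>\<^sup>+ x. ennreal ((w t x)\<^sup>2) * indicator \<Omega> x \<partial>lebesgue)"
        using True by (intro nn_integral_cong) (auto simp: f_def Q_def indicator_def)
      also have "\<dots> = (\<integral>\<^sup>+ x. ennreal ((w t x)\<^sup>2) \<partial>lebesgue_on \<Omega>)"
        by (rule nn_integral_restrict_space[OF O, symmetric])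
      also have "\<dots> = ennreal ((L2_norm \<Omega> (w t))\<^sup>2)"
        using w(1)[OF True] by (subst nn_integral_eq_integral) (auto simp: L2_space_def L2_norm_def)
      finally show ?thesis using True w(2)[OF True] by (simp add: ennreal_leI)
    next
      case False
      then have "f (x, t) = 0" for x by (auto simp: f_def Q_def)
      then show ?thesis by simp
    qed
  qed
  also have "\<dots> = ennreal (B * T)"
    using T B by (simp add: nn_integral_cmult ennreal_mult)
  finally have le: "(\<integral>\<^sup>+ p. ennreal ((?W p)\<^sup>2) \<partial>lebesgue_on (Q \<Omega> T)) \<le> ennreal (B * T)" .
  have int: "integrable (lebesgue_on (Q \<Omega> T)) (\<lambda>p. (?W p)\<^sup>2)"
    by (rule integrableI_nonneg[OF W2m]) (use le_less_trans[OF le ennreal_less_top] in auto)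
  then show "?W \<in> L2_space (Q \<Omega> T)" using Wm by (rule L2_spaceI[rotated])
  have "ennreal ((L2_norm (Q \<Omega> T) ?W)\<^sup>2) = (\<integral>\<^sup>+ p. ennreal ((?W p)\<^sup>2) \<partial>lebesgue_on (Q \<Omega> T))"
    using int by (subst nn_integral_eq_integral) (auto simp: L2_norm_def)
  then have "ennreal ((L2_norm (Q \<Omega> T) ?W)\<^sup>2) \<le> ennreal (B * T)" using le by (simp only:)
  then show "(L2_norm (Q \<Omega> T) ?W)\<^sup>2 \<le> B * T"
    by (rule ennreal_le_iff[THEN iffD1, rotated]) (use B T in simp)
qed

text \<open>The bound is known for almost every time only. Every interval to the left of t has
  positive measure and so contains a good time; good times approaching t hand the bound on through
  convergence in L2.\<close>

lemma bounded_slices: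
  fixes w :: "real \<Rightarrow> 'a::euclidean_space \<Rightarrow> real"
  assumes w: "w \<in> C_L2 {0<..T} \<Omega>"
    and ae: "AE t in lborel. t \<in> {0<..T} \<longrightarrow> (AE x in lebesgue_on \<Omega>. \<bar>w t x\<bar> \<le> M)"
    and t: "t \<in> {0<..T}"
  shows "AE x in lebesgue_on \<Omega>. \<bar>w t x\<bar> \<le> M"
proof -
  \<comment> \<open>The interval lies to the left because t may equal T; the denominator n + 2 keeps
    its left end positive even for n = 0.\<close>
  have "\<exists>s. t - t / real (Suc (Suc n)) < s \<and> s < t \<and> (AE x in lebesgue_on \<Omega>. \<bar>w s x\<bar> \<le> M)" for n
  proof (rule ccontr)
    let ?a = "t - t / real (Suc (Suc n))"
    assume none: "\<not> ?thesis"
    have a: "0 < ?a" "?a < t" using t by (auto simp: field_simps add_pos_nonneg)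
    have "AE s in lborel. s \<notin> {?a<..<t}"
      using ae by eventually_elim (use none a t in auto)
    then have "{?a<..<t} \<in> null_sets lborel" by (subst (asm) AE_iff_null_sets[symmetric]) auto
    then have "emeasure lborel {?a<..<t} = 0" by auto
    then show False using a(2) by (simp del: of_nat_Suc)
  qed
  then obtain s where s: "\<And>n. t - t / real (Suc (Suc n)) < s n" "\<And>n. s n < t"
    "\<And>n. AE x in lebesgue_on \<Omega>. \<bar>w (s n) x\<bar> \<le> M" by metis
  have sI: "s n \<in> {0<..T}" for n
  proof -
    have "0 < t - t / real (Suc (Suc n))" using t by (auto simp: field_simps add_pos_nonneg)
    then show ?thesis using s(1,2)[of n] t by auto
  qed
  have "(\<lambda>n. t - t * inverse (real (Suc (Suc n)))) \<longlonglongrightarrow> t - t * 0"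
    by (intro tendsto_intros LIMSEQ_Suc[OF LIMSEQ_inverse_real_of_nat])
  then have lower: "(\<lambda>n. t - t / real (Suc (Suc n))) \<longlonglongrightarrow> t" by (simp add: divide_inverse del: of_nat_Suc)
  have "s \<longlonglongrightarrow> t"
    by (rule tendsto_sandwich[OF _ _ lower tendsto_const])
      (use s(1,2) in \<open>auto intro!: always_eventually less_imp_le simp del: of_nat_Suc\<close>)
  then have "filterlim s (at t within {0<..T}) sequentially"
    unfolding filterlim_at using sI s(2) by (auto intro!: always_eventually simp: less_imp_neq)
  from filterlim_compose[OF C_timeD(2)[OF w t] this]
  have "(\<lambda>n. L2_norm \<Omega> (\<lambda>x. w (s n) x - w t x)) \<longlonglongrightarrow> 0" .
  then show ?thesis
    by (rule L2_limit_AE_bounded) (use C_timeD(1)[OF w] sI s(3) t in \<open>auto intro!: always_eventually\<close>)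
qed

section \<open>Bochner spaces\<close>

text \<open>Continuity is available only away from 0, where f may blow up. The integrals over
  truncated intervals are bounded and increase, so monotone convergence gives integrability up to
  0.\<close>

lemma integrable_open_interval:
  fixes f :: "real \<Rightarrow> real"
  assumes T: "T > 0" and f: "continuous_on {0<..T} f" "\<And>t. t \<in> {0<..T} \<Longrightarrow> f t \<ge> 0"
    and B: "\<And>s. 0 < s \<Longrightarrow> s < T \<Longrightarrow> integral {s..T} f \<le> B"
  shows "integrable (lebesgue_on {0<..<T}) f" "integral\<^sup>L (lebesgue_on {0<..<T}) f \<le> B"
proof -
  \<comment> \<open>The shift to n + 2 places \<open>a n\<close> strictly between 0 and T from n = 0
    on.\<close>
  define a where "a n = T / real (Suc (Suc n))" for n
  have a: "0 < a n" "a n < T" for n using T by (auto simp: a_def field_simps add_pos_nonneg)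
  define F where "F n t = (if t \<in> {a n..<T} then f t else 0)" for n t
  have fi: "integrable (lebesgue_on {a n..T}) f" for n
    using a[of n] by (intro continuous_imp_integrable_real continuous_on_subset[OF f(1)]) auto
  have "set_integrable lebesgue {a n..T} f" for n
    using fi[of n] by (simp add: set_integrable_def integrable_restrict_space)
  then have "set_integrable lebesgue {a n..<T} f" for n
    by (rule set_integrable_subset) auto
  then have fi': "integrable (lebesgue_on {a n..<T}) f" for n
    by (simp add: set_integrable_def integrable_restrict_space)
  have "(\<lambda>t. if t \<in> {0<..<T} then F n t else 0) = (\<lambda>t. if t \<in> {a n..<T} then f t else 0)" for n
    using a(1)[of n] by (auto simp: F_def fun_eq_iff)
  then have Fi: "integrable (lebesgue_on {0<..<T}) (F n)" for n
    using fi'[of n] by (simp add: Lebesgue_Measure.integrable_restrict_UNIV[symmetric])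
  have FB: "integral\<^sup>L (lebesgue_on {0<..<T}) (F n) \<le> B" for n
  proof -
    have "integral\<^sup>L (lebesgue_on {0<..<T}) (F n) = integral\<^sup>L (lebesgue_on {a n..<T}) f"
      unfolding F_def[abs_def] using a(1)[of n] by (intro Lebesgue_Measure.integral_restrict) auto
    also have "\<dots> = integral {a n..<T} f" by (rule lebesgue_integral_eq_integral[OF fi']) simp
    also have "\<dots> = integral {a n..T} f"
    proof (rule integral_spike_set)
      have "{x \<in> {a n..<T} - {a n..T}. f x \<noteq> 0} = {}" by auto
      then show "negligible {x \<in> {a n..<T} - {a n..T}. f x \<noteq> 0}" by (metis negligible_empty)
      show "negligible {x \<in> {a n..T} - {a n..<T}. f x \<noteq> 0}"
        by (rule negligible_subset[of "{T}"]) auto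
    qed
    also have "\<dots> \<le> B" using a by (intro B)
    finally show ?thesis .
  qed
  have mono: "mono (\<lambda>n. F n t)" if "t \<in> {0<..<T}" for t
  proof (rule monoI)
    fix m n :: nat assume "m \<le> n"
    then have "a n \<le> a m" using T by (auto simp: a_def intro!: divide_left_mono)
    then show "F m t \<le> F n t" using that f(2)[of t] by (auto simp: F_def)
  qed
  have lim: "(\<lambda>n. F n t) \<longlonglongrightarrow> f t" if t: "t \<in> {0<..<T}" for t
  proof (rule tendsto_eventually)
    have "(\<lambda>n. T * inverse (real (Suc (Suc n)))) \<longlonglongrightarrow> T * 0"
      by (intro tendsto_intros LIMSEQ_Suc[OF LIMSEQ_inverse_real_of_nat])
    then have "a \<longlonglongrightarrow> 0" by (simp add: a_def[abs_def] divide_inverse del: of_nat_Suc)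
    then have "\<forall>\<^sub>F n in sequentially. a n < t" using t by (intro order_tendstoD) auto
    then show "\<forall>\<^sub>F n in sequentially. F n t = f t" by eventually_elim (use t in \<open>simp add: F_def\<close>)
  qed
  have incI: "incseq (\<lambda>n. integral\<^sup>L (lebesgue_on {0<..<T}) (F n))"
    by (rule incseq_SucI, rule integral_mono[OF Fi Fi], rule monoD[OF mono]) auto
  obtain l where l: "(\<lambda>n. integral\<^sup>L (lebesgue_on {0<..<T}) (F n)) \<longlonglongrightarrow> l" "\<And>n. integral\<^sup>L (lebesgue_on {0<..<T}) (F n) \<le> l"
    using incseq_convergent[OF incI, of B] FB by blast
  have fm: "f \<in> borel_measurable (lebesgue_on {0<..<T})"
    by (rule continuous_imp_measurable_on_sets_lebesgue[OF continuous_on_subset[OF f(1)]]) auto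
  have conv: "integrable (lebesgue_on {0<..<T}) f \<and> integral\<^sup>L (lebesgue_on {0<..<T}) f = l"
  proof (intro conjI)
    have 1: "AE t in lebesgue_on {0<..<T}. mono (\<lambda>n. F n t)" using mono by (intro AE_I2) auto
    have 2: "AE t in lebesgue_on {0<..<T}. 0 \<le> F n t" for n using f(2) by (intro AE_I2) (auto simp: F_def)
    have 3: "AE t in lebesgue_on {0<..<T}. (\<lambda>n. F n t) \<longlonglongrightarrow> f t" using lim by (intro AE_I2) auto
    show "integrable (lebesgue_on {0<..<T}) f" by (rule integral_monotone_convergence_nonneg(1)[OF Fi 1 2 3 l(1) fm])
    show "integral\<^sup>L (lebesgue_on {0<..<T}) f = l" by (rule integral_monotone_convergence_nonneg(2)[OF Fi 1 2 3 l(1) fm])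
  qed
  then show "integrable (lebesgue_on {0<..<T}) f" by simp
  have "l \<le> B" by (rule LIMSEQ_le_const2[OF l(1)]) (use FB in auto)
  then show "integral\<^sup>L (lebesgue_on {0<..<T}) f \<le> B" using conv by simp
qed

lemma H1_norm_le_H2_norm: "H1_norm \<Omega> f \<le> H2_norm \<Omega> f"
  unfolding H1_norm_def H2_norm_def
  by (intro real_sqrt_le_mono add_left_mono sum_mono) (simp add: H1_norm_sq[unfolded H1_norm_def] H1_norm_sq)

text \<open>The weak derivative of the zero function is a chosen representative and vanishes only
  almost everywhere, so additivity of weak derivatives is needed.\<close>

lemma H1_norm_diff_self:
  assumes "open \<Omega>" "f \<in> H1_space \<Omega>"
  shows "H1_norm \<Omega> (\<lambda>x. f x - f x) = 0"
proof -
  have "grad_sq \<Omega> (\<lambda>x. f x - f x) = (\<Sum>b\<in>Basis. (L2_norm \<Omega> (\<lambda>x. weak_deriv \<Omega> b f x - weak_deriv \<Omega> b f x))\<^sup>2)"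
    unfolding grad_sq_def by (intro sum.cong refl arg_cong[where f="\<lambda>r. r\<^sup>2"] L2_norm_weak_deriv_diff assms)
  then have "(H1_norm \<Omega> (\<lambda>x. f x - f x))\<^sup>2 = 0" unfolding H1_norm_sq by simp
  then show ?thesis by simp
qed

text \<open>The approximating step functions take the values of \<open>w\<close> at the points \<open>k T / (n + 1)\<close>.\<close>

lemma strongly_measurable_C_time:
  fixes \<Omega> :: "'a::euclidean_space set"
  assumes \<Omega>: "open \<Omega>" and T: "T > 0" and w: "w \<in> C_H2 {0<..T} \<Omega>"
  shows "strongly_measurable_time T (H10_space \<Omega>) (H1_norm \<Omega>) w"
proof -
  \<comment> \<open>Rounding up makes the sampled times positive and at most T; rounding down could
    produce time 0, where w is not controlled.\<close>
  define k where "k n t = \<lceil>real (Suc n) * t / T\<rceil>" for n and t :: real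
  define s where "s n t = w (T * real_of_int (k n t) / real (Suc n))" for n and t :: real
  have bounds: "t \<le> T * real_of_int (k n t) / real (Suc n)" "T * real_of_int (k n t) / real (Suc n) \<le> t + T / real (Suc n)"
    "1 \<le> k n t" "k n t \<le> int (Suc n)" if t: "t \<in> {0<..<T}" for n t
  proof -
    let ?r = "real (Suc n) * t / T"
    have "?r < real (Suc n) * T / T" using t T by (intro divide_strict_right_mono mult_strict_left_mono) auto
    then have r: "0 < ?r" "?r < real (Suc n)" using t T by (auto simp del: of_nat_Suc)
    have c: "?r \<le> real_of_int (k n t)" "real_of_int (k n t) \<le> ?r + 1" by (auto simp: k_def)
    then show "t \<le> T * real_of_int (k n t) / real (Suc n)" "T * real_of_int (k n t) / real (Suc n) \<le> t + T / real (Suc n)"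
      using T by (auto simp: field_simps simp del: of_nat_Suc)
    show "1 \<le> k n t" using c(1) r(1) by linarith
    show "k n t \<le> int (Suc n)" unfolding k_def using r(2) by (simp add: ceiling_le_iff del: of_nat_Suc)
  qed
  have mem: "T * real_of_int j / real (Suc n) \<in> {0<..T}" if "1 \<le> j" "j \<le> int (Suc n)" for j n
  proof -
    have "real_of_int j \<le> real (Suc n)" using that(2) by (metis of_int_le_iff of_int_of_nat_eq)
    then show ?thesis using T that(1) by (auto simp: field_simps simp del: of_nat_Suc)
  qed
  have H1: "w t \<in> H1_space \<Omega>" if "t \<in> {0<..T}" for t using C_timeD(1)[OF w that] by (auto intro: H10_H1)
  show ?thesis
    unfolding strongly_measurable_time_def
  proof (intro exI[of _ s] conjI allI)
    fix n
    have sub: "s n ` {0<..<T} \<subseteq> (\<lambda>j. w (T * real_of_int j / real (Suc n))) ` {1..int (Suc n)}"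
      using bounds(3,4) unfolding s_def by (intro image_subsetI image_eqI[OF refl]) auto
    have "w (T * real_of_int j / real (Suc n)) \<in> H10_space \<Omega>" if "j \<in> {1..int (Suc n)}" for j
    proof -
      have "1 \<le> j" "j \<le> int (Suc n)" using that by simp_all
      from C_timeD(1)[OF w mem[OF this]] show ?thesis by (rule IntD1)
    qed
    then show "s n ` {0<..<T} \<subseteq> H10_space \<Omega>"
      by (intro order_trans[OF sub] image_subsetI)
    show "finite (s n ` {0<..<T})" by (rule finite_subset[OF sub]) simp
    show "{t \<in> {0<..<T}. s n t = f} \<in> sets lebesgue" for f
    proof -
      have "k n \<in> measurable borel (count_space UNIV)"
        unfolding k_def[abs_def] by measurable
      then have "k n -` {j. w (T * real_of_int j / real (Suc n)) = f} \<inter> space borel \<in> sets borel"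
        by (rule measurable_sets) simp
      then have "(k n -` {j. w (T * real_of_int j / real (Suc n)) = f}) \<inter> {0<..<T} \<in> sets borel" by auto
      moreover have "(k n -` {j. w (T * real_of_int j / real (Suc n)) = f}) \<inter> {0<..<T} = {t \<in> {0<..<T}. s n t = f}"
        by (auto simp: s_def)
      ultimately show ?thesis by auto
    qed
  next
    have "(\<lambda>n. H1_norm \<Omega> (\<lambda>x. s n t x - w t x)) \<longlonglongrightarrow> 0" if t: "t \<in> {0<..<T}" for t
    proof -
      have t': "t \<in> {0<..T}" using t by auto
      have "((\<lambda>r. H1_norm \<Omega> (\<lambda>x. w r x - w t x)) \<longlongrightarrow> 0) (at t within {0<..T})"
        by (rule Lim_null_comparison[OF _ C_timeD(2)[OF w t']]) (auto intro: always_eventually H1_norm_le_H2_norm)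
      \<comment> \<open>A sampled time may coincide with t, so the value at t has to be included; a
        limit over s different from t would not suffice.\<close>
      then have c: "continuous (at t within {0<..T}) (\<lambda>r. H1_norm \<Omega> (\<lambda>x. w r x - w t x))"
        using H1_norm_diff_self[OF \<Omega> H1[OF t']] by (simp add: continuous_within)
      have "(\<lambda>n. t + T * inverse (real (Suc n))) \<longlonglongrightarrow> t + T * 0"
        by (intro tendsto_intros LIMSEQ_inverse_real_of_nat)
      then have upper: "(\<lambda>n. t + T / real (Suc n)) \<longlonglongrightarrow> t" by (simp add: divide_inverse del: of_nat_Suc)
      have "(\<lambda>n. T * real_of_int (k n t) / real (Suc n)) \<longlonglongrightarrow> t"
        by (rule tendsto_sandwich[OF _ _ tendsto_const upper]) (use bounds(1,2)[OF t] in \<open>auto intro!: always_eventually simp del: of_nat_Suc\<close>)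
      from continuous_within_tendsto_compose[OF c _ this]
      have "(\<lambda>n. H1_norm \<Omega> (\<lambda>x. w (T * real_of_int (k n t) / real (Suc n)) x - w t x)) \<longlonglongrightarrow> H1_norm \<Omega> (\<lambda>x. w t x - w t x)"
        using mem bounds(3,4)[OF t] by (auto intro!: always_eventually simp del: of_nat_Suc)
      then show ?thesis using H1_norm_diff_self[OF \<Omega> H1[OF t']] by (simp add: s_def)
    qed
    then show "AE t in lebesgue_on {0<..<T}. (\<lambda>n. H1_norm \<Omega> (\<lambda>x. s n t x - w t x)) \<longlonglongrightarrow> 0"
      by (intro AE_I2) auto
  qed
qed

text \<open>The order of the limits: A is fixed before \<delta>, whereas B may depend on \<delta>.
  First \<delta> makes the first term small, then \<xi> the second.\<close>

lemma tendsto_zero_at_right: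
  fixes f :: "real \<Rightarrow> real"
  assumes T: "T > 0" and A: "A \<ge> 0" and f: "\<And>\<xi>. \<xi> > 0 \<Longrightarrow> f \<xi> \<ge> 0"
    and B: "\<And>\<delta>. 0 < \<delta> \<Longrightarrow> \<delta> < T \<Longrightarrow> \<exists>B. \<forall>\<xi>>0. f \<xi> \<le> A * \<delta> + B * \<xi>"
  shows "(f \<longlongrightarrow> 0) (at_right 0)"
proof (rule tendstoI)
  fix e :: real assume e: "e > 0"
  \<comment> \<open>The denominator contains A + 1 since A may be zero.\<close>
  define \<delta> where "\<delta> = min (T / 2) (e / (2 * (A + 1)))"
  have \<delta>: "0 < \<delta>" "\<delta> < T" using T A e by (auto simp: \<delta>_def)
  have "A * \<delta> \<le> A * (e / (2 * (A + 1)))" using A by (intro mult_left_mono) (auto simp: \<delta>_def)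
  also have "\<dots> < e" using A e by (simp add: field_simps add_nonneg_pos)
  finally have Ad: "A * \<delta> < e" .
  obtain B where B: "\<And>\<xi>. \<xi> > 0 \<Longrightarrow> f \<xi> \<le> A * \<delta> + B * \<xi>" using assms(4)[OF \<delta>] by auto
  have "((\<lambda>\<xi>. A * \<delta> + B * \<xi>) \<longlongrightarrow> A * \<delta> + B * 0) (at_right 0)" by (intro tendsto_intros)
  then have "\<forall>\<^sub>F \<xi> in at_right 0. A * \<delta> + B * \<xi> < e" using Ad by (intro order_tendstoD) auto
  moreover have "\<forall>\<^sub>F \<xi> in at_right (0::real). \<xi> > 0" by (simp add: eventually_at_right_less)
  ultimately show "\<forall>\<^sub>F \<xi> in at_right 0. dist (f \<xi>) 0 < e"
  proof eventually_elim
    case (elim \<xi>)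
    then show ?case using B[of \<xi>] f[of \<xi>] by (simp add: dist_real_def)
  qed
qed

section \<open>Convergence\<close>

lemma C_time_L2_scale:
  assumes "w \<in> C_L2 I \<Omega>"
  shows "(\<lambda>t x. c * w t x) \<in> C_L2 I \<Omega>"
  unfolding C_time_def mem_Collect_eq
proof (intro conjI ballI)
  fix t assume t: "t \<in> I"
  show "(\<lambda>x. c * w t x) \<in> L2_space \<Omega>" using C_timeD(1)[OF assms t] by (rule L2_space_scale)
  have "((\<lambda>s. \<bar>c\<bar> * L2_norm \<Omega> (\<lambda>x. w s x - w t x)) \<longlongrightarrow> \<bar>c\<bar> * 0) (at t within I)"
    by (intro tendsto_mult tendsto_const C_timeD(2)[OF assms t])
  then show "((\<lambda>s. L2_norm \<Omega> (\<lambda>x. c * w s x - c * w t x)) \<longlongrightarrow> 0) (at t within I)"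
    by (simp add: L2_norm_scale right_diff_distrib[symmetric])
qed

context reaction_diffusion
begin

lemma strong_solution_evolution:
  assumes T: "T > 0" and \<xi>: "\<xi> \<ge> 0" and sol: "strong_solution \<Omega> T \<alpha> \<mu> u0 v0 \<epsilon> \<xi> u v"
    and z: "AE (x, t) in lebesgue_on (Q \<Omega> T). \<mu> * u t x + v t x \<in> {-M..M}"
  obtains u' v' where "evolution T \<xi> u v u' v'"
proof -
  obtain u' v' where u: "evolution_regularity \<Omega> T u u'"
    and v: "if \<xi> > 0 then evolution_regularity \<Omega> T v v'
         else v \<in> C_H2 {0..T} \<Omega>"
    and eu: "\<forall>t\<in>{0<..T}. AE x in lebesgue_on \<Omega>. 1 / \<mu> * u' t x =
             weak_laplacian \<Omega> (u t) x - 1 / \<epsilon> * (u t x - \<alpha> (\<mu> * u t x + v t x))"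
    and ev: "\<forall>t\<in>{0<..T}. AE x in lebesgue_on \<Omega>. \<xi> * v' t x =
             weak_laplacian \<Omega> (v t) x + \<mu> / \<epsilon> * (u t x - \<alpha> (\<mu> * u t x + v t x))"
    using sol unfolding strong_solution_def by blast
  have uH: "u \<in> C_H2 {0<..T} \<Omega>"
    using u by (simp add: evolution_regularity_def)
  have vH: "v \<in> C_H2 {0<..T} \<Omega>"
  proof (cases "\<xi> > 0")
    case False
    then show ?thesis using v by (auto intro: C_time_subset[of _ "{0..T}"])
  qed (use v in \<open>simp add: evolution_regularity_def\<close>)
  \<comment> \<open>The sum \<mu> u + v is written as a difference to fit the closure lemmas. Its
    continuity in L2 is what transfers the almost everywhere bound on the cylinder to every
    time.\<close>
  have "(\<lambda>t x. v t x - - \<mu> * u t x) \<in> C_L2 {0<..T} \<Omega>"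
    by (intro C_time_L2_diff C_time_L2_scale C_time_H2_L2[OF uH] C_time_H2_L2[OF vH])
  then have zc: "(\<lambda>t x. \<mu> * u t x + v t x) \<in> C_L2 {0<..T} \<Omega>"
    by (simp add: add.commute)
  have "AE (x, t) in lebesgue_on (Q \<Omega> T). \<bar>\<mu> * u t x + v t x\<bar> \<le> M"
    using z by eventually_elim (auto simp: abs_le_iff)
  from bounded_slices[OF zc AE_slices[OF open_domain this]]
  have ad: "admissible (u t) (v t)" if "t \<in> {0<..T}" for t
    using C_timeD(1)[OF uH that] C_timeD(1)[OF vH that] that by (auto simp: admissible_def)
  \<comment> \<open>For \<xi> = 0 the given \<open>v'\<close> is arbitrary and need not be square
    integrable; zero replaces it without changing the product with \<xi>.\<close>
  define w where "w = (if \<xi> > 0 then v' else (\<lambda>t x. 0))"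
  have w: "\<xi> * w t x = \<xi> * v' t x" for t x using \<xi> by (auto simp: w_def)
  have wL: "w t \<in> L2_space \<Omega>" if "t \<in> {0<..T}" for t
    using v C_timeD(1)[OF _ that, of v' "L2_space \<Omega>" "L2_norm \<Omega>"]
    by (cases "\<xi> > 0") (auto simp: w_def evolution_regularity_def has_C1_deriv_def L2_space_zero)
  have "evolution T \<xi> u v u' w"
    unfolding evolution_def w reaction_def
    using u v eu ev ad vH wL by (auto simp: evolution_regularity_def w_def)
  then show ?thesis by (rule that)
qed

lemma H1_norm_le_grad:
  assumes "f \<in> H10_space \<Omega>"
  shows "(H1_norm \<Omega> f)\<^sup>2 \<le> (1 + poincare_const) * grad_sq \<Omega> f"
  using poincare[OF assms] by (simp add: H1_norm_sq distrib_right)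

lemma H1_norm_time_integral:
  fixes T :: real
  assumes T: "T > 0" and w: "\<And>t. t \<in> {0<..T} \<Longrightarrow> w t \<in> H10_space \<Omega>"
    and c: "continuous_on {0<..T} (\<lambda>t. L2_norm \<Omega> (w t))" "continuous_on {0<..T} (\<lambda>t. grad_sq \<Omega> (w t))"
    and B: "\<And>s. 0 < s \<Longrightarrow> s < T \<Longrightarrow> integral {s..T} (\<lambda>t. grad_sq \<Omega> (w t)) \<le> B"
  shows "integrable (lebesgue_on {0<..<T}) (\<lambda>t. (H1_norm \<Omega> (w t))\<^sup>2)"
    "integral\<^sup>L (lebesgue_on {0<..<T}) (\<lambda>t. (H1_norm \<Omega> (w t))\<^sup>2) \<le> (1 + poincare_const) * B"
proof -
  have cH: "continuous_on {0<..T} (\<lambda>t. (H1_norm \<Omega> (w t))\<^sup>2)"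
    unfolding H1_norm_sq by (intro continuous_intros c)
  have I: "integral {s..T} (\<lambda>t. (H1_norm \<Omega> (w t))\<^sup>2) \<le> (1 + poincare_const) * B" if s: "0 < s" "s < T" for s
  proof -
    have sub: "{s..T} \<subseteq> {0<..T}" using s by auto
    have "integral {s..T} (\<lambda>t. (H1_norm \<Omega> (w t))\<^sup>2) \<le> integral {s..T} (\<lambda>t. (1 + poincare_const) * grad_sq \<Omega> (w t))"
    proof (rule integral_le)
      show "(\<lambda>t. (H1_norm \<Omega> (w t))\<^sup>2) integrable_on {s..T}"
        by (rule integrable_continuous_real[OF continuous_on_subset[OF cH sub]])
      show "(\<lambda>t. (1 + poincare_const) * grad_sq \<Omega> (w t)) integrable_on {s..T}"
        by (intro integrable_continuous_real continuous_intros continuous_on_subset[OF c(2) sub])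
      show "(H1_norm \<Omega> (w t))\<^sup>2 \<le> (1 + poincare_const) * grad_sq \<Omega> (w t)" if "t \<in> {s..T}" for t
        using that sub by (intro H1_norm_le_grad w) auto
    qed
    also have "\<dots> = (1 + poincare_const) * integral {s..T} (\<lambda>t. grad_sq \<Omega> (w t))" by simp
    also have "\<dots> \<le> (1 + poincare_const) * B"
      using B[OF s] poincare_const_pos by (intro mult_left_mono) auto
    finally show ?thesis .
  qed
  show "integrable (lebesgue_on {0<..<T}) (\<lambda>t. (H1_norm \<Omega> (w t))\<^sup>2)"
    "integral\<^sup>L (lebesgue_on {0<..<T}) (\<lambda>t. (H1_norm \<Omega> (w t))\<^sup>2) \<le> (1 + poincare_const) * B"
    by (rule integrable_open_interval[OF T cH _ I]; simp)+
qed

lemma evolution_H10: "evolution T \<xi> u v u' v' \<Longrightarrow> t \<in> {0<..T} \<Longrightarrow> v t \<in> H10_space \<Omega>"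
  by (simp add: evolution_def admissible_def)

lemma evolution_L2_time_space:
  assumes e: "evolution T \<xi> u v u' v'" and T: "T > 0" and \<xi>: "\<xi> \<ge> 0"
  shows "v \<in> L2_time_space T (H10_space \<Omega>) (H1_norm \<Omega>)"
proof -
  have v: "v \<in> C_H2 {0<..T} \<Omega>" using e by (simp add: evolution_def)
  define K where "K = size_bound T (L2_norm \<Omega> (u 0))"
  have K: "L2_norm \<Omega> (u t) \<le> K" "L2_norm \<Omega> (v t) \<le> K" if "t \<in> {0<..T}" for t
    unfolding K_def by (rule evolution_size[OF e that])+
  have K0: "K \<ge> 0" using K(1)[of T] T order_trans[OF L2_norm_nonneg] by auto
  have "integral {s..T} (\<lambda>t. grad_sq \<Omega> (v t)) \<le> grad_const K * T + \<xi> / 2 * K\<^sup>2" if s: "0 < s" "s < T" for s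
  proof -
    have "grad_const K * (T - s) \<le> grad_const K * T"
      using s K0 \<mu>_pos \<epsilon>_pos L_pos M_pos vol_nonneg by (intro mult_left_mono) (auto simp: grad_const_def)
    then show ?thesis using evolution_grad_integral[OF e \<xi> s(1) less_imp_le[OF s(2)] order_refl K] by linarith
  qed
  then have "integrable (lebesgue_on {0<..<T}) (\<lambda>t. (H1_norm \<Omega> (v t))\<^sup>2)"
    using evolution_H10[OF e]
    by (intro H1_norm_time_integral(1)[OF T] C_time_L2_norm_continuous[OF C_time_H2_L2[OF v]]
        evolution_grad_continuous[OF e]) auto
  moreover have "AE t in lebesgue_on {0<..<T}. v t \<in> H10_space \<Omega>"
    using evolution_H10[OF e] by (intro AE_I2) auto
  ultimately show ?thesis
    using strongly_measurable_C_time[OF open_domain T v] by (simp add: L2_time_space_def)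
qed

text \<open>Time is split at \<delta>. Before \<delta>, U grows at most linearly from 0 and the
  gradient energies of both solutions are bounded separately; after \<delta>, the Gronwall estimate
  applies. Only the latter involves the bound on \<open>p'\<close>, so the coefficient A is free of
  \<delta>.\<close>

lemma evolution_convergence_bounds:
  assumes T: "T > 0" and e0: "evolution T 0 p q p' q'"
    and ev: "\<And>\<xi>. \<xi> > 0 \<Longrightarrow> evolution T \<xi> (u \<xi>) (v \<xi>) (u' \<xi>) (v' \<xi>)"
    and start: "\<And>\<xi>. \<xi> > 0 \<Longrightarrow> AE x in lebesgue_on \<Omega>. u \<xi> 0 x = p 0 x"
  obtains A where "A \<ge> 0" "\<And>\<delta>. 0 < \<delta> \<Longrightarrow> \<delta> < T \<Longrightarrow> \<exists>B. \<forall>\<xi>>0.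
      (\<forall>t\<in>{0<..T}. (L2_norm \<Omega> (\<lambda>x. u \<xi> t x - p t x))\<^sup>2 \<le> A * \<delta> + B * \<xi>) \<and>
      (\<forall>s. 0 < s \<longrightarrow> s < T \<longrightarrow> integral {s..T} (\<lambda>r. grad_sq \<Omega> (\<lambda>x. v \<xi> r x - q r x)) \<le> A * \<delta> + B * \<xi>)"
proof -
  \<comment> \<open>The first components start from the same data up to a null set, so this K bounds
    the solutions for all \<xi> at once, and differences are bounded by 2 K.\<close>
  define K where "K = size_bound T (L2_norm \<Omega> (p 0))"
  have K0: "L2_norm \<Omega> (p t) \<le> K" "L2_norm \<Omega> (q t) \<le> K" if "t \<in> {0<..T}" for t
    unfolding K_def by (rule evolution_size[OF e0 that])+
  have Kpos: "K \<ge> 0" using K0(1)[of T] T order_trans[OF L2_norm_nonneg] by auto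
  define E where "E = exp ((U_const + V_const) * T)"
  define D where "D = 2 / \<epsilon> * ((2 * K) * (2 * K))"
  define G where "G = grad_const K"
  have E: "E > 0" by (simp add: E_def)
  have D: "D \<ge> 0" using \<epsilon>_pos by (simp add: D_def)
  have G: "G \<ge> 0" using Kpos \<mu>_pos \<epsilon>_pos L_pos M_pos vol_nonneg by (simp add: G_def grad_const_def)
  have lc: "lip_const \<ge> 0" using V_const_nonneg poincare_const_pos by (simp add: lip_const_def)
  \<comment> \<open>The three summands: growth of U before \<delta>; the Gronwall estimate, with 4
    undoing its factor 1 / 4 before the gradient; and the gradient energy of both solutions before
    \<delta>.\<close>
  define A where "A = D + 4 * E * D + 4 * G"
  have ED: "E * D \<ge> 0" using E D by simp
  have A: "A \<ge> 0" using ED D G by (simp add: A_def)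
  have p0: "p 0 \<in> L2_space \<Omega>" using e0 T by (auto simp: evolution_def dest!: C_timeD(1))
  have pc: "continuous_on {0<..T} (\<lambda>t. L2_norm \<Omega> (p' t))"
    using e0 by (intro C_time_L2_norm_continuous) (auto simp: evolution_def has_C1_deriv_def)
  show ?thesis
  proof (rule that[OF A])
    fix \<delta> :: real assume \<delta>: "0 < \<delta>" "\<delta> < T"
    have "bounded ((\<lambda>t. L2_norm \<Omega> (p' t)) ` {\<delta>..T})"
      by (rule compact_imp_bounded, rule compact_continuous_image[OF continuous_on_subset[OF pc]]) (use \<delta> in auto)
    then obtain B where B: "B > 0" "\<And>t. t \<in> {\<delta>..T} \<Longrightarrow> L2_norm \<Omega> (p' t) \<le> B"
      by (auto simp: bounded_pos)
    define C where "C = (2 * K)\<^sup>2 / 2 + (1 + (2 * (2 * K) * (lip_const * (B + 1)) + 1) / 2) * T"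
    have C: "C \<ge> 0" using Kpos B lc T by (simp add: C_def)
    have EC: "E * C \<ge> 0" using E C by simp
    show "\<exists>B. \<forall>\<xi>>0.
      (\<forall>t\<in>{0<..T}. (L2_norm \<Omega> (\<lambda>x. u \<xi> t x - p t x))\<^sup>2 \<le> A * \<delta> + B * \<xi>) \<and>
      (\<forall>s. 0 < s \<longrightarrow> s < T \<longrightarrow> integral {s..T} (\<lambda>r. grad_sq \<Omega> (\<lambda>x. v \<xi> r x - q r x)) \<le> A * \<delta> + B * \<xi>)"
    \<comment> \<open>The first term is the Gronwall contribution, again with 4 undoing 1 / 4. The
      square of K stems from the boundary value in the gradient estimate for positive \<xi> before
      \<delta>.\<close>
    proof (intro exI[of _ "4 * E * C + K\<^sup>2"] allI impI)
      fix \<xi> :: real assume \<xi>: "\<xi> > 0"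
      note e = ev[OF \<xi>] and ae = start[OF \<xi>]
      have u0: "u \<xi> 0 \<in> L2_space \<Omega>" using e T by (auto simp: evolution_def dest!: C_timeD(1))
      have "L2_norm \<Omega> (u \<xi> 0) = L2_norm \<Omega> (p 0)" by (rule L2_norm_cong_AE[OF ae u0 p0])
      then have K1: "L2_norm \<Omega> (u \<xi> t) \<le> K" "L2_norm \<Omega> (v \<xi> t) \<le> K" if "t \<in> {0<..T}" for t
        unfolding K_def using evolution_size[OF e that] by auto
      have "L2_norm \<Omega> (\<lambda>x. u \<xi> 0 x - p 0 x) = L2_norm \<Omega> (\<lambda>x. 0)"
        by (rule L2_norm_cong_AE[OF _ L2_space_diff[OF u0 p0] L2_space_zero]) (use ae in eventually_elim, simp)
      then have init: "L2_norm \<Omega> (\<lambda>x. u \<xi> 0 x - p 0 x) = 0" by simp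
      have l2: "u \<xi> t \<in> L2_space \<Omega>" "v \<xi> t \<in> L2_space \<Omega>" "p t \<in> L2_space \<Omega>" "q t \<in> L2_space \<Omega>" if "t \<in> {0<..T}" for t
        using e e0 that admissible_L2(1,2) unfolding evolution_def by blast+
      have K2: "L2_norm \<Omega> (\<lambda>x. u \<xi> t x - p t x) \<le> 2 * K" "L2_norm \<Omega> (\<lambda>x. v \<xi> t x - q t x) \<le> 2 * K" if t: "t \<in> {0<..T}" for t
        using L2_norm_triangle_diff[OF l2(1,3)[OF t]] L2_norm_triangle_diff[OF l2(2,4)[OF t]] K0[OF t] K1[OF t] by linarith+
      let ?g = "\<lambda>r. grad_sq \<Omega> (\<lambda>x. v \<xi> r x - q r x)"
      have main: "(L2_norm \<Omega> (\<lambda>x. u \<xi> t x - p t x))\<^sup>2 + 1 / 4 * integral {\<delta>..t} ?g \<le> E * D * \<delta> + E * C * \<xi>"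
        if t: "t \<in> {\<delta>..T}" for t
      proof -
        have "E * (D * \<delta> + \<xi> * C) = E * D * \<delta> + E * C * \<xi>" by (simp add: algebra_simps)
        then show ?thesis
          using evolution_difference_estimate[OF \<xi> e e0 K2 init B(2) \<delta>(1) t] unfolding E_def D_def C_def by linarith
      qed
      have gc: "continuous_on {0<..T} ?g"
        using e e0 by (intro C_time_H2_grad_diff_continuous open_domain) (auto simp: evolution_def)
      have gi: "?g integrable_on {a..b}" if "0 < a" "b \<le> T" for a b
        using that by (intro integrable_continuous_real continuous_on_subset[OF gc]) auto
      have gn: "0 \<le> integral {a..b} ?g" if "0 < a" "b \<le> T" for a b
        by (intro Henstock_Kurzweil_Integration.integral_nonneg gi that) simp
      have signs: "0 \<le> D * \<delta>" "0 \<le> E * D * \<delta>" "0 \<le> G * \<delta>" "0 \<le> E * C * \<xi>" "0 \<le> K\<^sup>2 * \<xi>"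
        using D ED G EC \<delta> \<xi> by simp_all
      have rhs: "A * \<delta> + (4 * E * C + K\<^sup>2) * \<xi> = D * \<delta> + 4 * (E * D * \<delta>) + 4 * (G * \<delta>) + 4 * (E * C * \<xi>) + K\<^sup>2 * \<xi>"
        by (simp add: A_def algebra_simps)
      show "(\<forall>t\<in>{0<..T}. (L2_norm \<Omega> (\<lambda>x. u \<xi> t x - p t x))\<^sup>2 \<le> A * \<delta> + (4 * E * C + K\<^sup>2) * \<xi>) \<and>
        (\<forall>s. 0 < s \<longrightarrow> s < T \<longrightarrow> integral {s..T} ?g \<le> A * \<delta> + (4 * E * C + K\<^sup>2) * \<xi>)"
      proof (intro conjI ballI allI impI)
        fix t assume t: "t \<in> {0<..T}"
        show "(L2_norm \<Omega> (\<lambda>x. u \<xi> t x - p t x))\<^sup>2 \<le> A * \<delta> + (4 * E * C + K\<^sup>2) * \<xi>"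
        proof (cases "t \<ge> \<delta>")
          case True
          then show ?thesis using main[of t] gn[of \<delta> t] t \<delta> signs unfolding rhs by auto
        next
          case False
          have "(L2_norm \<Omega> (\<lambda>x. u \<xi> t x - p t x))\<^sup>2 \<le> D * t"
            unfolding D_def by (rule evolution_difference_growth[OF e e0 K2 init t])
          also have "\<dots> \<le> D * \<delta>" using False D by (intro mult_left_mono) auto
          finally show ?thesis using signs unfolding rhs by linarith
        qed
      next
        fix s assume s: "0 < s" "s < T"
        have "T \<in> {\<delta>..T}" using \<delta> by simp
        from main[OF this] have "1 / 4 * integral {\<delta>..T} ?g \<le> E * D * \<delta> + E * C * \<xi>"
          using zero_le_power2[of "L2_norm \<Omega> (\<lambda>x. u \<xi> T x - p T x)"] by linarith
        then have late: "integral {\<delta>..T} ?g \<le> 4 * (E * D * \<delta>) + 4 * (E * C * \<xi>)" by simp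
        show "integral {s..T} ?g \<le> A * \<delta> + (4 * E * C + K\<^sup>2) * \<xi>"
        proof (cases "s \<ge> \<delta>")
          case True
          have "integral {s..T} ?g \<le> integral {\<delta>..T} ?g"
            using True s \<delta> by (intro integral_subset_le gi) auto
          then show ?thesis using late signs unfolding rhs by linarith
        next
          case False
          then have s\<delta>: "s \<le> \<delta>" by simp
          have sub: "{s..\<delta>} \<subseteq> {0<..T}" using s \<delta> by auto
          have ci: "(\<lambda>r. grad_sq \<Omega> (v \<xi> r)) integrable_on {s..\<delta>}" "(\<lambda>r. grad_sq \<Omega> (q r)) integrable_on {s..\<delta>}"
            by (intro integrable_continuous_real continuous_on_subset[OF evolution_grad_continuous[OF e] sub]
                continuous_on_subset[OF evolution_grad_continuous[OF e0] sub])+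
          have "integral {s..\<delta>} ?g \<le> integral {s..\<delta>} (\<lambda>r. 2 * grad_sq \<Omega> (v \<xi> r) + 2 * grad_sq \<Omega> (q r))"
          proof (rule integral_le)
            show "?g integrable_on {s..\<delta>}" using s \<delta> by (intro gi) auto
            show "(\<lambda>r. 2 * grad_sq \<Omega> (v \<xi> r) + 2 * grad_sq \<Omega> (q r)) integrable_on {s..\<delta>}"
              by (intro Henstock_Kurzweil_Integration.integrable_add integrable_on_mult_right ci)
            show "?g r \<le> 2 * grad_sq \<Omega> (v \<xi> r) + 2 * grad_sq \<Omega> (q r)" if "r \<in> {s..\<delta>}" for r
              using that sub by (intro grad_sq_diff_le open_domain H10_H1 evolution_H10[OF e] evolution_H10[OF e0]) auto
          qed
          also have "\<dots> = 2 * integral {s..\<delta>} (\<lambda>r. grad_sq \<Omega> (v \<xi> r)) + 2 * integral {s..\<delta>} (\<lambda>r. grad_sq \<Omega> (q r))"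
            by (subst Henstock_Kurzweil_Integration.integral_add) (auto intro!: integrable_on_mult_right ci)
          also have "\<dots> \<le> 4 * (G * \<delta>) + K\<^sup>2 * \<xi>"
          proof -
            have "G * (\<delta> - s) \<le> G * \<delta>" using G s by (intro mult_left_mono) auto
            moreover have "integral {s..\<delta>} (\<lambda>r. grad_sq \<Omega> (v \<xi> r)) \<le> G * (\<delta> - s) + \<xi> / 2 * K\<^sup>2"
              unfolding G_def using \<xi> by (intro evolution_grad_integral[OF e _ s(1) s\<delta> less_imp_le[OF \<delta>(2)] K1]) auto
            moreover have "integral {s..\<delta>} (\<lambda>r. grad_sq \<Omega> (q r)) \<le> G * (\<delta> - s) + 0 / 2 * K\<^sup>2"
              unfolding G_def by (intro evolution_grad_integral[OF e0 _ s(1) s\<delta> less_imp_le[OF \<delta>(2)] K0]) auto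
            moreover have "\<xi> / 2 * K\<^sup>2 = K\<^sup>2 * \<xi> / 2" by simp
            ultimately show ?thesis by linarith
          qed
          finally have early: "integral {s..\<delta>} ?g \<le> 4 * (G * \<delta>) + K\<^sup>2 * \<xi>" .
          have "integral {s..T} ?g = integral {s..\<delta>} ?g + integral {\<delta>..T} ?g"
            using s \<delta> s\<delta> by (intro Henstock_Kurzweil_Integration.integral_combine[symmetric] gi) auto
          then show ?thesis using early late signs unfolding rhs by linarith
        qed
      qed
    qed
  qed
qed

end

theorem theorem2p4:
  fixes \<Omega> :: "'a::euclidean_space set"
    and T \<mu> M L\<^sub>\<alpha> :: real
    and \<alpha> :: "real \<Rightarrow> real"
    and z0 u0 v0 :: "'a \<Rightarrow> real"
    and u v :: "real \<Rightarrow> real \<Rightarrow> real \<Rightarrow> 'a \<Rightarrow> real"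
  assumes "smooth_bounded_domain \<Omega>"
    and "T > 0"
    and "mono \<alpha>"
    and "\<forall>s. \<exists>r>0. \<exists>L. L-lipschitz_on (cball s r) \<alpha>"
    and "range \<alpha> = UNIV"
    and "\<alpha> 0 = 0"
    and "z0 \<in> Linf_space \<Omega>"
    and "\<mu> > 0"
    and "u0 = (\<lambda>x. \<alpha> (z0 x))"
    and "v0 = (\<lambda>x. z0 x - \<mu> * \<alpha> (z0 x))"
    and "M > 0"
    and "AE x in lebesgue_on \<Omega>. z0 x \<in> {-M..M}"
    and "L\<^sub>\<alpha> > 0"
    and "L\<^sub>\<alpha>-lipschitz_on {-M..M} \<alpha>"
    and "L\<^sub>\<alpha> < 1 / \<mu>"
    and "\<And>\<epsilon> \<xi>. \<epsilon> > 0 \<Longrightarrow> \<xi> \<ge> 0 \<Longrightarrow> strong_solution \<Omega> T \<alpha> \<mu> u0 v0 \<epsilon> \<xi> (u \<epsilon> \<xi>) (v \<epsilon> \<xi>)"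
    and "\<And>\<epsilon> \<xi>. \<epsilon> > 0 \<Longrightarrow> \<xi> \<ge> 0 \<Longrightarrow>
           AE (x, t) in lebesgue_on (Q \<Omega> T). \<mu> * u \<epsilon> \<xi> t x + v \<epsilon> \<xi> t x \<in> {-M..M}"
  shows "\<forall>\<epsilon>>0. converges_L2_Q \<Omega> T (u \<epsilon>) (u \<epsilon> 0) \<and> converges_L2_H10 \<Omega> T (v \<epsilon>) (v \<epsilon> 0)"
proof (intro allI impI)
  fix \<epsilon> :: real assume \<epsilon>: "\<epsilon> > 0"
  note T = \<open>T > 0\<close>
  have dom: "open \<Omega>" "bounded \<Omega>" using assms(1) by (simp_all add: smooth_bounded_domain_def)
  obtain R where R: "R > 0" "\<Omega> \<subseteq> cball 0 R"
    using dom(2) by (auto simp: bounded_pos subset_iff)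
  interpret reaction_diffusion \<Omega> \<alpha> \<mu> \<epsilon> M L\<^sub>\<alpha> R
  proof
    show "L\<^sub>\<alpha> * \<mu> < 1" using \<open>L\<^sub>\<alpha> < 1 / \<mu>\<close> \<open>\<mu> > 0\<close> by (simp add: field_simps)
  qed (use assms dom R \<epsilon> in auto)
  note sol = assms(16)[OF \<epsilon>]
  have "\<exists>u' v'. evolution T \<xi> (u \<epsilon> \<xi>) (v \<epsilon> \<xi>) u' v'" if "\<xi> \<ge> 0" for \<xi>
    using strong_solution_evolution[OF T that sol[OF that] assms(17)[OF \<epsilon> that]] by blast
  then obtain u' v' where ev: "\<And>\<xi>. \<xi> \<ge> 0 \<Longrightarrow> evolution T \<xi> (u \<epsilon> \<xi>) (v \<epsilon> \<xi>) (u' \<xi>) (v' \<xi>)" by metis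
  have init: "AE x in lebesgue_on \<Omega>. u \<epsilon> \<xi> 0 x = u \<epsilon> 0 0 x" if "\<xi> \<ge> 0" for \<xi>
  proof -
    have "AE x in lebesgue_on \<Omega>. u \<epsilon> \<xi> 0 x = u0 x" "AE x in lebesgue_on \<Omega>. u \<epsilon> 0 0 x = u0 x"
      using sol[OF that] sol[of 0] by (auto simp: strong_solution_def)
    then show ?thesis by eventually_elim simp
  qed
  obtain A where A: "A \<ge> 0"
    and bound: "\<And>\<delta>. 0 < \<delta> \<Longrightarrow> \<delta> < T \<Longrightarrow> \<exists>B. \<forall>\<xi>>0.
      (\<forall>t\<in>{0<..T}. (L2_norm \<Omega> (\<lambda>x. u \<epsilon> \<xi> t x - u \<epsilon> 0 t x))\<^sup>2 \<le> A * \<delta> + B * \<xi>) \<and>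
      (\<forall>s. 0 < s \<longrightarrow> s < T \<longrightarrow> integral {s..T} (\<lambda>r. grad_sq \<Omega> (\<lambda>x. v \<epsilon> \<xi> r x - v \<epsilon> 0 r x)) \<le> A * \<delta> + B * \<xi>)"
    by (rule evolution_convergence_bounds[OF T ev[OF order_refl] ev[OF less_imp_le] init[OF less_imp_le]]) (assumption | rule that)+
  have uL: "u \<epsilon> \<xi> t \<in> L2_space \<Omega>" if "\<xi> \<ge> 0" "t \<in> {0<..T}" for \<xi> t
    using ev[OF that(1)] that(2) admissible_L2(1) unfolding evolution_def by blast
  have jm: "jointly_measurable \<Omega> T (u \<epsilon> \<xi>)" if "\<xi> \<ge> 0" for \<xi>
    using sol[OF that] by (simp add: strong_solution_def)
  have jmd: "jointly_measurable \<Omega> T (\<lambda>t x. u \<epsilon> \<xi> t x - u \<epsilon> 0 t x)" if "\<xi> \<ge> 0" for \<xi>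
    using borel_measurable_diff[OF jm[OF that, unfolded jointly_measurable_def] jm[OF order_refl, unfolded jointly_measurable_def]]
    by (simp add: jointly_measurable_def case_prod_beta')
  have uQ: "(\<lambda>(x, t). u \<epsilon> \<xi> t x) \<in> L2_space (Q \<Omega> T)" if "\<xi> \<ge> 0" for \<xi>
  proof (rule L2_Q_bound(1)[OF dom(1) less_imp_le[OF T] _ jm[OF that] uL[OF that]])
    show "(L2_norm \<Omega> (u \<epsilon> \<xi> t))\<^sup>2 \<le> (size_bound T (L2_norm \<Omega> (u \<epsilon> \<xi> 0)))\<^sup>2" if "t \<in> {0<..T}" for t
      using evolution_size(1)[OF ev[OF \<open>\<xi> \<ge> 0\<close>] that] by (intro power_mono) auto
  qed simp
  have "((\<lambda>\<xi>. (L2_norm (Q \<Omega> T) (\<lambda>(x, t). u \<epsilon> \<xi> t x - u \<epsilon> 0 t x))\<^sup>2) \<longlongrightarrow> 0) (at_right 0)"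
  \<comment> \<open>Integrating the bound on the time slices over the cylinder costs a factor
    T.\<close>
  proof (rule tendsto_zero_at_right[OF T, of "A * T"])
    fix \<delta> assume \<delta>: "0 < \<delta>" "\<delta> < T"
    obtain B where B: "\<And>\<xi> t. \<xi> > 0 \<Longrightarrow> t \<in> {0<..T} \<Longrightarrow> (L2_norm \<Omega> (\<lambda>x. u \<epsilon> \<xi> t x - u \<epsilon> 0 t x))\<^sup>2 \<le> A * \<delta> + B * \<xi>"
      using bound[OF \<delta>] by blast
    show "\<exists>B. \<forall>\<xi>>0. (L2_norm (Q \<Omega> T) (\<lambda>(x, t). u \<epsilon> \<xi> t x - u \<epsilon> 0 t x))\<^sup>2 \<le> A * T * \<delta> + B * \<xi>"
    proof (intro exI[of _ "B * T"] allI impI)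
      fix \<xi> :: real assume \<xi>: "\<xi> > 0"
      have "0 \<le> A * \<delta> + B * \<xi>" using B[OF \<xi>, of T] T by (auto intro: order_trans[OF zero_le_power2])
      then have "(L2_norm (Q \<Omega> T) (\<lambda>(x, t). u \<epsilon> \<xi> t x - u \<epsilon> 0 t x))\<^sup>2 \<le> (A * \<delta> + B * \<xi>) * T"
        using \<xi> T B[OF \<xi>] by (intro L2_Q_bound(2)[OF dom(1) _ _ jmd] L2_space_diff uL) auto
      then show "(L2_norm (Q \<Omega> T) (\<lambda>(x, t). u \<epsilon> \<xi> t x - u \<epsilon> 0 t x))\<^sup>2 \<le> A * T * \<delta> + B * T * \<xi>"
        by (simp add: algebra_simps)
    qed
  qed (use A T in auto)
  from tendsto_real_sqrt[OF this]
  have "((\<lambda>\<xi>. L2_norm (Q \<Omega> T) (\<lambda>(x, t). u \<epsilon> \<xi> t x - u \<epsilon> 0 t x)) \<longlongrightarrow> 0) (at_right 0)" by simp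
  then have "converges_L2_Q \<Omega> T (u \<epsilon>) (u \<epsilon> 0)" using uQ by (simp add: converges_L2_Q_def)
  moreover have "((\<lambda>\<xi>. integral\<^sup>L (lebesgue_on {0<..<T}) (\<lambda>t. (H1_norm \<Omega> (\<lambda>x. v \<epsilon> \<xi> t x - v \<epsilon> 0 t x))\<^sup>2)) \<longlongrightarrow> 0) (at_right 0)"
  \<comment> \<open>Poincare's inequality upgrades the gradient bound to the full norm at the cost
    of this factor. The lower limit s of the integrals is arbitrary, so monotone convergence reaches
    the whole interval.\<close>
  proof (rule tendsto_zero_at_right[OF T, of "(1 + poincare_const) * A"])
    fix \<delta> assume \<delta>: "0 < \<delta>" "\<delta> < T"
    obtain B where B: "\<And>\<xi> s. \<xi> > 0 \<Longrightarrow> 0 < s \<Longrightarrow> s < T \<Longrightarrow>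
        integral {s..T} (\<lambda>r. grad_sq \<Omega> (\<lambda>x. v \<epsilon> \<xi> r x - v \<epsilon> 0 r x)) \<le> A * \<delta> + B * \<xi>"
      using bound[OF \<delta>] by blast
    show "\<exists>B. \<forall>\<xi>>0. integral\<^sup>L (lebesgue_on {0<..<T}) (\<lambda>t. (H1_norm \<Omega> (\<lambda>x. v \<epsilon> \<xi> t x - v \<epsilon> 0 t x))\<^sup>2)
        \<le> (1 + poincare_const) * A * \<delta> + B * \<xi>"
    proof (intro exI[of _ "(1 + poincare_const) * B"] allI impI)
      fix \<xi> :: real assume \<xi>: "\<xi> > 0"
      have vH: "v \<epsilon> \<eta> \<in> C_H2 {0<..T} \<Omega>" if "\<eta> \<ge> 0" for \<eta>
        using ev[OF that] by (simp add: evolution_def)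
      have "integral\<^sup>L (lebesgue_on {0<..<T}) (\<lambda>t. (H1_norm \<Omega> (\<lambda>x. v \<epsilon> \<xi> t x - v \<epsilon> 0 t x))\<^sup>2)
          \<le> (1 + poincare_const) * (A * \<delta> + B * \<xi>)"
      proof (rule H1_norm_time_integral(2)[OF T _ _ _ B[OF \<xi>]])
        show "(\<lambda>x. v \<epsilon> \<xi> t x - v \<epsilon> 0 t x) \<in> H10_space \<Omega>" if "t \<in> {0<..T}" for t
          using \<xi> by (intro H10_diff dom evolution_H10[OF ev that]) auto
        show "continuous_on {0<..T} (\<lambda>t. L2_norm \<Omega> (\<lambda>x. v \<epsilon> \<xi> t x - v \<epsilon> 0 t x))"
          using \<xi> by (intro C_time_L2_norm_continuous C_time_L2_diff C_time_H2_L2 vH) auto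
        show "continuous_on {0<..T} (\<lambda>t. grad_sq \<Omega> (\<lambda>x. v \<epsilon> \<xi> t x - v \<epsilon> 0 t x))"
          using \<xi> by (intro C_time_H2_grad_diff_continuous dom vH) auto
      qed
      then show "integral\<^sup>L (lebesgue_on {0<..<T}) (\<lambda>t. (H1_norm \<Omega> (\<lambda>x. v \<epsilon> \<xi> t x - v \<epsilon> 0 t x))\<^sup>2)
          \<le> (1 + poincare_const) * A * \<delta> + (1 + poincare_const) * B * \<xi>"
        by (simp add: algebra_simps)
    qed
  qed (use A poincare_const_pos in auto)
  from tendsto_real_sqrt[OF this]
  have "((\<lambda>\<xi>. L2_time_norm T (H1_norm \<Omega>) (\<lambda>t x. v \<epsilon> \<xi> t x - v \<epsilon> 0 t x)) \<longlongrightarrow> 0) (at_right 0)"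
    by (simp add: L2_time_norm_def)
  then have "converges_L2_H10 \<Omega> T (v \<epsilon>) (v \<epsilon> 0)"
    using evolution_L2_time_space[OF ev T] by (simp add: converges_L2_H10_def)
  ultimately show "converges_L2_Q \<Omega> T (u \<epsilon>) (u \<epsilon> 0) \<and> converges_L2_H10 \<Omega> T (v \<epsilon>) (v \<epsilon> 0)" ..
qed

end
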